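(* Let $p>2$, $\alpha,\beta\in(1,\infty)$ with $\frac1\alpha+\frac1\beta=1$, assume $\sigma$ satisfies $(I_{p(\alpha\vee\beta)})$, let $\theta\in(0,\frac1{2\beta})$ and $r>0$ with $r<(\frac1{2\beta}-\theta)\wedge(\theta p-1)$. Let $(N_n)_{n\in\mathbb N}$ be positive integers, put $\varepsilon_n:=5\rho(n)+A_{2\beta}(2N_n+1)^{-1}$, assume $\sum_n\varepsilon_n^{\theta p-r}<\infty$, and let $(M_n)$ be positive integers with $M_n\le K\varepsilon_n^{-r}$ for a constant $K>0$. Then almost surely $$\lim_{n\to\infty}\sup_{t\in[-\pi,\pi]}\big|T_{M_n}[v](t)-T^B_{n,N_n,M_n}[v](t)\big|=0.$$
   Context: $(\Omega,\mathcal F,(\mathcal F_t)_{t\in[-\pi,\pi]},P)$ is a filtered probability space satisfying the usual conditions and carrying a standard Brownian motion $W$. $\sigma=(\sigma_t)_{t\in[-\pi,\pi]}$ is a real-valued progressively measurable process with continuous paths, $x\in\mathbb R$, and $H_t=x+\int_{-\pi}^t\sigma_s\,dW_s$; $v_t:=\sigma_t^2$. For $a>0$, $\sigma$ satisfies $(I_a)$ if $E[\int_{-\pi}^{\pi}|\sigma_z|^a\,dz]<\infty$. Write $i$ for the imaginary unit; $\mathcal F[\phi](q):=\frac1{2\pi}\int_{-\pi}^{\pi}e^{-iqt}\phi(t)\,dt$. For each $n$, $\nu^n=\{-\pi=t^n_0\le\dots\le t^n_{m_n}=\pi\}$ is a partition of $[-\pi,\pi]$ with mesh $\rho(n):=\max_i|t^n_{i+1}-t^n_i|$,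 and $\lfloor t\rfloor_n:=\sup\{z\in\nu^n:z\le t\}$. For $q\in\mathbb Z$: $\Gamma_z(q,n):=\frac1{2\pi}\int_{-\pi}^z e^{-iq\lfloor t\rfloor_n}\,dH_t$, $\mathcal F_n[dH](q):=\Gamma_\pi(q,n)$, $\mathcal F^B_{n,N}[v](q):=\frac{2\pi}{2N+1}\sum_{|l|\le N}\mathcal F_n[dH](l)\,\mathcal F_n[dH](q-l)$. Trigonometric polynomials: $T_M[v](t):=\sum_{|l|\le M}(1-\frac{|l|}{M})\mathcal F[v](l)e^{ilt}$ and $T^B_{n,N,M}[v](t):=\sum_{|l|\le M}(1-\frac{|l|}{M})\mathcal F^B_{n,N}[v](l)e^{ilt}$. For $r>1$, $A_r:=5+\frac{2\pi^r}{r-1}$. *)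

theory Defs
  imports "HOL-Probability.Probability"
begin

definition filtration_on :: "'a measure \<Rightarrow> (real \<Rightarrow> 'a set set) \<Rightarrow> bool" where
  "filtration_on M F \<longleftrightarrow>
     (\<forall>t\<in>{-pi..pi}. sigma_algebra (space M) (F t) \<and> F t \<subseteq> sets M) \<and>
     (\<forall>s\<in>{-pi..pi}. \<forall>t\<in>{-pi..pi}. s \<le> t \<longrightarrow> F s \<subseteq> F t)"

definition usual_conditions :: "'a measure \<Rightarrow> (real \<Rightarrow> 'a set set) \<Rightarrow> bool" where
  "usual_conditions M F \<longleftrightarrow>
     (\<forall>A. A \<subseteq> space M \<and> (\<exists>B\<in>null_sets M. A \<subseteq> B) \<longrightarrow> A \<in> F (-pi)) \<and>
     (\<forall>t. -pi \<le> t \<and> t < pi \<longrightarrow> F t = (\<Inter>s\<in>{t<..pi}. F s))"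

definition adapted :: "'a measure \<Rightarrow> (real \<Rightarrow> 'a set set) \<Rightarrow> (real \<Rightarrow> 'a \<Rightarrow> real) \<Rightarrow> bool" where
  "adapted M F X \<longleftrightarrow> (\<forall>t\<in>{-pi..pi}. X t \<in> measurable (sigma (space M) (F t)) borel)"

definition progressive :: "'a measure \<Rightarrow> (real \<Rightarrow> 'a set set) \<Rightarrow> (real \<Rightarrow> 'a \<Rightarrow> real) \<Rightarrow> bool" where
  "progressive M F X \<longleftrightarrow> (\<forall>t\<in>{-pi..pi}.
     (\<lambda>(s, w). X s w) \<in> borel_measurable
        (restrict_space lborel {-pi..t} \<Otimes>\<^sub>M sigma (space M) (F t)))"

definition brownian_motion :: "'a measure \<Rightarrow> (real \<Rightarrow> 'a set set) \<Rightarrow> (real \<Rightarrow> 'a \<Rightarrow> real) \<Rightarrow> bool" where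
  "brownian_motion M F W \<longleftrightarrow>
     adapted M F W \<and>
     (\<forall>w\<in>space M. W (-pi) w = 0 \<and> continuous_on {-pi..pi} (\<lambda>t. W t w)) \<and>
     (\<forall>s\<in>{-pi..pi}. \<forall>t\<in>{-pi..pi}. s < t \<longrightarrow>
        distributed M lborel (\<lambda>w. W t w - W s w) (normal_density 0 (sqrt (t - s))) \<and>
        (\<forall>A\<in>F s. \<forall>B\<in>sets borel.
           measure M (A \<inter> ((\<lambda>w. W t w - W s w) -` B \<inter> space M))
             = measure M A * measure M ((\<lambda>w. W t w - W s w) -` B \<inter> space M)))"

definition conv_in_prob :: "'a measure \<Rightarrow> (nat \<Rightarrow> 'a \<Rightarrow> real) \<Rightarrow> ('a \<Rightarrow> real) \<Rightarrow> bool" where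
  "conv_in_prob M X Y \<longleftrightarrow>
     (\<forall>e>0. (\<lambda>m. measure M {w\<in>space M. \<bar>X m w - Y w\<bar> > e}) \<longlonglongrightarrow> 0)"

definition riemann_ito_sum :: "(real \<Rightarrow> 'a \<Rightarrow> real) \<Rightarrow> (real \<Rightarrow> 'a \<Rightarrow> real) \<Rightarrow> real \<Rightarrow> nat \<Rightarrow> 'a \<Rightarrow> real" where
  "riemann_ito_sum X W t m w =
     (let h = (t + pi) / real (Suc m) in
      \<Sum>k\<le>m. X (-pi + real k * h) w * (W (-pi + real (Suc k) * h) w - W (-pi + real k * h) w))"

text \<open>H is (a version of) x + int_{-pi}^t sigma dW: for a continuous adapted integrand the
  Ito integral is the limit in probability of left-point Riemann sums.\<close>
definition is_ito_process :: "'a measure \<Rightarrow> real \<Rightarrow> (real \<Rightarrow> 'a \<Rightarrow> real) \<Rightarrow> (real \<Rightarrow> 'a \<Rightarrow> real)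
    \<Rightarrow> (real \<Rightarrow> 'a \<Rightarrow> real) \<Rightarrow> bool" where
  "is_ito_process M x \<sigma> W H \<longleftrightarrow>
     (\<forall>t\<in>{-pi..pi}. H t \<in> borel_measurable M \<and>
        conv_in_prob M (\<lambda>m w. x + riemann_ito_sum \<sigma> W t m w) (H t))"

definition cond_I :: "'a measure \<Rightarrow> real \<Rightarrow> (real \<Rightarrow> 'a \<Rightarrow> real) \<Rightarrow> bool" where
  "cond_I M a \<sigma> \<longleftrightarrow>
     (\<integral>\<^sup>+ w. (\<integral>\<^sup>+ z\<in>{-pi..pi}. ennreal (\<bar>\<sigma> z w\<bar> powr a) \<partial>lborel) \<partial>M) < \<infinity>"

definition partitions :: "(nat \<Rightarrow> nat \<Rightarrow> real) \<Rightarrow> (nat \<Rightarrow> nat) \<Rightarrow> bool" where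
  "partitions tp m \<longleftrightarrow> (\<forall>n. tp n 0 = -pi \<and> tp n (m n) = pi \<and>
      (\<forall>i<m n. tp n i \<le> tp n (Suc i)))"

definition mesh :: "(nat \<Rightarrow> nat \<Rightarrow> real) \<Rightarrow> (nat \<Rightarrow> nat) \<Rightarrow> nat \<Rightarrow> real" where
  "mesh tp m n = Max {\<bar>tp n (Suc i) - tp n i\<bar> | i. i < m n}"

definition fourier :: "(real \<Rightarrow> real) \<Rightarrow> int \<Rightarrow> complex" where
  "fourier \<phi> q = integral {-pi..pi} (\<lambda>t. exp (- \<i> * of_int q * of_real t) * of_real (\<phi> t)) / (2 * pi)"

text \<open>F_n[dH](q) = 1/(2 pi) int_{-pi}^{pi} e^{-iq floor(t)_n} dH_t; the integrand is the
  step function equal to e^{-iq t_i} on [t_i, t_{i+1}), so the stochastic integral is the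
  elementary sum below.\<close>
definition fourier_dH :: "(nat \<Rightarrow> nat \<Rightarrow> real) \<Rightarrow> (nat \<Rightarrow> nat) \<Rightarrow> (real \<Rightarrow> 'a \<Rightarrow> real)
    \<Rightarrow> nat \<Rightarrow> int \<Rightarrow> 'a \<Rightarrow> complex" where
  "fourier_dH tp m H n q w =
     (\<Sum>i<m n. exp (- \<i> * of_int q * of_real (tp n i)) * of_real (H (tp n (Suc i)) w - H (tp n i) w))
       / (2 * pi)"

definition fourier_B :: "(nat \<Rightarrow> nat \<Rightarrow> real) \<Rightarrow> (nat \<Rightarrow> nat) \<Rightarrow> (real \<Rightarrow> 'a \<Rightarrow> real)
    \<Rightarrow> nat \<Rightarrow> nat \<Rightarrow> int \<Rightarrow> 'a \<Rightarrow> complex" where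
  "fourier_B tp m H n N q w =
     (2 * pi / (2 * of_nat N + 1)) *
       (\<Sum>l\<in>{-int N..int N}. fourier_dH tp m H n l w * fourier_dH tp m H n (q - l) w)"

definition T_poly :: "nat \<Rightarrow> (real \<Rightarrow> real) \<Rightarrow> real \<Rightarrow> complex" where
  "T_poly M v t = (\<Sum>l\<in>{-int M..int M}.
      of_real (1 - \<bar>real_of_int l\<bar> / real M) * fourier v l * exp (\<i> * of_int l * of_real t))"

definition T_B_poly :: "(nat \<Rightarrow> nat \<Rightarrow> real) \<Rightarrow> (nat \<Rightarrow> nat) \<Rightarrow> (real \<Rightarrow> 'a \<Rightarrow> real)
    \<Rightarrow> nat \<Rightarrow> nat \<Rightarrow> nat \<Rightarrow> 'a \<Rightarrow> real \<Rightarrow> complex" where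
  "T_B_poly tp m H n N M w t = (\<Sum>l\<in>{-int M..int M}.
      of_real (1 - \<bar>real_of_int l\<bar> / real M) * fourier_B tp m H n N l w * exp (\<i> * of_int l * of_real t))"

definition A_const :: "real \<Rightarrow> real" where
  "A_const r = 5 + 2 * pi powr r / (r - 1)"

end

theory Submission
  imports Defs
begin

text \<open>
  On the cells of the partition, \<open>2\<pi> F\<^sup>B(q)\<close> is the quadratic form
  \<open>\<Sum> e\<^sup>-\<^sup>i\<^sup>q\<^sup>t\<^sup>j D(t\<^sub>k - t\<^sub>j) y\<^sub>k y\<^sub>j\<close> in the increments \<open>y\<^sub>k\<close> of \<open>H\<close>, where \<open>D\<close> is the normalised
  Dirichlet kernel. Its diagonal produces \<open>\<integral> e\<^sup>-\<^sup>i\<^sup>q\<^sup>\<lfloor>\<^sup>t\<^sup>\<rfloor> v dt\<close>, which differs from \<open>2\<pi> F[v](q)\<close> by at most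
  \<open>\<bar>q\<bar> \<rho> \<integral> v\<close> on every path. What remains is an iterated stochastic integral, whose moment of
  order \<open>2\<kappa>\<close> is at most \<open>C \<epsilon>\<^sup>\<kappa> E \<integral> \<sigma>\<^sup>4\<^sup>\<kappa>\<close>, because the Riemann sums of \<open>D\<^sup>2\<close> are \<open>O(\<epsilon>)\<close>. Summing over
  \<open>\<bar>q\<bar> \<le> M\<close> gives moments that are summable in \<open>n\<close> for a suitable integer \<open>\<kappa>\<close>.

  No stochastic calculus is needed: \<open>H\<close> is approximated along grids refining the partition, and the
  moment bounds for the discrete martingale transforms follow from a Taylor expansion of
  \<open>(S + X \<Delta>W)\<^sup>2\<^sup>\<kappa>\<close> and a Gronwall argument. A general \<open>\<sigma>\<close> is first truncated; the truncated and
  the original Riemann sums agree where \<open>\<bar>\<sigma>\<bar>\<close> stays below the truncation level.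
\<close>

section \<open>Brownian increments\<close>

text \<open>Three limits are nested: refinement of the grid, removal of the truncation, and
  \<open>n\<close>. The first two are passed by Fatou's lemma, so the moment bounds must not depend
  on the refinement or on the truncation level \<open>R\<close>. They are therefore expressed
  through a budget \<open>G\<close> for the row sums of the squared kernel and through the expected
  time integral of sigma^(4k). Going from order 2k to 4k is the price of the two factors sigma in an
  iterated integral. The supremum over t is replaced by a sum over L = 2M + 1 frequencies. A crude
  count gives expectations of order L^(2k+1) \<epsilon>^k, and M \<le> K \<epsilon>^(-r) turns this
  into \<epsilon>^(k(1-2r) - r). Summability thus asks for k(1-2r) \<ge> \<theta> p, integrability
  for 4k \<le> p max(\<alpha>,\<beta>); both hold when k is p/(2\<beta>) rounded up.\<close>

locale filtered_brownian_motion = prob_space M for M :: "'a measure" +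
  fixes F :: "real \<Rightarrow> 'a set set" and W :: "real \<Rightarrow> 'a \<Rightarrow> real"
  assumes filt: "filtration_on M F" and bm: "brownian_motion M F W"
begin

abbreviation FM :: "real \<Rightarrow> 'a measure" where "FM t \<equiv> sigma (space M) (F t)"

lemma sets_FM: "t \<in> {-pi..pi} \<Longrightarrow> sets (FM t) = F t"
  using filt by (auto simp: filtration_on_def sigma_algebra.sets_measure_of_eq)

lemma space_FM [simp]: "space (FM t) = space M"
  by (simp add: space_measure_of_conv)

lemma measurable_FM_mono:
  assumes "X \<in> borel_measurable (FM s)" "s \<le> t" "s \<in> {-pi..pi}" "t \<in> {-pi..pi}"
  shows "X \<in> borel_measurable (FM t)"
proof -
  have "sets (FM s) \<subseteq> sets (FM t)"
    using assms filt by (simp add: sets_FM filtration_on_def)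
  then show ?thesis
    using assms(1) by (auto simp: measurable_def)
qed

lemma measurable_FM_M:
  assumes "X \<in> borel_measurable (FM s)" "s \<in> {-pi..pi}"
  shows "X \<in> borel_measurable M"
proof -
  have "sets (FM s) \<subseteq> sets M"
    using assms filt by (simp add: sets_FM filtration_on_def)
  then show ?thesis
    using assms(1) by (auto simp: measurable_def)
qed

lemma W_FM: "t \<in> {-pi..pi} \<Longrightarrow> W t \<in> borel_measurable (FM t)"
  using bm by (simp add: brownian_motion_def adapted_def)

lemma W_M [measurable]: "t \<in> {-pi..pi} \<Longrightarrow> W t \<in> borel_measurable M"
  using W_FM measurable_FM_M by blast

lemma indep_increment:
  assumes "s < t" "s \<in> {-pi..pi}" "t \<in> {-pi..pi}" "Z \<in> borel_measurable (FM s)"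
  shows "indep_var borel Z borel (\<lambda>w. W t w - W s w)"
proof -
  let ?D = "\<lambda>w. W t w - W s w"
  have ZM: "Z \<in> borel_measurable M"
    using assms measurable_FM_M by blast
  have DM: "?D \<in> borel_measurable M"
    using assms by measurable
  \<comment> \<open>The definition of Brownian motion gives the product formula for single events,
    while \<open>indep_var_eq\<close> asks for it on generated sigma-algebras. Preimages of Borel
    sets already form a sigma-algebra, so \<open>sigma_sets\<close> drops out.\<close>
  have alg: "sigma_sets (space M) {X -` A \<inter> space M |A. A \<in> sets borel} = {X -` A \<inter> space M |A. A \<in> sets borel}"
    for X :: "'a \<Rightarrow> real"
    using sigma_sets_vimage_commute[of X "space M" UNIV "sets borel"]
      sets.sigma_sets_eq[of "borel :: real measure"] by simp
  have "prob ((Z -` A \<inter> space M) \<inter> (?D -` B \<inter> space M)) = prob (Z -` A \<inter> space M) * prob (?D -` B \<inter> space M)"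
    if "A \<in> sets borel" "B \<in> sets borel" for A B
  proof -
    have "Z -` A \<inter> space M \<in> F s"
      using measurable_sets[OF assms(4) that(1)] sets_FM[OF assms(2)] by simp
    then show ?thesis
      using bm assms that by (simp add: brownian_motion_def)
  qed
  then show ?thesis
    unfolding indep_var_eq alg indep_sets2_eq using ZM DM by (auto simp: measurable_sets)
qed

text \<open>This is the double factorial (2k-1)!!, the moment of order 2k of the standard normal
  law.\<close>

definition gauss_moment :: "nat \<Rightarrow> real" where
  "gauss_moment k = fact (2 * k) / (2 ^ k * fact k)"

lemma increment_distr:
  assumes "s < t" "s \<in> {-pi..pi}" "t \<in> {-pi..pi}"
  shows "distributed M lborel (\<lambda>w. W t w - W s w) (normal_density 0 (sqrt (t - s)))"
  using bm assms by (simp add: brownian_motion_def)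

lemma increment_integrable [simp, intro]:
  assumes "s \<le> t" "s \<in> {-pi..pi}" "t \<in> {-pi..pi}"
  shows "integrable M (\<lambda>w. (W t w - W s w) ^ k)"
\<comment> \<open>Equal times are a separate case here and below: the normal law is given only for
  \<open>s < t\<close>, while grids may repeat points.\<close>
proof (cases "s = t")
  case False
  then have st: "s < t" "sqrt (t - s) > 0" using assms by auto
  have "integrable lborel (\<lambda>x. normal_density 0 (sqrt (t - s)) x * x ^ k)"
    using integrable_normal_moment[OF st(2), of 0 k] by simp
  then show ?thesis
    using distributed_integrable[OF increment_distr[OF st(1) assms(2,3)], of "\<lambda>x. x ^ k"] by simp
qed simp

lemma increment_moment_even:
  assumes "s \<le> t" "s \<in> {-pi..pi}" "t \<in> {-pi..pi}"
  shows "expectation (\<lambda>w. (W t w - W s w) ^ (2 * k)) = gauss_moment k * (t - s) ^ k"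
proof (cases "s = t")
  case False
  then have st: "s < t" "sqrt (t - s) > 0" using assms by auto
  show ?thesis
    using integral_normal_moment_even[OF st(2), of 0 k] st
      distributed_integral[OF increment_distr[OF st(1) assms(2,3)], of "\<lambda>x. x ^ (2 * k)"]
    by (simp add: gauss_moment_def field_simps)
qed (cases k; simp add: gauss_moment_def prob_space)

lemma increment_moment_1:
  assumes "s \<le> t" "s \<in> {-pi..pi}" "t \<in> {-pi..pi}"
  shows "expectation (\<lambda>w. W t w - W s w) = 0"
proof (cases "s = t")
  case False
  then have st: "s < t" "sqrt (t - s) > 0" using assms by auto
  show ?thesis
    using integral_normal_moment_odd[OF st(2), of 0 0] st
      distributed_integral[OF increment_distr[OF st(1) assms(2,3)], of "\<lambda>x. x"]
    by simp
qed simp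

text \<open>All moment estimates use the independence of an increment from the past through this
  factorisation, which takes the place of conditional expectations.\<close>

lemma integrable_times_increment:
  assumes "s \<le> t" "s \<in> {-pi..pi}" "t \<in> {-pi..pi}" "Z \<in> borel_measurable (FM s)" "integrable M Z"
  shows "integrable M (\<lambda>w. Z w * (W t w - W s w) ^ k)"
    and "expectation (\<lambda>w. Z w * (W t w - W s w) ^ k) = expectation Z * expectation (\<lambda>w. (W t w - W s w) ^ k)"
proof -
  have *: "integrable M (\<lambda>w. Z w * (W t w - W s w) ^ k) \<and>
     expectation (\<lambda>w. Z w * (W t w - W s w) ^ k) = expectation Z * expectation (\<lambda>w. (W t w - W s w) ^ k)"
  proof (cases "s = t")
    case True
    then show ?thesis using assms by (simp add: prob_space)
  next
    case False
    then have st: "s < t" using assms by auto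
    have "indep_var borel (id \<circ> Z) borel ((\<lambda>x. x ^ k) \<circ> (\<lambda>w. W t w - W s w))"
      by (rule indep_var_compose[OF indep_increment[OF st assms(2-4)]]) auto
    then have "indep_var borel Z borel (\<lambda>w. (W t w - W s w) ^ k)"
      by (simp add: o_def)
    from indep_var_integrable[OF this] indep_var_lebesgue_integral[OF this] show ?thesis
      using assms by auto
  qed
  then show "integrable M (\<lambda>w. Z w * (W t w - W s w) ^ k)"
    and "expectation (\<lambda>w. Z w * (W t w - W s w) ^ k) = expectation Z * expectation (\<lambda>w. (W t w - W s w) ^ k)"
    by auto
qed

end

section \<open>Moments of martingale transforms\<close>

text \<open>The linear term is kept exactly because its expectation will vanish when
  \<open>b\<close> contains a centred increment. Each later binomial term carries
  \<open>b\<^sup>2\<close>, so it is dominated by the two extreme monomials, and the binomial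
  coefficients add up to at most \<open>2 ^ (n + 2)\<close>.\<close>

lemma add_power_le_taylor2:
  fixes a b :: real
  shows "(a + b) ^ (n + 2) \<le> a ^ (n + 2) + real (n + 2) * a ^ (n + 1) * b
           + 2 ^ (n + 2) * (\<bar>a\<bar> ^ n * b\<^sup>2 + \<bar>b\<bar> ^ (n + 2))"
proof -
  let ?m = "\<bar>a\<bar> ^ n * b\<^sup>2 + \<bar>b\<bar> ^ (n + 2)"
  let ?t = "\<lambda>k. real (n + 2 choose k) * b ^ k * a ^ (n + 2 - k)"
  have le: "?t (k + 2) \<le> real (n + 2 choose (k + 2)) * ?m" if "k \<le> n" for k
  proof -
    have "\<bar>b\<bar> ^ k * \<bar>a\<bar> ^ (n - k) \<le> max \<bar>a\<bar> \<bar>b\<bar> ^ k * max \<bar>a\<bar> \<bar>b\<bar> ^ (n - k)"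
      by (intro mult_mono power_mono) auto
    also have "\<dots> = max \<bar>a\<bar> \<bar>b\<bar> ^ n"
      using that by (simp flip: power_add)
    also have "\<dots> \<le> \<bar>a\<bar> ^ n + \<bar>b\<bar> ^ n"
      by (auto simp: max_def)
    finally have "\<bar>b\<bar> ^ k * \<bar>a\<bar> ^ (n - k) * b\<^sup>2 \<le> (\<bar>a\<bar> ^ n + \<bar>b\<bar> ^ n) * b\<^sup>2"
      by (intro mult_right_mono) auto
    also have "\<dots> = ?m"
      by (simp add: algebra_simps power_add power2_eq_square)
    finally have m: "\<bar>b\<bar> ^ k * \<bar>a\<bar> ^ (n - k) * b\<^sup>2 \<le> ?m" .
    have "b ^ (k + 2) * a ^ (n - k) \<le> \<bar>b ^ (k + 2) * a ^ (n - k)\<bar>"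
      by simp
    also have "\<dots> = \<bar>b\<bar> ^ k * \<bar>a\<bar> ^ (n - k) * b\<^sup>2"
      by (simp add: abs_mult power_abs power_add power2_eq_square)
    finally show ?thesis
      using m by (simp add: mult.assoc mult_left_mono)
  qed
  have "(a + b) ^ (n + 2) = (\<Sum>k\<le>Suc (Suc n). ?t k)"
    using binomial_ring[of b a "n + 2"] by (simp add: add.commute numeral_2_eq_2)
  also have "\<dots> = ?t 0 + ?t 1 + (\<Sum>k\<le>n. ?t (k + 2))"
    by (subst sum.atMost_Suc_shift, subst sum.atMost_Suc_shift) (simp add: add.assoc numeral_2_eq_2)
  also have "(\<Sum>k\<le>n. ?t (k + 2)) \<le> (\<Sum>k\<le>n. real (n + 2 choose (k + 2)) * ?m)"
    by (intro sum_mono le) simp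
  also have "\<dots> = (\<Sum>k\<le>n. real (n + 2 choose (k + 2))) * ?m"
    by (simp add: sum_distrib_right)
  also have "\<dots> \<le> 2 ^ (n + 2) * ?m"
  proof (rule mult_right_mono)
    have "(\<Sum>k\<le>n. real (n + 2 choose (k + 2))) \<le> (\<Sum>k\<le>Suc (Suc n). real (n + 2 choose k))"
      by (subst sum.atMost_Suc_shift, subst sum.atMost_Suc_shift) (simp add: numeral_2_eq_2)
    also have "\<dots> = real (\<Sum>k\<le>n+2. n + 2 choose k)"
      by simp
    also have "\<dots> = 2 ^ (n + 2)"
      by (subst choose_row_sum) simp
    finally show "(\<Sum>k\<le>n. real (n + 2 choose (k + 2))) \<le> 2 ^ (n + 2)" .
  qed simp
  finally show ?thesis
    by (simp add: mult_ac)
qed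

text \<open>The redundant exponents 0 and 1 give every term the shape (power of \<open>a\<close>)
  (power of \<open>x\<close>) (power of \<open>y\<close>) with total degree \<open>2 * Suc j\<close>
  in \<open>a\<close> and \<open>x\<close>. One integrability and factorisation fact then covers all
  of them.\<close>

lemma add_power_le_taylor2_even:
  fixes a d x y :: real
  shows "(a + d * x * y) ^ (2 * Suc j) \<le> a ^ (2 * Suc j) + real (2 * Suc j) * d * (a ^ Suc (2 * j) * x ^ 1 * y ^ 1)
     + 4 ^ Suc j * (d\<^sup>2 * (a ^ (2 * j) * x ^ 2 * y ^ (2 * 1)) + d ^ (2 * Suc j) * (a ^ 0 * x ^ (2 * Suc j) * y ^ (2 * Suc j)))"
proof -
  have e: "2 * Suc j = 2 * j + 2" by simp
  have "\<bar>d * x * y\<bar> ^ (2 * j + 2) = (d * x * y) ^ (2 * j + 2)" "\<bar>a\<bar> ^ (2 * j) = a ^ (2 * j)"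
    using power_even_abs[of "2 * j + 2"] power_even_abs[of "2 * j"] by (simp_all del: power_Suc mult_Suc_right add: power_add)
  moreover have "(2::real) ^ (2 * j + 2) = 4 ^ Suc j"
    by (simp add: power_mult)
  ultimately show ?thesis
    using add_power_le_taylor2[of a "d * x * y" "2 * j"] unfolding e 
    by (simp only: power_mult_distrib) (simp add: mult_ac)
qed

text \<open>Young's inequality, by cases on whether \<open>x\<^sup>2 G \<le> a\<^sup>2\<close>.\<close>
lemma young_even_power:
  fixes a x G :: real
  assumes "G > 0"
  shows "a ^ (2 * j) * x\<^sup>2 \<le> a ^ (2 * Suc j) / G + G ^ j * x ^ (2 * Suc j)"
proof (cases "x\<^sup>2 * G \<le> a\<^sup>2")
  case True
  then have "x\<^sup>2 \<le> a\<^sup>2 / G" using assms by (simp add: field_simps)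
  then have "a ^ (2 * j) * x\<^sup>2 \<le> a ^ (2 * j) * (a\<^sup>2 / G)"
    by (intro mult_left_mono) (auto simp: power_mult)
  also have "\<dots> = a ^ (2 * Suc j) / G"
    by (simp add: power2_eq_square)
  also have "\<dots> \<le> a ^ (2 * Suc j) / G + G ^ j * x ^ (2 * Suc j)"
    using assms by (simp add: zero_le_even_power del: power_Suc mult_Suc_right)
  finally show ?thesis .
next
  case False
  then have "(a\<^sup>2) ^ j \<le> (x\<^sup>2 * G) ^ j"
    by (intro power_mono) auto
  then have "a ^ (2 * j) * x\<^sup>2 \<le> (x\<^sup>2 * G) ^ j * x\<^sup>2"
    by (intro mult_right_mono) (auto simp: power_mult)
  also have "\<dots> = G ^ j * x ^ (2 * Suc j)"
    by (simp add: power_mult power_mult_distrib power2_eq_square)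
  also have "\<dots> \<le> a ^ (2 * Suc j) / G + G ^ j * x ^ (2 * Suc j)"
    using assms by (simp add: zero_le_even_power del: power_Suc mult_Suc_right)
  finally show ?thesis .
qed

lemma abs_power_mult_le:
  fixes a x :: real
  assumes "i + j = 2 * n"
  shows "\<bar>a ^ i * x ^ j\<bar> \<le> a ^ (2 * n) + x ^ (2 * n)"
proof -
  have "\<bar>a ^ i * x ^ j\<bar> \<le> max \<bar>a\<bar> \<bar>x\<bar> ^ i * max \<bar>a\<bar> \<bar>x\<bar> ^ j"
    unfolding abs_mult power_abs by (intro mult_mono power_mono) auto
  also have "\<dots> = max \<bar>a\<bar> \<bar>x\<bar> ^ (2 * n)"
    by (simp flip: power_add add: assms)
  also have "\<dots> \<le> a ^ (2 * n) + x ^ (2 * n)"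
    by (auto simp: max_def power_mult)
  finally show ?thesis .
qed

context filtered_brownian_motion
begin

text \<open>\<open>4 ^ k\<close> bounds the binomial coefficients in the Taylor remainder; the
  summand 1 belongs to its mixed term and \<open>gauss_moment k\<close> to its pure power of the
  increment.\<close>

definition step_const :: "nat \<Rightarrow> real" where
  "step_const k = 4 ^ k * (1 + gauss_moment k)"

lemma gauss_moment_nonneg: "gauss_moment k \<ge> 0"
  by (simp add: gauss_moment_def)

lemma step_const_pos: "step_const k > 0"
  by (simp add: step_const_def gauss_moment_nonneg add_pos_nonneg)

text \<open>\<open>G\<close> is meant as a budget for the sum of all
  \<open>d\<^sup>2 * (t - s)\<close> along a grid. Young's inequality with this \<open>G\<close>
  splits the mixed term S^(2j) X^2: one part only multiplies the old moment by 1 + C g / G, and such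
  factors have a bounded product over the grid; the other part is a source term of order g G^j. The
  bound g \<le> G brings the pure power g^(j+1) to the same order.\<close>

lemma one_step_moment:
  assumes st: "s \<le> t" "s \<in> {-pi..pi}" "t \<in> {-pi..pi}"
    and SX: "S \<in> borel_measurable (FM s)" "X \<in> borel_measurable (FM s)"
    and int: "integrable M (\<lambda>w. S w ^ (2 * Suc j))" "integrable M (\<lambda>w. X w ^ (2 * Suc j))"
    and G: "G > 0" "d\<^sup>2 * (t - s) \<le> G"
  defines "g \<equiv> d\<^sup>2 * (t - s)" and "C \<equiv> step_const (Suc j)"
  shows "integrable M (\<lambda>w. (S w + d * X w * (W t w - W s w)) ^ (2 * Suc j))" (is ?I)
    and "expectation (\<lambda>w. (S w + d * X w * (W t w - W s w)) ^ (2 * Suc j))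
       \<le> (1 + C * g / G) * expectation (\<lambda>w. S w ^ (2 * Suc j))
          + C * g * G ^ j * expectation (\<lambda>w. X w ^ (2 * Suc j))" (is ?E)
proof -
  let ?n = "2 * Suc j"
  let ?D = "\<lambda>w. W t w - W s w"
  have [measurable]: "S \<in> borel_measurable M" "X \<in> borel_measurable M" 
      "W s \<in> borel_measurable M" "W t \<in> borel_measurable M"
    using SX st by (auto intro: measurable_FM_M)
  note [measurable] = SX
  have g0: "g \<ge> 0" "g \<le> G" using st G by (auto simp: g_def)
  have mixed: "integrable M (\<lambda>w. S w ^ i * X w ^ l)" if "i + l = ?n" for i l
    by (rule Bochner_Integration.integrable_bound[OF Bochner_Integration.integrable_add[OF int]])
       (use abs_power_mult_le[OF that] in \<open>auto intro!: AE_I2 intro: order_trans[OF _ abs_ge_self]\<close>)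
  have mD: "integrable M (\<lambda>w. S w ^ i * X w ^ l * ?D w ^ k)"
       "expectation (\<lambda>w. S w ^ i * X w ^ l * ?D w ^ k) = expectation (\<lambda>w. S w ^ i * X w ^ l) * expectation (\<lambda>w. ?D w ^ k)"
    if "i + l = ?n" for i l k
    by (rule integrable_times_increment[OF st _ mixed[OF that]], measurable)+
  define U where "U w = S w ^ ?n + real ?n * d * (S w ^ Suc (2 * j) * X w ^ 1 * ?D w ^ 1)
     + 4 ^ Suc j * (d\<^sup>2 * (S w ^ (2 * j) * X w ^ 2 * ?D w ^ (2 * 1)) + d ^ ?n * (S w ^ 0 * X w ^ ?n * ?D w ^ (2 * Suc j)))" for w
  have le: "(S w + d * X w * ?D w) ^ ?n \<le> U w" for w
    unfolding U_def by (rule add_power_le_taylor2_even)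
  have intU: "integrable M U"
    unfolding U_def 
    by (intro Bochner_Integration.integrable_add integrable_mult_right mD int) auto
  show I: ?I
    by (rule Bochner_Integration.integrable_bound[OF intU])
       (use le in \<open>auto intro!: AE_I2 intro: order_trans[OF _ abs_ge_self] simp del: mult_Suc_right mult_Suc\<close>)
  have lin: "expectation (\<lambda>w. f0 w + a * f1 w + b * (c * f2 w + e * f3 w))
      = expectation f0 + a * expectation f1 + b * (c * expectation f2 + e * expectation f3)"
    if "integrable M f0" "integrable M f1" "integrable M f2" "integrable M f3" for f0 f1 f2 f3 :: "'a \<Rightarrow> real" and a b c e
    using that by simp
  have "expectation (\<lambda>w. (S w + d * X w * ?D w) ^ ?n) \<le> expectation U"
    by (rule integral_mono[OF I intU le])
  also have "expectation U = expectation (\<lambda>w. S w ^ ?n)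
      + 4 ^ Suc j * (g * expectation (\<lambda>w. S w ^ (2 * j) * X w ^ 2) + gauss_moment (Suc j) * g ^ Suc j * expectation (\<lambda>w. X w ^ ?n))"
  proof -
    have "expectation U = expectation (\<lambda>w. S w ^ ?n) + real ?n * d * expectation (\<lambda>w. S w ^ Suc (2 * j) * X w ^ 1 * ?D w ^ 1)
     + 4 ^ Suc j * (d\<^sup>2 * expectation (\<lambda>w. S w ^ (2 * j) * X w ^ 2 * ?D w ^ (2 * 1))
         + d ^ ?n * expectation (\<lambda>w. S w ^ 0 * X w ^ ?n * ?D w ^ (2 * Suc j)))"
      unfolding U_def
      by (rule lin; intro mD int) auto
    \<comment> \<open>The martingale property: the first-order term has mean zero because the
      increment is centred and independent of the past.\<close>
    also have "expectation (\<lambda>w. S w ^ Suc (2 * j) * X w ^ 1 * ?D w ^ 1) = 0"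
      by (subst mD) (use increment_moment_1[OF st] in auto)
    also have "expectation (\<lambda>w. S w ^ (2 * j) * X w ^ 2 * ?D w ^ (2 * 1)) = expectation (\<lambda>w. S w ^ (2 * j) * X w ^ 2) * (t - s)"
      by (subst mD, simp, subst increment_moment_even[OF st]) (simp add: gauss_moment_def)
    also have "expectation (\<lambda>w. S w ^ 0 * X w ^ ?n * ?D w ^ (2 * Suc j)) = expectation (\<lambda>w. X w ^ ?n) * (gauss_moment (Suc j) * (t - s) ^ Suc j)"
      by (subst mD, simp, subst increment_moment_even[OF st]) simp
    moreover have "g ^ Suc j = d ^ ?n * (t - s) ^ Suc j"
      by (simp only: g_def power_mult_distrib power_mult)
    ultimately show ?thesis
      by (simp add: g_def mult_ac del: power_Suc mult_Suc_right)
  qed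
  also have "expectation (\<lambda>w. S w ^ (2 * j) * X w ^ 2) \<le> expectation (\<lambda>w. S w ^ ?n / G + G ^ j * X w ^ ?n)"
    by (intro integral_mono mixed Bochner_Integration.integrable_add integrable_mult_right integrable_divide int young_even_power G) auto
  also have "\<dots> = expectation (\<lambda>w. S w ^ ?n) / G + G ^ j * expectation (\<lambda>w. X w ^ ?n)"
    using int by (simp del: mult_Suc_right mult_Suc)
  also have "g ^ Suc j \<le> g * G ^ j"
    using g0 by (auto intro!: mult_left_mono power_mono)
  finally have *: "expectation (\<lambda>w. (S w + d * X w * ?D w) ^ ?n) \<le> expectation (\<lambda>w. S w ^ ?n)
      + 4 ^ Suc j * (g * (expectation (\<lambda>w. S w ^ ?n) / G + G ^ j * expectation (\<lambda>w. X w ^ ?n))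
         + gauss_moment (Suc j) * (g * G ^ j) * expectation (\<lambda>w. X w ^ ?n))"
    using g0 by (simp add: mult_left_mono mult_right_mono gauss_moment_nonneg del: mult_Suc_right mult_Suc)
  \<comment> \<open>The claimed factor \<open>1 + C * g / G\<close> is larger than the estimate
    requires: \<open>collect\<close> isolates the surplus, which involves
    \<open>gauss_moment\<close> times the old moment, and this line shows that it has the right
    sign.\<close>
  have nonneg: "0 \<le> 4 ^ Suc j * gauss_moment (Suc j) * (g / G * expectation (\<lambda>w. S w ^ ?n))"
    using g0 G by (intro mult_nonneg_nonneg gauss_moment_nonneg integral_nonneg divide_nonneg_pos) (auto simp: power_mult simp del: mult_Suc_right mult_Suc)
  have collect: "(1 + q * (1 + m) * g / G) * A + q * (1 + m) * g * u * B
      = A + q * (g * (A / G + u * B) + m * (g * u) * B) + q * m * (g / G * A)" for A B q m u :: real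
    by (simp add: algebra_simps add_divide_distrib)
  show ?E
    using * nonneg unfolding C_def step_const_def collect by linarith
qed

text \<open>Points may coincide: partitions are only weakly increasing, and clamping one grid to the
  cells of another produces degenerate cells.\<close>

definition grid :: "(nat \<Rightarrow> real) \<Rightarrow> nat \<Rightarrow> bool" where
  "grid s n \<longleftrightarrow> (\<forall>j\<le>n. s j \<in> {-pi..pi}) \<and> (\<forall>j<n. s j \<le> s (Suc j))"

lemma grid_subset: "grid s n \<Longrightarrow> k \<le> n \<Longrightarrow> grid s k"
  by (simp add: grid_def)

lemma grid_in: "grid s n \<Longrightarrow> j \<le> n \<Longrightarrow> s j \<in> {-pi..pi}"
  by (simp add: grid_def)

lemma grid_step: "grid s n \<Longrightarrow> j < n \<Longrightarrow> s j \<le> s (Suc j)"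
  by (simp add: grid_def)

lemma grid_mono:
  assumes "grid s n" "i \<le> j" "j \<le> n"
  shows "s i \<le> s j"
  using assms(2)
proof (induction rule: inc_induct)
  case (step k)
  then show ?case using grid_step[of s n k] assms by simp
qed simp

lemma grid_length: "grid s n \<Longrightarrow> (\<Sum>j<n. s (Suc j) - s j) \<le> 2 * pi"
  using grid_in[of s n 0] grid_in[of s n n] by (simp add: sum_lessThan_telescope)

definition dW :: "(nat \<Rightarrow> real) \<Rightarrow> nat \<Rightarrow> 'a \<Rightarrow> real" where
  "dW s j w = W (s (Suc j)) w - W (s j) w"

definition grid_adapted :: "(nat \<Rightarrow> real) \<Rightarrow> nat \<Rightarrow> (nat \<Rightarrow> 'a \<Rightarrow> real) \<Rightarrow> bool" where
  "grid_adapted s n X \<longleftrightarrow> (\<forall>j<n. X j \<in> borel_measurable (FM (s j)))"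

lemma grid_adapted_sum_measurable:
  assumes "grid s n" "grid_adapted s n X" "k \<le> n"
  shows "(\<lambda>w. \<Sum>j<k. d j * X j w * dW s j w) \<in> borel_measurable (FM (s k))"
proof (rule borel_measurable_sum)
  fix j assume "j \<in> {..<k}"
  then have j: "j < k" "j < n" using assms by auto
  have le: "s i \<le> s k" "s i \<in> {-pi..pi}" if "i \<le> k" for i
    using that assms grid_mono grid_in by auto
  have [measurable]: "X j \<in> borel_measurable (FM (s k))"
    using measurable_FM_mono[of "X j" "s j" "s k"] le[of j] le[of k] assms j by (auto simp: grid_adapted_def)
  have [measurable]: "W (s i) \<in> borel_measurable (FM (s k))" if "i \<le> k" for i
    using measurable_FM_mono[OF W_FM, of "s i" "s k"] le[of i] le[of k] that by auto
  have "W (s (Suc j)) \<in> borel_measurable (FM (s k))" "W (s j) \<in> borel_measurable (FM (s k))"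
    using j by auto
  then show "(\<lambda>w. d j * X j w * dW s j w) \<in> borel_measurable (FM (s k))"
    unfolding dW_def by measurable
qed

text \<open>The exponential is the Gronwall factor that remains once the whole budget
  \<open>G\<close> is spent.\<close>

definition moment_const :: "nat \<Rightarrow> real" where
  "moment_const k = step_const k * exp (step_const k)"

lemma moment_const_pos: "moment_const k > 0"
  by (simp add: moment_const_def step_const_pos)

text \<open>The one-step estimate is iterated as in the discrete Gronwall lemma.\<close>
lemma martingale_transform_moment:
  assumes s: "grid s n" and X: "grid_adapted s n X"
    and int: "\<And>j. j < n \<Longrightarrow> integrable M (\<lambda>w. X j w ^ (2 * Suc i))"
    and G: "G > 0" "(\<Sum>j<n. (d j)\<^sup>2 * (s (Suc j) - s j)) \<le> G"
  shows "integrable M (\<lambda>w. (\<Sum>j<n. d j * X j w * dW s j w) ^ (2 * Suc i))"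
    and "expectation (\<lambda>w. (\<Sum>j<n. d j * X j w * dW s j w) ^ (2 * Suc i))
      \<le> moment_const (Suc i) * G ^ i * (\<Sum>j<n. (d j)\<^sup>2 * (s (Suc j) - s j) * expectation (\<lambda>w. X j w ^ (2 * Suc i)))"
proof -
  let ?C = "step_const (Suc i)"
  define g where "g j = (d j)\<^sup>2 * (s (Suc j) - s j)" for j
  define e where "e j = expectation (\<lambda>w. X j w ^ (2 * Suc i))" for j
  have g0: "g j \<ge> 0" if "j < n" for j
    using grid_step[OF s that] by (simp add: g_def)
  have e0: "e j \<ge> 0" for j
    unfolding e_def by (rule Bochner_Integration.integral_nonneg) (simp add: zero_le_even_power del: power_Suc mult_Suc_right)
  have gG: "g j \<le> G" if "j < n" for j
  proof -
    have "g j \<le> sum g {..<n}"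
      using that g0 by (intro member_le_sum) auto
    then show ?thesis using G by (simp add: g_def)
  qed
  have C0: "?C > 0" by (rule step_const_pos)
  \<comment> \<open>The exponent carries the partial sum of \<open>g\<close>, so that each step of
    the induction contributes exactly its own factor; it is compared with the full budget only after
    the induction.\<close>
  have main: "integrable M (\<lambda>w. (\<Sum>j<k. d j * X j w * dW s j w) ^ (2 * Suc i)) \<and>
     expectation (\<lambda>w. (\<Sum>j<k. d j * X j w * dW s j w) ^ (2 * Suc i))
       \<le> exp (?C * sum g {..<k} / G) * (?C * G ^ i * (\<Sum>j<k. g j * e j))" if "k \<le> n" for k
    using that
  proof (induction k)
    case (Suc k)
    let ?S = "\<lambda>w. \<Sum>j<k. d j * X j w * dW s j w"
    let ?A = "?C * G ^ i * (\<Sum>j<k. g j * e j)"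
    let ?E = "exp (?C * sum g {..<k} / G)"
    have k: "k < n" "k \<le> n" using Suc.prems by auto
    have IH: "integrable M (\<lambda>w. ?S w ^ (2 * Suc i))" "expectation (\<lambda>w. ?S w ^ (2 * Suc i)) \<le> ?E * ?A"
      using Suc by auto
    have meas: "?S \<in> borel_measurable (FM (s k))" "X k \<in> borel_measurable (FM (s k))"
      using grid_adapted_sum_measurable[OF s X k(2)] X k by (auto simp: grid_adapted_def)
    have st: "s k \<le> s (Suc k)" "s k \<in> {-pi..pi}" "s (Suc k) \<in> {-pi..pi}"
      using s k by (auto simp: grid_def)
    note step = one_step_moment[OF st meas IH(1) int[OF k(1)] G(1), of "d k", folded g_def, OF gG[OF k(1)]]
    have eq: "(\<Sum>j<Suc k. d j * X j w * dW s j w) = ?S w + d k * X k w * (W (s (Suc k)) w - W (s k) w)" for w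
      by (simp add: dW_def)
    have "(1 + ?C * g k / G) * expectation (\<lambda>w. ?S w ^ (2 * Suc i)) \<le> exp (?C * g k / G) * (?E * ?A)"
    proof (rule mult_mono)
      show "1 + ?C * g k / G \<le> exp (?C * g k / G)"
        by (rule exp_ge_add_one_self)
      show "0 \<le> expectation (\<lambda>w. ?S w ^ (2 * Suc i))"
        by (rule Bochner_Integration.integral_nonneg) (simp add: zero_le_even_power del: power_Suc mult_Suc_right)
    qed (use IH in auto)
    also have "\<dots> = exp (?C * sum g {..<Suc k} / G) * ?A"
      by (simp add: exp_add algebra_simps add_divide_distrib)
    finally have 1: "(1 + ?C * g k / G) * expectation (\<lambda>w. ?S w ^ (2 * Suc i)) \<le> exp (?C * sum g {..<Suc k} / G) * ?A" .
    have "0 \<le> ?C * sum g {..<Suc k} / G"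
      using C0 G g0 Suc.prems by (intro divide_nonneg_pos mult_nonneg_nonneg sum_nonneg) auto
    then have 2: "?C * g k * G ^ i * e k \<le> exp (?C * sum g {..<Suc k} / G) * (?C * g k * G ^ i * e k)"
      using C0 G g0[OF k(1)] e0[of k] mult_right_mono[of 1 "exp (?C * sum g {..<Suc k} / G)" "?C * g k * G ^ i * e k"]
      by (simp del: sum.lessThan_Suc)
    have "expectation (\<lambda>w. (\<Sum>j<Suc k. d j * X j w * dW s j w) ^ (2 * Suc i))
        \<le> (1 + ?C * g k / G) * expectation (\<lambda>w. ?S w ^ (2 * Suc i)) + ?C * g k * G ^ i * e k"
      unfolding eq e_def by (rule step(2))
    also have "\<dots> \<le> exp (?C * sum g {..<Suc k} / G) * (?A + ?C * g k * G ^ i * e k)"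
      using 1 2 by (simp only: distrib_left) 
    also have "?A + ?C * g k * G ^ i * e k = ?C * G ^ i * (\<Sum>j<Suc k. g j * e j)"
      by (simp add: algebra_simps)
    finally show ?case
      using step(1) unfolding eq by blast
  qed simp
  show "integrable M (\<lambda>w. (\<Sum>j<n. d j * X j w * dW s j w) ^ (2 * Suc i))"
    using main[of n] by simp
  have "exp (?C * sum g {..<n} / G) \<le> exp ?C"
    using G C0 by (simp add: g_def field_simps)
  then have "exp (?C * sum g {..<n} / G) * (?C * G ^ i * (\<Sum>j<n. g j * e j)) \<le> exp ?C * (?C * G ^ i * (\<Sum>j<n. g j * e j))"
    using C0 G g0 e0 by (intro mult_right_mono mult_nonneg_nonneg sum_nonneg) auto
  then show "expectation (\<lambda>w. (\<Sum>j<n. d j * X j w * dW s j w) ^ (2 * Suc i))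
      \<le> moment_const (Suc i) * G ^ i * (\<Sum>j<n. (d j)\<^sup>2 * (s (Suc j) - s j) * expectation (\<lambda>w. X j w ^ (2 * Suc i)))"
    using main[of n] unfolding moment_const_def g_def e_def by (auto simp: mult_ac)
qed

end

section \<open>Iterated sums\<close>

context filtered_brownian_motion
begin

definition bounded_adapted :: "(nat \<Rightarrow> real) \<Rightarrow> nat \<Rightarrow> real \<Rightarrow> (nat \<Rightarrow> 'a \<Rightarrow> real) \<Rightarrow> bool" where
  "bounded_adapted s n R X \<longleftrightarrow> grid_adapted s n X \<and> (\<forall>j<n. \<forall>w\<in>space M. \<bar>X j w\<bar> \<le> R)"

lemma bounded_adapted_measurable:
  "grid s n \<Longrightarrow> bounded_adapted s n R X \<Longrightarrow> j < n \<Longrightarrow> X j \<in> borel_measurable M"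
  using measurable_FM_M[of "X j" "s j"] grid_in[of s n j] by (simp add: bounded_adapted_def grid_adapted_def)

lemma bounded_adapted_integrable:
  assumes "grid s n" "bounded_adapted s n R X" "j < n"
  shows "integrable M (\<lambda>w. X j w ^ k)"
proof (rule integrable_const_bound[where B = "R ^ k"])
  show "AE w in M. norm (X j w ^ k) \<le> R ^ k"
    using assms by (intro AE_I2) (auto simp: bounded_adapted_def power_abs intro!: power_mono)
  show "(\<lambda>w. X j w ^ k) \<in> borel_measurable M"
    using bounded_adapted_measurable[OF assms] by measurable
qed

lemma even_power_integral_nonneg: "0 \<le> expectation (\<lambda>w. X w ^ (2 * k) :: real)"
  by (rule Bochner_Integration.integral_nonneg) (simp add: zero_le_even_power)

text \<open>The outer sum is a transform with unit coefficients on an interval of length at most 2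
  pi, which gives \<open>moment_const (Suc i) * (2 * pi) ^ i\<close>. The last factor comes from the
  weighted inequality 2ab \<le> a^2/c + c b^2 that separates the inner sum from the outer
  integrand.\<close>

definition chaos_const :: "nat \<Rightarrow> real" where
  "chaos_const i = moment_const (Suc i) * (2 * pi) ^ i * (1 + moment_const (2 * Suc i)) / 2"

lemma chaos_const_pos: "chaos_const i > 0"
  unfolding chaos_const_def using moment_const_pos by (simp add: add_pos_pos)

text \<open>The moments of the inner sum are controlled only after integrating over the outer
  variable; this is what lets the kernel be measured by its square integral in both variables.\<close>
lemma double_sum_moment:
  assumes s: "grid s n" and X: "bounded_adapted s n R X" and G: "G > 0"
    and row: "\<And>k. k < n \<Longrightarrow> (\<Sum>j<n. (d k j)\<^sup>2 * (s (Suc j) - s j)) \<le> G"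
    and col: "\<And>j. j < n \<Longrightarrow> (\<Sum>k<n. (d k j)\<^sup>2 * (s (Suc k) - s k)) \<le> G"
  defines "Z \<equiv> \<lambda>w. \<Sum>k<n. (\<Sum>j<k. d k j * X j w * dW s j w) * X k w * dW s k w"
  shows "integrable M (\<lambda>w. Z w ^ (2 * Suc i))"
    and "expectation (\<lambda>w. Z w ^ (2 * Suc i))
       \<le> chaos_const i * G ^ Suc i * (\<Sum>k<n. (s (Suc k) - s k) * expectation (\<lambda>w. X k w ^ (4 * Suc i)))"
proof -
  let ?h = "\<lambda>k. s (Suc k) - s k"
  let ?q = "2 * Suc i"
  \<comment> \<open>The inner sum needs moments of order \<open>2 * ?q = 4 * Suc i\<close>;
    \<open>l\<close> writes this order as \<open>2 * Suc l\<close>, the form in which the transform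
    estimate is stated.\<close>
  obtain l where l: "2 * ?q = 2 * Suc l" "l = Suc (2 * i)" "Suc l = ?q" by simp
  define Y where "Y k w = (\<Sum>j<k. d k j * X j w * dW s j w)" for k w
  define e where "e k = expectation (\<lambda>w. X k w ^ (4 * Suc i))" for k
  have e0: "e k \<ge> 0" for k
    using even_power_integral_nonneg[of "X k" "2 * Suc i"] by (simp add: e_def mult.assoc[symmetric] del: power_Suc mult_Suc_right)
  have h0: "?h k \<ge> 0" if "k < n" for k
    using grid_step[OF s that] by simp
  have YX: "Y k \<in> borel_measurable (FM (s k))" "X k \<in> borel_measurable (FM (s k))" 
      "Y k \<in> borel_measurable M" "X k \<in> borel_measurable M" if "k < n" for k
  proof -
    show *: "Y k \<in> borel_measurable (FM (s k))"
      unfolding Y_def using grid_adapted_sum_measurable[OF s] X that by (simp add: bounded_adapted_def)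
    show "X k \<in> borel_measurable (FM (s k))"
      using X that by (simp add: bounded_adapted_def grid_adapted_def)
    show "Y k \<in> borel_measurable M"
      using * grid_in[OF s] that by (intro measurable_FM_M) auto
    show "X k \<in> borel_measurable M"
      using bounded_adapted_measurable[OF s X that] .
  qed
  have four: "4 * Suc i = 2 * ?q" by simp
  have iX: "integrable M (\<lambda>w. X k w ^ (2 * ?q))" if "k < n" for k
    by (rule bounded_adapted_integrable[OF s X that])
  have iY: "integrable M (\<lambda>w. Y k w ^ (2 * ?q))" 
    and bY: "expectation (\<lambda>w. Y k w ^ (2 * ?q)) \<le> moment_const ?q * G ^ Suc (2 * i) * (\<Sum>j<n. (d k j)\<^sup>2 * ?h j * e j)"
    if k: "k < n" for k
  proof -
    have le: "(\<Sum>j<k. (d k j)\<^sup>2 * ?h j) \<le> G"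
      using row[OF k] h0 k by (intro order_trans[OF sum_mono2 row[OF k]]) auto
    have ad: "grid_adapted s k X"
      using X k by (auto simp: bounded_adapted_def grid_adapted_def)
    have int: "integrable M (\<lambda>w. X j w ^ (2 * Suc l))" if "j < k" for j
      by (rule bounded_adapted_integrable[OF s X]) (use that k in auto)
    note m = martingale_transform_moment[OF grid_subset[OF s less_imp_le[OF k]] ad int G le]
    show "integrable M (\<lambda>w. Y k w ^ (2 * ?q))"
      using m(1) unfolding Y_def l(1) by blast
    have "expectation (\<lambda>w. Y k w ^ (2 * ?q)) \<le> moment_const ?q * G ^ Suc (2 * i) * (\<Sum>j<k. (d k j)\<^sup>2 * ?h j * e j)"
      using m(2) unfolding Y_def e_def four l(1) unfolding l(2) l(3)[unfolded l(2)] by blast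
    also have "\<dots> \<le> moment_const ?q * G ^ Suc (2 * i) * (\<Sum>j<n. (d k j)\<^sup>2 * ?h j * e j)"
      using moment_const_pos[of ?q] G h0 e0 k by (intro mult_left_mono sum_mono2) auto
    finally show "expectation (\<lambda>w. Y k w ^ (2 * ?q)) \<le> moment_const ?q * G ^ Suc (2 * i) * (\<Sum>j<n. (d k j)\<^sup>2 * ?h j * e j)" .
  qed
  have iYX: "integrable M (\<lambda>w. (Y k w * X k w) ^ ?q)" if "k < n" for k
  proof (rule Bochner_Integration.integrable_bound[OF Bochner_Integration.integrable_add[OF iY[OF that] iX[OF that]]])
    show "(\<lambda>w. (Y k w * X k w) ^ ?q) \<in> borel_measurable M"
      using YX[OF that] by measurable
    show "AE w in M. norm ((Y k w * X k w) ^ ?q) \<le> norm (Y k w ^ (2 * ?q) + X k w ^ (2 * ?q))"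
      using abs_power_mult_le[of ?q ?q ?q] 
      by (intro AE_I2) (auto simp: power_mult_distrib simp del: power_Suc mult_Suc_right intro: order_trans[OF _ abs_ge_self])
  qed
  \<comment> \<open>The weight \<open>G ^ Suc i\<close> balances the two terms: the moment of
    \<open>Y\<close> of order \<open>2 * ?q\<close> has size G^(2 (i+1)) after summation over
    \<open>k\<close>, so both sides end up of size G^(i+1).\<close>
  have bYX: "2 * expectation (\<lambda>w. (Y k w * X k w) ^ ?q)
     \<le> expectation (\<lambda>w. Y k w ^ (2 * ?q)) / G ^ Suc i + G ^ Suc i * e k" if k: "k < n" for k
  proof -
    have "2 * (Y k w * X k w) ^ ?q \<le> Y k w ^ (2 * ?q) / G ^ Suc i + G ^ Suc i * X k w ^ (2 * ?q)" for w
    proof -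
      have am: "2 * a * b \<le> a\<^sup>2 / c + c * b\<^sup>2" if "c > 0" for a b c :: real
      proof -
        have "0 \<le> (a - c * b)\<^sup>2 / c" using that by simp
        also have "\<dots> = a\<^sup>2 / c + c * b\<^sup>2 - 2 * a * b"
          using that by (simp add: field_simps power2_eq_square)
        finally show ?thesis by simp
      qed
      have sq: "z ^ (2 * ?q) = (z ^ ?q)\<^sup>2" for z :: real
        by (simp only: power_mult[symmetric] mult.commute)
      from am[of "G ^ Suc i" "Y k w ^ ?q" "X k w ^ ?q"] G show ?thesis
        unfolding sq power_mult_distrib by (simp add: mult.assoc del: power_Suc mult_Suc_right)
    qed
    then have "expectation (\<lambda>w. 2 * (Y k w * X k w) ^ ?q) \<le> expectation (\<lambda>w. Y k w ^ (2 * ?q) / G ^ Suc i + G ^ Suc i * X k w ^ (2 * ?q))"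
      by (intro integral_mono Bochner_Integration.integrable_add integrable_mult_right integrable_divide iX iY iYX k)
    then show ?thesis
      using iX[OF k] iY[OF k] iYX[OF k] by (simp add: e_def del: power_Suc mult_Suc_right mult_Suc)
  qed
  have sumY: "(\<Sum>k<n. ?h k * expectation (\<lambda>w. Y k w ^ (2 * ?q))) \<le> moment_const ?q * G ^ (2 * Suc i) * (\<Sum>k<n. ?h k * e k)"
  proof -
    have "(\<Sum>k<n. ?h k * expectation (\<lambda>w. Y k w ^ (2 * ?q)))
        \<le> (\<Sum>k<n. ?h k * (moment_const ?q * G ^ Suc (2 * i) * (\<Sum>j<n. (d k j)\<^sup>2 * ?h j * e j)))"
      by (intro sum_mono mult_left_mono bY h0) auto
    also have "\<dots> = moment_const ?q * G ^ Suc (2 * i) * (\<Sum>k<n. \<Sum>j<n. ?h k * ((d k j)\<^sup>2 * ?h j * e j))"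
      by (simp add: sum_distrib_left mult_ac)
    also have "(\<Sum>k<n. \<Sum>j<n. ?h k * ((d k j)\<^sup>2 * ?h j * e j)) = (\<Sum>j<n. \<Sum>k<n. ?h k * ((d k j)\<^sup>2 * ?h j * e j))"
      by (rule sum.swap)
    also have "\<dots> = (\<Sum>j<n. ?h j * e j * (\<Sum>k<n. (d k j)\<^sup>2 * ?h k))"
      by (simp add: sum_distrib_left mult_ac)
    also have "moment_const ?q * G ^ Suc (2 * i) * \<dots> \<le> moment_const ?q * G ^ Suc (2 * i) * (\<Sum>j<n. ?h j * e j * G)"
      using moment_const_pos[of ?q] G
      by (intro mult_left_mono sum_mono col mult_nonneg_nonneg h0 e0) auto
    also have "\<dots> = moment_const ?q * G ^ (2 * Suc i) * (\<Sum>k<n. ?h k * e k)"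
      by (simp add: sum_distrib_right[symmetric])
    finally show ?thesis .
  qed
  \<comment> \<open>The outer sum is itself a martingale transform, with adapted integrand
    \<open>Y k * X k\<close> and coefficients 1.\<close>
  have ad: "grid_adapted s n (\<lambda>k w. Y k w * X k w)"
    unfolding grid_adapted_def using YX by (auto intro: borel_measurable_times)
  have "(\<Sum>j<n. 1\<^sup>2 * ?h j) \<le> 2 * pi"
    using grid_length[OF s] by simp
  note m = martingale_transform_moment[where d = "\<lambda>_. 1" and i = i, OF s ad iYX _ this]
  have Z: "Z w = (\<Sum>k<n. 1 * (Y k w * X k w) * dW s k w)" for w
    by (simp add: Z_def Y_def)
  show "integrable M (\<lambda>w. Z w ^ (2 * Suc i))"
    unfolding Z using m(1) by simp
  have "expectation (\<lambda>w. Z w ^ (2 * Suc i)) \<le> moment_const (Suc i) * (2 * pi) ^ i * (\<Sum>k<n. ?h k * expectation (\<lambda>w. (Y k w * X k w) ^ ?q))"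
    using m(2) unfolding Z by simp
  also have "(\<Sum>k<n. ?h k * expectation (\<lambda>w. (Y k w * X k w) ^ ?q))
     \<le> (\<Sum>k<n. ?h k * ((expectation (\<lambda>w. Y k w ^ (2 * ?q)) / G ^ Suc i + G ^ Suc i * e k) / 2))"
    using bYX h0 by (intro sum_mono mult_left_mono) (auto simp: field_simps)
  also have "\<dots> = ((\<Sum>k<n. ?h k * expectation (\<lambda>w. Y k w ^ (2 * ?q))) / G ^ Suc i + G ^ Suc i * (\<Sum>k<n. ?h k * e k)) / 2"
    by (simp add: sum_distrib_left sum_divide_distrib sum.distrib add_divide_distrib distrib_left mult_ac)
  also have "\<dots> \<le> ((moment_const ?q * G ^ (2 * Suc i) * (\<Sum>k<n. ?h k * e k)) / G ^ Suc i + G ^ Suc i * (\<Sum>k<n. ?h k * e k)) / 2"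
    using sumY G by (intro divide_right_mono add_right_mono) auto
  also have "\<dots> = (1 + moment_const ?q) / 2 * (G ^ Suc i * (\<Sum>k<n. ?h k * e k))"
  proof -
    have "G ^ (2 * Suc i) = G ^ Suc i * G ^ Suc i" by (simp add: power_add[symmetric] mult_2)
    then show ?thesis using G by (simp add: field_simps)
  qed
  finally show "expectation (\<lambda>w. Z w ^ (2 * Suc i)) \<le> chaos_const i * G ^ Suc i * (\<Sum>k<n. ?h k * expectation (\<lambda>w. X k w ^ (4 * Suc i)))"
    unfolding chaos_const_def e_def using moment_const_pos[of "Suc i"] by (simp add: mult_left_mono mult_ac)
qed

text \<open>The variables (dW)^2 - h are centred and independent of the past, so the summands are
  orthogonal. Each has variance 3 h^2 - h^2 = 2 h^2, which explains the factor 2.\<close>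

lemma quadratic_variation_error:
  assumes s: "grid s n" and X: "bounded_adapted s n c X" 
  defines "P \<equiv> \<lambda>w. \<Sum>k<n. X k w * ((dW s k w)\<^sup>2 - (s (Suc k) - s k))"
  shows "integrable M (\<lambda>w. (P w)\<^sup>2)"
    and "expectation (\<lambda>w. (P w)\<^sup>2) \<le> 2 * c\<^sup>2 * (\<Sum>k<n. (s (Suc k) - s k)\<^sup>2)"
proof -
  let ?h = "\<lambda>k. s (Suc k) - s k"
  let ?Q = "\<lambda>k w. (dW s k w)\<^sup>2 - ?h k"
  define S where "S k w = (\<Sum>j<k. X j w * ?Q j w)" for k w
  have main: "S k \<in> borel_measurable (FM (s k)) \<and> integrable M (\<lambda>w. (S k w)\<^sup>2) \<and>
      expectation (\<lambda>w. (S k w)\<^sup>2) \<le> 2 * c\<^sup>2 * (\<Sum>j<k. (?h j)\<^sup>2)" if "k \<le> n" for k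
    using that
  proof (induction k)
    case 0
    then show ?case by (simp add: S_def)
  next
    case (Suc k)
    then have k: "k < n" and IH: "S k \<in> borel_measurable (FM (s k))" "integrable M (\<lambda>w. (S k w)\<^sup>2)"
      "expectation (\<lambda>w. (S k w)\<^sup>2) \<le> 2 * c\<^sup>2 * (\<Sum>j<k. (?h j)\<^sup>2)" by auto
    have st: "s k \<le> s (Suc k)" "s k \<in> {-pi..pi}" "s (Suc k) \<in> {-pi..pi}"
      using s k by (auto simp: grid_def)
    have Xk: "X k \<in> borel_measurable (FM (s k))" "\<And>w. w \<in> space M \<Longrightarrow> \<bar>X k w\<bar> \<le> c"
      using X k by (auto simp: bounded_adapted_def grid_adapted_def)
    have [measurable]: "S k \<in> borel_measurable (FM (s (Suc k)))" "X k \<in> borel_measurable (FM (s (Suc k)))"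
      "W (s k) \<in> borel_measurable (FM (s (Suc k)))" "W (s (Suc k)) \<in> borel_measurable (FM (s (Suc k)))"
      using measurable_FM_mono[OF IH(1) st] measurable_FM_mono[OF Xk(1) st] 
        measurable_FM_mono[OF W_FM st] W_FM st by auto
    have [measurable]: "S k \<in> borel_measurable M" "X k \<in> borel_measurable M"
      using measurable_FM_M[OF IH(1) st(2)] measurable_FM_M[OF Xk(1) st(2)] by auto
    have iX2: "integrable M (\<lambda>w. (X k w)\<^sup>2)"
      by (rule bounded_adapted_integrable[OF s X k])
    have iSX: "integrable M (\<lambda>w. S k w * X k w)"
      by (rule Bochner_Integration.integrable_bound[OF Bochner_Integration.integrable_add[OF IH(2) iX2]])
         (use abs_power_mult_le[of 1 1 1] in \<open>auto intro!: AE_I2 intro: order_trans[OF _ abs_ge_self]\<close>)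
    note it = integrable_times_increment[OF st, folded dW_def]
    have m: "(\<lambda>w. S k w * X k w) \<in> borel_measurable (FM (s k))" "(\<lambda>w. (X k w)\<^sup>2) \<in> borel_measurable (FM (s k))"
      using IH(1) Xk(1) by measurable
    note iS = it(1)[OF m(1) iSX, of 2] and iX4 = it(1)[OF m(2) iX2, of 4] and iX22 = it(1)[OF m(2) iX2, of 2]
    \<comment> \<open>The square is written as a combination of past factors times even powers of
      the increment, to which the factorisation applies term by term. The bracket after the factor 2
      then has mean zero.\<close>
    have eq: "(S (Suc k) w)\<^sup>2 = (S k w)\<^sup>2 + 2 * (S k w * X k w * dW s k w ^ 2 - ?h k * (S k w * X k w))
       + ((X k w)\<^sup>2 * dW s k w ^ 4 - 2 * ?h k * ((X k w)\<^sup>2 * dW s k w ^ 2) + (?h k)\<^sup>2 * (X k w)\<^sup>2)" for w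
    proof -
      have "(a + b * (D\<^sup>2 - h))\<^sup>2 = a\<^sup>2 + 2 * (a * b * D\<^sup>2 - h * (a * b)) + (b\<^sup>2 * D ^ 4 - 2 * h * (b\<^sup>2 * D\<^sup>2) + h\<^sup>2 * b\<^sup>2)"
        for a b D h :: real by algebra
      then show ?thesis by (simp add: S_def)
    qed
    have "S (Suc k) = (\<lambda>w. S k w + X k w * ((W (s (Suc k)) w - W (s k) w)\<^sup>2 - ?h k))"
      by (simp add: S_def dW_def fun_eq_iff)
    then have meas: "S (Suc k) \<in> borel_measurable (FM (s (Suc k)))"
      by simp
    have int: "integrable M (\<lambda>w. (S (Suc k) w)\<^sup>2)"
      unfolding eq by (intro Bochner_Integration.integrable_add Bochner_Integration.integrable_diff
          integrable_mult_right IH iS iSX iX2 iX4 iX22)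
    have D2: "expectation (\<lambda>w. dW s k w ^ 2) = ?h k"
      using increment_moment_even[OF st, of 1] by (simp add: dW_def gauss_moment_def)
    have D4: "expectation (\<lambda>w. dW s k w ^ 4) = 3 * (?h k)\<^sup>2"
      using increment_moment_even[OF st, of 2] by (simp add: dW_def gauss_moment_def fact_numeral)
    have lin: "expectation (\<lambda>w. f0 w + 2 * (f1 w - a * f2 w) + (f3 w - b * f4 w + d * f5 w))
      = expectation f0 + 2 * (expectation f1 - a * expectation f2) + (expectation f3 - b * expectation f4 + d * expectation f5)"
      if "integrable M f0" "integrable M f1" "integrable M f2" "integrable M f3" "integrable M f4" "integrable M f5"
      for f0 f1 f2 f3 f4 f5 :: "'a \<Rightarrow> real" and a b d
      using that by simp
    have "expectation (\<lambda>w. (S (Suc k) w)\<^sup>2) = expectation (\<lambda>w. (S k w)\<^sup>2)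
        + 2 * (expectation (\<lambda>w. S k w * X k w * dW s k w ^ 2) - ?h k * expectation (\<lambda>w. S k w * X k w))
        + (expectation (\<lambda>w. (X k w)\<^sup>2 * dW s k w ^ 4) - 2 * ?h k * expectation (\<lambda>w. (X k w)\<^sup>2 * dW s k w ^ 2)
           + (?h k)\<^sup>2 * expectation (\<lambda>w. (X k w)\<^sup>2))"
      unfolding eq by (rule lin[OF IH(2) iS iSX iX4 iX22 iX2])
    also have "\<dots> = expectation (\<lambda>w. (S k w)\<^sup>2) + 2 * (?h k)\<^sup>2 * expectation (\<lambda>w. (X k w)\<^sup>2)"
      unfolding it(2)[OF m(1) iSX] it(2)[OF m(2) iX2] D2 D4 by (simp add: power2_eq_square algebra_simps)
    also have "expectation (\<lambda>w. (X k w)\<^sup>2) \<le> expectation (\<lambda>w. c\<^sup>2)"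
      using Xk(2) iX2 by (intro integral_mono) (auto simp: abs_le_square_iff[symmetric] intro: order_trans[OF _ abs_ge_self])
    finally have "expectation (\<lambda>w. (S (Suc k) w)\<^sup>2) \<le> expectation (\<lambda>w. (S k w)\<^sup>2) + 2 * (?h k)\<^sup>2 * c\<^sup>2"
      by (simp add: prob_space mult_left_mono)
    with IH(3) meas int show ?case
      by (simp add: algebra_simps)
  qed
  show "integrable M (\<lambda>w. (P w)\<^sup>2)" "expectation (\<lambda>w. (P w)\<^sup>2) \<le> 2 * c\<^sup>2 * (\<Sum>k<n. (s (Suc k) - s k)\<^sup>2)"
    using main[of n] by (auto simp: S_def[abs_def] P_def)
qed

end

section \<open>Comparison of Riemann sums along different grids\<close>

lemma riemann_sum_error:
  fixes f :: "real \<Rightarrow> real"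
  assumes "\<And>k. k < n \<Longrightarrow> s k \<le> s (Suc k)" "continuous_on {s 0..s n} f"
    and "\<And>k u. k < n \<Longrightarrow> u \<in> {s k..s (Suc k)} \<Longrightarrow> \<bar>f (s k) - f u\<bar> \<le> e"
  shows "\<bar>(\<Sum>k<n. (s (Suc k) - s k) * f (s k)) - integral {s 0..s n} f\<bar> \<le> e * (s n - s 0)"
  using assms
proof (induction n)
  case (Suc n)
  have mono: "s i \<le> s j" if "i \<le> j" "j \<le> Suc n" for i j
    using that(1)
  proof (induction rule: inc_induct)
    case (step k)
    then show ?case using Suc.prems(1)[of k] that by simp
  qed simp
  have IH: "\<bar>(\<Sum>k<n. (s (Suc k) - s k) * f (s k)) - integral {s 0..s n} f\<bar> \<le> e * (s n - s 0)"
    using mono[of 0 n] mono[of n "Suc n"] by (intro Suc continuous_on_subset[OF Suc.prems(2)]) auto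
  have int: "f integrable_on {s n..s (Suc n)}"
    using mono[of 0 n] by (intro integrable_continuous_interval continuous_on_subset[OF Suc.prems(2)]) auto
  have comb: "integral {s 0..s n} f + integral {s n..s (Suc n)} f = integral {s 0..s (Suc n)} f"
    using mono[of 0 n] mono[of n "Suc n"] Suc.prems(2)
    by (intro Henstock_Kurzweil_Integration.integral_combine integrable_continuous_interval) auto
  have "norm (integral {s n..s (Suc n)} (\<lambda>u. f (s n) - f u)) \<le> e * (s (Suc n) - s n)"
    using mono[of n "Suc n"] Suc.prems(3)[of n] Suc.prems(2) mono[of 0 n]
    by (intro integral_bound continuous_intros continuous_on_subset[OF Suc.prems(2)]) auto
  also have "integral {s n..s (Suc n)} (\<lambda>u. f (s n) - f u) = (s (Suc n) - s n) * f (s n) - integral {s n..s (Suc n)} f"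
    using mono[of n "Suc n"] int by (subst Henstock_Kurzweil_Integration.integral_diff) auto
  finally show ?case
    using IH comb by (simp add: algebra_simps)
qed simp

lemma sum_lessThan_mult:
  fixes f :: "nat \<Rightarrow> 'b::comm_monoid_add"
  shows "(\<Sum>k<n * m. f k) = (\<Sum>i<n. \<Sum>j<m. f (i * m + j))"
proof -
  have "(\<Sum>i<n. \<Sum>j<m. f (i * m + j)) = (\<Sum>i<n. sum f {i * m..<i * m + m})"
    by (simp add: sum.atLeastLessThan_shift_0[of f] atLeast0LessThan add.commute)
  then show ?thesis using sum.nat_group[of f m n] by simp
qed

text \<open>Both sides are the increment of \<open>f\<close> over the intersection of [a, a'] and
  [b, b'], and both are 0 when the intersection has no interior.\<close>

lemma clamp_increment_swap:
  fixes f :: "real \<Rightarrow> real"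
  assumes "a \<le> a'" "b \<le> b'"
  shows "f (max a (min a' b')) - f (max a (min a' b)) = f (max b (min b' a')) - f (max b (min b' a))"
proof -
  consider "a' \<le> b" | "b' \<le> a" | "b < a'" "a < b'" by linarith
  then show ?thesis
  proof cases
    case 1
    then have "max a (min a' b') = max a (min a' b)" "max b (min b' a') = max b (min b' a)"
      using assms by linarith+
    then show ?thesis by simp
  next
    case 2
    then have "max a (min a' b') = max a (min a' b)" "max b (min b' a') = max b (min b' a)"
      using assms by linarith+
    then show ?thesis by simp
  next
    case 3
    then have "max a (min a' b') = min a' b'" "max b (min b' a') = min a' b'" 
      "max a (min a' b) = max a b" "max b (min b' a) = max a b"
      using assms by linarith+
    then show ?thesis by simp
  qed
qed

text \<open>When two cells overlap in an interval of positive length, that interval starts after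
  both left end points, which gives adaptedness, and these end points are within one mesh of each
  other, which gives smallness.\<close>

lemma clamp_nondegenerate:
  fixes a a' b b' :: real
  assumes "max a (min a' b) < max a (min a' b')" "a \<le> a'" "a' - a \<le> d" "b' - b \<le> d"
  shows "a \<le> max a (min a' b)" "b \<le> max a (min a' b)" "\<bar>a - b\<bar> \<le> d"
  using assms by linarith+

context filtered_brownian_motion
begin

definition ito_sum :: "(real \<Rightarrow> 'a \<Rightarrow> real) \<Rightarrow> (nat \<Rightarrow> real) \<Rightarrow> nat \<Rightarrow> 'a \<Rightarrow> real" where
  "ito_sum X s n w = (\<Sum>k<n. X (s k) w * dW s k w)"

definition nice_integrand :: "real \<Rightarrow> (real \<Rightarrow> 'a \<Rightarrow> real) \<Rightarrow> bool" where
  "nice_integrand R X \<longleftrightarrow> (\<forall>t\<in>{-pi..pi}. X t \<in> borel_measurable (FM t)) \<and>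
     (\<forall>w\<in>space M. continuous_on {-pi..pi} (\<lambda>t. X t w) \<and> (\<forall>t\<in>{-pi..pi}. \<bar>X t w\<bar> \<le> R))"

text \<open>Path continuity is not uniform over the sample space. The mean square of X_u - X_v,
  however, is by dominated convergence a continuous function of (u, v) on a compact square, hence
  uniformly continuous, and it vanishes on the diagonal.\<close>

lemma nice_integrand_L2_modulus:
  assumes X: "nice_integrand R X" and "e > 0"
  obtains \<delta> where "\<delta> > 0" "\<And>u v. u \<in> {-pi..pi} \<Longrightarrow> v \<in> {-pi..pi} \<Longrightarrow> \<bar>u - v\<bar> \<le> \<delta> \<Longrightarrow>
     expectation (\<lambda>w. (X u w - X v w)\<^sup>2) \<le> e"
proof -
  let ?f = "\<lambda>z. expectation (\<lambda>w. (X (fst z) w - X (snd z) w)\<^sup>2)"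
  let ?Q = "{-pi..pi} \<times> {-pi..pi} :: (real \<times> real) set"
  have meas [measurable]: "X u \<in> borel_measurable M" if "u \<in> {-pi..pi}" for u
    using X that measurable_FM_M[of "X u" u] by (auto simp: nice_integrand_def)
  have "continuous_on ?Q ?f"
    unfolding continuous_on_sequentially
  proof (intro allI ballI impI)
    fix z :: "nat \<Rightarrow> real \<times> real" and a assume a: "a \<in> ?Q" and z: "(\<forall>n. z n \<in> ?Q) \<and> z \<longlonglongrightarrow> a"
    have fz: "fst (z n) \<in> {-pi..pi}" "snd (z n) \<in> {-pi..pi}" for n using z by (auto simp: mem_Times_iff)
    have fa: "fst a \<in> {-pi..pi}" "snd a \<in> {-pi..pi}" using a by (auto simp: mem_Times_iff)
    have "(\<lambda>n. expectation (\<lambda>w. (X (fst (z n)) w - X (snd (z n)) w)\<^sup>2)) \<longlonglongrightarrow> ?f a"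
    proof (rule integral_dominated_convergence[where w = "\<lambda>_. (2 * R)\<^sup>2"])
      show "AE w in M. (\<lambda>n. (X (fst (z n)) w - X (snd (z n)) w)\<^sup>2) \<longlonglongrightarrow> (X (fst a) w - X (snd a) w)\<^sup>2"
      proof (intro AE_I2 tendsto_intros)
        fix w assume w: "w \<in> space M"
        then have c: "continuous_on {-pi..pi} (\<lambda>t. X t w)" using X by (auto simp: nice_integrand_def)
        show "(\<lambda>n. X (fst (z n)) w) \<longlonglongrightarrow> X (fst a) w"
          using z fz fa by (intro continuous_on_tendsto_compose[OF c]) (auto intro!: tendsto_fst)
        show "(\<lambda>n. X (snd (z n)) w) \<longlonglongrightarrow> X (snd a) w"
          using z fz fa by (intro continuous_on_tendsto_compose[OF c]) (auto intro!: tendsto_snd)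
      qed
      show "AE w in M. norm ((X (fst (z n)) w - X (snd (z n)) w)\<^sup>2) \<le> (2 * R)\<^sup>2" for n
      proof (intro AE_I2)
        fix w assume w: "w \<in> space M"
        have "\<bar>X (fst (z n)) w\<bar> \<le> R" "\<bar>X (snd (z n)) w\<bar> \<le> R"
          using X w fz[of n] by (auto simp: nice_integrand_def)
        then have "\<bar>X (fst (z n)) w - X (snd (z n)) w\<bar> \<le> \<bar>2 * R\<bar>" by auto
        then show "norm ((X (fst (z n)) w - X (snd (z n)) w)\<^sup>2) \<le> (2 * R)\<^sup>2"
          by (simp add: abs_le_square_iff)
      qed
    qed (use fz fa in \<open>auto intro!: borel_measurable_power borel_measurable_diff meas\<close>)
    then show "(?f \<circ> z) \<longlonglongrightarrow> ?f a" by (simp add: o_def)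
  qed
  then have "uniformly_continuous_on ?Q ?f"
    by (intro compact_uniformly_continuous compact_Times) auto
  then obtain d where d: "d > 0" "\<And>z z'. z \<in> ?Q \<Longrightarrow> z' \<in> ?Q \<Longrightarrow> dist z' z < d \<Longrightarrow> dist (?f z') (?f z) < e"
    using \<open>e > 0\<close> unfolding uniformly_continuous_on_def by meson
  show ?thesis
  proof (rule that[of "d / 2"])
    fix u v :: real assume uv: "u \<in> {-pi..pi}" "v \<in> {-pi..pi}" "\<bar>u - v\<bar> \<le> d / 2"
    have "dist (u, v) (v, v) < d"
      using uv d(1) by (simp add: dist_Pair_Pair dist_real_def)
    from d(2)[OF _ _ this] uv have "\<bar>?f (u, v)\<bar> < e"
      by (simp add: dist_real_def)
    then show "expectation (\<lambda>w. (X u w - X v w)\<^sup>2) \<le> e" by simp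
  qed (use d in simp)
qed

text \<open>Both sums are rewritten over the common refinement \<open>s\<close>, obtained by listing, for each
  cell of the first grid, the points of the second grid clamped to that cell.\<close>
lemma ito_sum_grid_compare:
  assumes a: "grid a n" and b: "grid b m" and m: "m > 0" and ends: "a 0 = b 0" "a n = b m"
    and X: "nice_integrand R X"
    and mesh: "\<And>i. i < n \<Longrightarrow> a (Suc i) - a i \<le> \<delta>" "\<And>j. j < m \<Longrightarrow> b (Suc j) - b j \<le> \<delta>"
    and mod: "\<And>u v. u \<in> {-pi..pi} \<Longrightarrow> v \<in> {-pi..pi} \<Longrightarrow> \<bar>u - v\<bar> \<le> \<delta> \<Longrightarrow> expectation (\<lambda>w. (X u w - X v w)\<^sup>2) \<le> e"
    and e: "e \<ge> 0"
  shows "integrable M (\<lambda>w. (ito_sum X a n w - ito_sum X b m w)\<^sup>2)"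
    and "expectation (\<lambda>w. (ito_sum X a n w - ito_sum X b m w)\<^sup>2) \<le> moment_const 1 * (2 * pi * e)"
proof -
  define cl where "cl i x = max (a i) (min (a (Suc i)) x)" for i x
  define s where "s k = cl (k div m) (b (k mod m))" for k
  have s1: "s (i * m + j) = cl i (b j)" if "j < m" for i j
    using that by (simp add: s_def)
  have am: "a i \<le> a j" if "i \<le> j" "j \<le> n" for i j using grid_mono[OF a that] .
  have bm': "b i \<le> b j" if "i \<le> j" "j \<le> m" for i j using grid_mono[OF b that] .
  \<comment> \<open>For \<open>j = m - 1\<close> the successor index already belongs to the next
    cell. The two descriptions of that point agree because both grids have the same end
    points.\<close>
  have s2: "s (Suc (i * m + j)) = cl i (b (Suc j))" if "j < m" "i < n" for i j
  proof (cases "Suc j < m")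
    case True
    then show ?thesis using s1[of "Suc j" i] by simp
  next
    case False
    then have j: "Suc j = m" using that by simp
    have "s (Suc (i * m + j)) = cl (Suc i) (b 0)"
      using s1[OF m, of "Suc i"] j by (metis add.commute add.right_neutral add_Suc_right mult_Suc)
    also have "\<dots> = a (Suc i)"
      using am[of 0 "Suc i"] that ends by (simp add: cl_def)
    also have "\<dots> = cl i (b (Suc j))"
      using am[of "Suc i" n] am[of i "Suc i"] that ends j by (simp add: cl_def)
    finally show ?thesis .
  qed
  have dm: "k div m < n" "k mod m < m" "k div m * m + k mod m = k" if "k < n * m" for k
    using that m by (auto simp: less_mult_imp_div_less)
  have ain: "a i \<in> {-pi..pi}" if "i \<le> n" for i using grid_in[OF a that] .
  have bin: "b i \<in> {-pi..pi}" if "i \<le> m" for i using grid_in[OF b that] .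
  have clin: "cl i x \<in> {-pi..pi}" if "i < n" for i x
    using ain[of i] ain[of "Suc i"] that by (auto simp: cl_def)
  have sk: "s k = cl (k div m) (b (k mod m))" "s (Suc k) = cl (k div m) (b (Suc (k mod m)))" if "k < n * m" for k
    using s1[OF dm(2)[OF that], of "k div m"] s2[OF dm(2)[OF that] dm(1)[OF that]]
    unfolding dm(3)[OF that] .
  have gs: "grid s (n * m)"
    unfolding grid_def
  proof (intro conjI allI impI)
    fix k assume k: "k \<le> n * m"
    show "s k \<in> {-pi..pi}"
    proof (cases "k = n * m")
      case True
      then have "s k = a n"
        using m am[of 0 n] ends by (simp add: s_def cl_def)
      then show ?thesis using ain[of n] by simp
    next
      case False
      then show ?thesis using clin[of "k div m"] dm[of k] k by (simp add: s_def)
    qed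
  next
    fix k assume k: "k < n * m"
    show "s k \<le> s (Suc k)"
      using bm'[of "k mod m" "Suc (k mod m)"] dm(2)[OF k] unfolding sk[OF k] cl_def
      by (intro max.mono min.mono) auto
  qed
  define ndeg where "ndeg k \<longleftrightarrow> s k < s (Suc k)" for k
  \<comment> \<open>On a degenerate cell one of the two values may lie in the future of
    \<open>s k\<close>, so the integrand is set to 0 there to keep it adapted. The sums do not
    change, since the increment over such a cell is 0.\<close>
  define Z where "Z k w = (if ndeg k then X (a (k div m)) w - X (b (k mod m)) w else 0)" for k w
  have nd: "s k \<ge> a (k div m)" "s k \<ge> b (k mod m)" "\<bar>a (k div m) - b (k mod m)\<bar> \<le> \<delta>" if "ndeg k" "k < n * m" for k
  proof -
    let ?i = "k div m" and ?j = "k mod m"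
    have "max (a ?i) (min (a (Suc ?i)) (b ?j)) < max (a ?i) (min (a (Suc ?i)) (b (Suc ?j)))"
      using that(1) sk[OF that(2)] unfolding ndeg_def cl_def by simp
    note c = clamp_nondegenerate[OF this am mesh(1)[OF dm(1)[OF that(2)]] mesh(2)[OF dm(2)[OF that(2)]]]
    show "s k \<ge> a ?i" "s k \<ge> b ?j" "\<bar>a ?i - b ?j\<bar> \<le> \<delta>"
      using c dm(1)[OF that(2)] unfolding sk(1)[OF that(2)] cl_def by auto
  qed
  have Zad: "grid_adapted s (n * m) Z"
    unfolding grid_adapted_def
  proof (intro allI impI)
    fix k assume k: "k < n * m"
    show "Z k \<in> borel_measurable (FM (s k))"
    proof (cases "ndeg k")
      case True
      have X': "X t \<in> borel_measurable (FM t)" if "t \<in> {-pi..pi}" for t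
        using X that by (simp add: nice_integrand_def)
      have kin: "s k \<in> {-pi..pi}" "a (k div m) \<in> {-pi..pi}" "b (k mod m) \<in> {-pi..pi}"
        using grid_in[OF gs, of k] ain[of "k div m"] bin[of "k mod m"] dm(1,2)[OF k] k by simp_all
      have "X (a (k div m)) \<in> borel_measurable (FM (s k))"
        by (rule measurable_FM_mono[OF X'[OF kin(2)] nd(1)[OF True k] kin(2,1)])
      moreover have "X (b (k mod m)) \<in> borel_measurable (FM (s k))"
        by (rule measurable_FM_mono[OF X'[OF kin(3)] nd(2)[OF True k] kin(3,1)])
      ultimately show ?thesis
        using True by (simp add: Z_def[abs_def])
    qed (simp add: Z_def[abs_def])
  qed
  have Zb: "bounded_adapted s (n * m) \<bar>2 * R\<bar> Z"
    unfolding bounded_adapted_def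
  proof (intro conjI Zad allI impI ballI)
    fix k w assume k: "k < n * m" and w: "w \<in> space M"
    have "\<bar>X (a (k div m)) w\<bar> \<le> R" "\<bar>X (b (k mod m)) w\<bar> \<le> R"
      using X w ain[of "k div m"] bin[of "k mod m"] dm[OF k] by (auto simp: nice_integrand_def)
    then show "\<bar>Z k w\<bar> \<le> \<bar>2 * R\<bar>" by (auto simp: Z_def)
  qed
  have Zint: "integrable M (\<lambda>w. Z k w ^ (2 * Suc 0))" if "k < n * m" for k
    by (rule bounded_adapted_integrable[OF gs Zb that])
  have A: "ito_sum X a n w = (\<Sum>k<n * m. X (a (k div m)) w * dW s k w)" for w
  proof -
    have "dW a i w = (\<Sum>j<m. dW s (i * m + j) w)" if i: "i < n" for i
    proof -
      have "(\<Sum>j<m. dW s (i * m + j) w) = (\<Sum>j<m. W (cl i (b (Suc j))) w - W (cl i (b j)) w)"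
        using i by (intro sum.cong) (auto simp: dW_def s1 s2)
      also have "\<dots> = W (cl i (b m)) w - W (cl i (b 0)) w"
        by (rule sum_lessThan_telescope)
      finally have "(\<Sum>j<m. dW s (i * m + j) w) = W (cl i (b m)) w - W (cl i (b 0)) w" .
      moreover have "cl i (b m) = a (Suc i)" "cl i (b 0) = a i"
        using am[of i "Suc i"] am[of "Suc i" n] am[of 0 i] i ends by (auto simp: cl_def)
      ultimately show ?thesis by (simp add: dW_def)
    qed
    then show ?thesis
      using m by (simp add: ito_sum_def sum_lessThan_mult sum_distrib_left)
  qed
  \<comment> \<open>The refinement is listed cell by cell of \<open>a\<close>, so the pieces of one
    cell of \<open>b\<close> are scattered over all \<open>i\<close>. Exchanging the roles of the
    two clampings makes them telescope.\<close>
  have B: "ito_sum X b m w = (\<Sum>k<n * m. X (b (k mod m)) w * dW s k w)" for w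
  proof -
    define cl' where "cl' j x = max (b j) (min (b (Suc j)) x)" for j x
    have "dW b j w = (\<Sum>i<n. dW s (i * m + j) w)" if j: "j < m" for j
    proof -
      have "dW s (i * m + j) w = W (cl' j (a (Suc i))) w - W (cl' j (a i)) w" if i: "i < n" for i
        using am[of i "Suc i"] bm'[of j "Suc j"] i j unfolding dW_def s1[OF j] s2[OF j i] cl_def cl'_def
        by (intro clamp_increment_swap) auto
      then have "(\<Sum>i<n. dW s (i * m + j) w) = (\<Sum>i<n. W (cl' j (a (Suc i))) w - W (cl' j (a i)) w)"
        by (intro sum.cong) auto
      also have "\<dots> = W (cl' j (a n)) w - W (cl' j (a 0)) w"
        by (rule sum_lessThan_telescope)
      finally have "(\<Sum>i<n. dW s (i * m + j) w) = W (cl' j (a n)) w - W (cl' j (a 0)) w" .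
      moreover have "cl' j (a n) = b (Suc j)" "cl' j (a 0) = b j"
        using bm'[of j "Suc j"] bm'[of "Suc j" m] bm'[of 0 j] j ends by (auto simp: cl'_def)
      ultimately show ?thesis by (simp add: dW_def)
    qed
    then have "ito_sum X b m w = (\<Sum>j<m. \<Sum>i<n. X (b j) w * dW s (i * m + j) w)"
      by (simp add: ito_sum_def sum_distrib_left)
    also have "\<dots> = (\<Sum>i<n. \<Sum>j<m. X (b j) w * dW s (i * m + j) w)"
      by (rule sum.swap)
    finally show ?thesis
      using m by (simp add: sum_lessThan_mult)
  qed
  have diff: "ito_sum X a n w - ito_sum X b m w = (\<Sum>k<n * m. 1 * Z k w * dW s k w)" for w
    unfolding A B sum_subtractf[symmetric]
  proof (rule sum.cong)
    fix k assume "k \<in> {..<n * m}"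
    then have "s k = s (Suc k)" if "\<not> ndeg k"
      using that grid_step[OF gs, of k] by (auto simp: ndeg_def)
    then show "X (a (k div m)) w * dW s k w - X (b (k mod m)) w * dW s k w = 1 * Z k w * dW s k w"
      by (auto simp: Z_def dW_def algebra_simps)
  qed simp
  have G: "(\<Sum>k<n * m. 1\<^sup>2 * (s (Suc k) - s k)) \<le> 2 * pi"
    using grid_length[OF gs] by simp
  note mm = martingale_transform_moment[OF gs Zad Zint _ G]
  show "integrable M (\<lambda>w. (ito_sum X a n w - ito_sum X b m w)\<^sup>2)"
    using mm(1) unfolding diff by simp
  have "(\<Sum>k<n * m. 1\<^sup>2 * (s (Suc k) - s k) * expectation (\<lambda>w. Z k w ^ (2 * Suc 0))) \<le> (\<Sum>k<n * m. (s (Suc k) - s k) * e)"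
  proof (rule sum_mono)
    fix k assume "k \<in> {..<n * m}"
    then have k: "k < n * m" by simp
    have "expectation (\<lambda>w. Z k w ^ (2 * Suc 0)) \<le> e"
    proof (cases "ndeg k")
      case True
      then show ?thesis
        using mod[OF ain[of "k div m"] bin[of "k mod m"] nd(3)[OF True k]] dm[OF k] by (simp add: Z_def)
    qed (simp add: Z_def e)
    then show "1\<^sup>2 * (s (Suc k) - s k) * expectation (\<lambda>w. Z k w ^ (2 * Suc 0)) \<le> (s (Suc k) - s k) * e"
      using grid_step[OF gs k] by (simp add: mult_left_mono)
  qed
  also have "\<dots> \<le> 2 * pi * e"
    unfolding sum_distrib_right[symmetric] by (intro mult_right_mono grid_length[OF gs] e)
  finally show "expectation (\<lambda>w. (ito_sum X a n w - ito_sum X b m w)\<^sup>2) \<le> moment_const 1 * (2 * pi * e)"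
    using mm(2) moment_const_pos[of 1] unfolding diff by (simp add: order_trans[OF _ mult_left_mono])
qed

end

section \<open>Passage to the limit: Fatou's lemma, Riemann sums and refinements of a
  partition\<close>

lemma nn_integral_le_of_tendsto:
  fixes u :: "nat \<Rightarrow> 'a \<Rightarrow> real"
  assumes "\<And>n. u n \<in> borel_measurable M" "AE w in M. (\<lambda>n. u n w) \<longlonglongrightarrow> v w"
    and le: "\<And>n. (\<integral>\<^sup>+ w. ennreal (u n w) \<partial>M) \<le> ennreal (c n)" and c: "c \<longlonglongrightarrow> C"
  shows "(\<integral>\<^sup>+ w. ennreal (v w) \<partial>M) \<le> ennreal C"
proof -
  have "(\<integral>\<^sup>+ w. ennreal (v w) \<partial>M) = (\<integral>\<^sup>+ w. liminf (\<lambda>n. ennreal (u n w)) \<partial>M)"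
    using assms(2) by (intro nn_integral_cong_AE) (auto elim!: eventually_mono intro!: lim_imp_Liminf[symmetric] tendsto_ennrealI)
  also have "\<dots> \<le> liminf (\<lambda>n. \<integral>\<^sup>+ w. ennreal (u n w) \<partial>M)"
    using assms(1) by (intro nn_integral_liminf) measurable
  also have "\<dots> \<le> liminf (\<lambda>n. ennreal (c n))"
    using le by (intro Liminf_mono) auto
  also have "\<dots> = ennreal C"
    using c by (intro lim_imp_Liminf tendsto_ennrealI) auto
  finally show ?thesis .
qed

lemma riemann_sums_tendsto:
  fixes f :: "real \<Rightarrow> real"
  assumes f: "continuous_on {a..b} f" and ends: "\<And>l. s l 0 = a" "\<And>l. s l (n l) = b"
    and step: "\<And>l k. k < n l \<Longrightarrow> s l k \<le> s l (Suc k)" "\<And>l k. k < n l \<Longrightarrow> s l (Suc k) - s l k \<le> \<delta> l" and "\<delta> \<longlonglongrightarrow> 0"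
  shows "(\<lambda>l. \<Sum>k<n l. (s l (Suc k) - s l k) * f (s l k)) \<longlonglongrightarrow> integral {a..b} f"
proof (rule LIMSEQ_I)
  have mono: "s l i \<le> s l j" if "i \<le> j" "j \<le> n l" for l i j
    using that(1)
  proof (induction rule: inc_induct)
    case (step k)
    then show ?case using assms(4)[of k l] that by simp
  qed simp
  fix e :: real assume e: "e > 0"
  have ab: "a \<le> b" using mono[of 0 "n 0" 0] ends by simp
  define e' where "e' = e / (2 * (b - a + 1))"
  have "e' > 0" using e ab by (simp add: e'_def)
  moreover have "e' * (b - a + 1) = e / 2"
    using ab unfolding e'_def by (simp add: divide_simps)
  ultimately have e': "e' > 0" "e' * (b - a) < e"
    using e by (auto simp: algebra_simps)
  have "uniformly_continuous_on {a..b} f"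
    using f by (intro compact_uniformly_continuous) auto
  then obtain d where d: "d > 0" "\<And>u v. u \<in> {a..b} \<Longrightarrow> v \<in> {a..b} \<Longrightarrow> dist v u < d \<Longrightarrow> dist (f v) (f u) < e'"
    using e' unfolding uniformly_continuous_on_def by meson
  obtain l0 where l0: "\<And>l. l \<ge> l0 \<Longrightarrow> \<bar>\<delta> l\<bar> < d"
    using LIMSEQ_D[OF \<open>\<delta> \<longlonglongrightarrow> 0\<close> d(1)] by auto
  show "\<exists>no. \<forall>l\<ge>no. norm ((\<Sum>k<n l. (s l (Suc k) - s l k) * f (s l k)) - integral {a..b} f) < e"
  proof (intro exI allI impI)
    fix l assume l: "l \<ge> l0"
    have "\<bar>(\<Sum>k<n l. (s l (Suc k) - s l k) * f (s l k)) - integral {s l 0..s l (n l)} f\<bar> \<le> e' * (s l (n l) - s l 0)"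
    proof (rule riemann_sum_error)
      fix k u assume k: "k < n l" and u: "u \<in> {s l k..s l (Suc k)}"
      have "dist (s l k) u < d"
        using u step(2)[OF k] l0[OF l] by (auto simp: dist_real_def)
      moreover have "s l k \<in> {a..b}" "u \<in> {a..b}"
        using mono[of 0 k l] mono[of k "n l" l] mono[of "Suc k" "n l" l] k u by (auto simp: ends)
      ultimately show "\<bar>f (s l k) - f u\<bar> \<le> e'"
        using d(2)[of u "s l k"] by (simp add: dist_real_def)
    qed (use step f ends in auto)
    with e' show "norm ((\<Sum>k<n l. (s l (Suc k) - s l k) * f (s l k)) - integral {a..b} f) < e"
      by (simp add: ends)
  qed
qed

text \<open>The upper triangle is folded onto the lower one, so that the inner sum looks only into
  the past, as an iterated stochastic sum must.\<close>

lemma quadratic_form_split: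
  fixes E :: "nat \<Rightarrow> nat \<Rightarrow> real"
  shows "(\<Sum>k<n. \<Sum>j<n. E k j * x k * x j)
     = (\<Sum>k<n. (\<Sum>j<k. (E k j + E j k) * x j) * x k) + (\<Sum>k<n. E k k * (x k)\<^sup>2)"
proof (induction n)
  case (Suc n)
  have "(\<Sum>k<Suc n. \<Sum>j<Suc n. E k j * x k * x j)
    = (\<Sum>k<n. \<Sum>j<n. E k j * x k * x j) + (\<Sum>k<n. E k n * x k * x n) + (\<Sum>j<n. E n j * x n * x j) + E n n * x n * x n"
    by (simp add: sum.distrib)
  moreover have "(\<Sum>k<n. E k n * x k * x n) + (\<Sum>j<n. E n j * x n * x j) = (\<Sum>j<n. (E n j + E j n) * x j) * x n"
    unfolding sum_distrib_right sum.distrib[symmetric] by (intro sum.cong) (auto simp: algebra_simps)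
  ultimately show ?case
    using Suc by (simp add: power2_eq_square)
qed simp

text \<open>Each cell is cut into \<open>L\<close> equal parts and index \<open>i * L + j\<close> is
  the \<open>j\<close>-th point of cell \<open>i\<close>. At the last index \<open>m * L\<close> the
  formula mentions \<open>t (Suc m)\<close>, a point beyond the grid, but with coefficient
  0.\<close>

definition fine_grid :: "(nat \<Rightarrow> real) \<Rightarrow> nat \<Rightarrow> nat \<Rightarrow> real" where
  "fine_grid t L k = t (k div L) + real (k mod L) * (t (Suc (k div L)) - t (k div L)) / real L"

lemma fine_grid_block:
  assumes "j \<le> L" "L > 0"
  shows "fine_grid t L (i * L + j) = t i + real j * (t (Suc i) - t i) / real L"
proof (cases "j = L")
  case True
  have "i * L + j = Suc i * L" using True by simp
  then have "fine_grid t L (i * L + j) = t (Suc i)"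
    using assms by (simp only: fine_grid_def) simp
  then show ?thesis using True assms by simp
qed (use assms in \<open>simp add: fine_grid_def\<close>)

lemma fine_grid_mult: "L > 0 \<Longrightarrow> fine_grid t L (i * L) = t i"
  using fine_grid_block[of 0 L t i] by simp

lemma fine_grid_step:
  assumes "L > 0"
  shows "fine_grid t L (Suc k) - fine_grid t L k = (t (Suc (k div L)) - t (k div L)) / real L"
proof -
  have m: "k mod L < L" using assms by simp
  have "fine_grid t L (Suc (k div L * L + k mod L)) - fine_grid t L (k div L * L + k mod L) = (t (Suc (k div L)) - t (k div L)) / real L"
    using fine_grid_block[of "Suc (k mod L)" L t "k div L"] fine_grid_block[of "k mod L" L t "k div L"] m assms
    by (simp add: field_simps del: mod_mult_div_eq div_mult_mod_eq mult_div_mod_eq)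
  then show ?thesis unfolding div_mult_mod_eq .
qed

context filtered_brownian_motion
begin

lemma gridI:
  assumes "\<And>k. k < n \<Longrightarrow> s k \<le> s (Suc k)" "- pi \<le> s 0" "s n \<le> pi"
  shows "grid s n"
proof -
  have "s i \<le> s j" if "i \<le> j" "j \<le> n" for i j
    using that(1)
  proof (induction rule: inc_induct)
    case (step k)
    then show ?case using assms(1)[of k] that by simp
  qed simp
  from this[of 0] this[of _ n] assms show ?thesis
    unfolding grid_def by (auto intro: order_trans)
qed

lemma fine_grid_grid:
  assumes t: "grid t m" and L: "L > 0"
  shows "grid (fine_grid t L) (m * L)"
    and "k < m * L \<Longrightarrow> fine_grid t L (Suc k) - fine_grid t L k \<le> 2 * pi / L"
proof -
  have d: "k div L < m" if "k < m * L" for k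
    using that by (simp add: less_mult_imp_div_less)
  show "grid (fine_grid t L) (m * L)"
  proof (rule gridI)
    fix k assume "k < m * L"
    then have "0 \<le> fine_grid t L (Suc k) - fine_grid t L k"
      using grid_step[OF t d] fine_grid_step[OF L, of t k] by simp
    then show "fine_grid t L k \<le> fine_grid t L (Suc k)" by simp
  next
    show "- pi \<le> fine_grid t L 0" "fine_grid t L (m * L) \<le> pi"
      using fine_grid_mult[OF L, of t 0] fine_grid_mult[OF L, of t m] grid_in[OF t, of 0] grid_in[OF t, of m] by auto
  qed
  show "fine_grid t L (Suc k) - fine_grid t L k \<le> 2 * pi / L" if "k < m * L"
    unfolding fine_grid_step[OF L] using grid_in[OF t, of "k div L"] grid_in[OF t, of "Suc (k div L)"] d[OF that] L
    by (intro divide_right_mono) auto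
qed

section \<open>Convergence in probability to zero\<close>

lemma mesh_tendsto: "(\<lambda>l. 2 * pi / real (Suc l)) \<longlonglongrightarrow> 0"
  by (rule LIMSEQ_Suc[OF tendsto_divide_0]) (auto intro!: filterlim_real_sequentially filterlim_at_top_imp_at_infinity)

text \<open>Convergence to 0 in probability, metrised by the mean of min 1 |Z|. In this form
  domination is monotonicity of the integral, and almost surely convergent subsequences come from
  convergence in L1.\<close>

definition vanishing :: "(nat \<Rightarrow> 'a \<Rightarrow> real) \<Rightarrow> bool" where
  "vanishing Z \<longleftrightarrow> (\<forall>l. Z l \<in> borel_measurable M) \<and> (\<lambda>l. expectation (\<lambda>w. min 1 \<bar>Z l w\<bar>)) \<longlonglongrightarrow> 0"

lemma integrable_min1: "Z \<in> borel_measurable M \<Longrightarrow> integrable M (\<lambda>w. min 1 \<bar>Z w\<bar>)" for Z :: "'a \<Rightarrow> real"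
  by (rule integrable_const_bound[where B = 1]) auto

lemma vanishing_of_L2:
  assumes int: "\<And>l. integrable M (\<lambda>w. (Z l w)\<^sup>2)" and meas: "\<And>l. Z l \<in> borel_measurable M"
    and lim: "(\<lambda>l. expectation (\<lambda>w. (Z l w)\<^sup>2)) \<longlonglongrightarrow> 0"
  shows "vanishing Z"
  unfolding vanishing_def
proof (intro conjI allI meas LIMSEQ_I)
  fix e :: real assume e: "e > 0"
  obtain l0 where l0: "\<And>l. l \<ge> l0 \<Longrightarrow> expectation (\<lambda>w. (Z l w)\<^sup>2) < (e / 2)\<^sup>2"
    using LIMSEQ_D[OF lim, of "(e / 2)\<^sup>2"] e by (auto dest!: abs_less_iff[THEN iffD1, OF _])
  show "\<exists>no. \<forall>l\<ge>no. norm (expectation (\<lambda>w. min 1 \<bar>Z l w\<bar>) - 0) < e"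
  proof (intro exI allI impI)
    fix l assume l: "l \<ge> l0"
    \<comment> \<open>The two terms are balanced for second moments below (e/2)^2: each then
      contributes at most e/2 to the mean.\<close>
    have "min 1 \<bar>z\<bar> \<le> e / 2 + z\<^sup>2 / (e / 2)" for z :: real
    proof (cases "\<bar>z\<bar> \<le> e / 2")
      case True
      then have "min 1 \<bar>z\<bar> \<le> e / 2" "0 \<le> z\<^sup>2 / (e / 2)" using e by auto
      then show ?thesis by linarith
    next
      case False
      then have "\<bar>z\<bar> * (e / 2) \<le> z\<^sup>2"
        by (metis abs_ge_zero linorder_le_cases mult_left_mono power2_abs power2_eq_square)
      then have "\<bar>z\<bar> \<le> z\<^sup>2 / (e / 2)" using e by (simp add: field_simps)
      then show ?thesis using e by linarith
    qed
    then have "expectation (\<lambda>w. min 1 \<bar>Z l w\<bar>) \<le> expectation (\<lambda>w. e / 2 + (Z l w)\<^sup>2 / (e / 2))"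
      by (intro integral_mono integrable_min1 meas Bochner_Integration.integrable_add integrable_divide int) auto
    also have "\<dots> = e / 2 + expectation (\<lambda>w. (Z l w)\<^sup>2) / (e / 2)"
      using int[of l] by (simp add: prob_space)
    also have "\<dots> < e / 2 + (e / 2)\<^sup>2 / (e / 2)"
      using l0[OF l] e by (intro add_strict_left_mono divide_strict_right_mono) auto
    also have "\<dots> = e" by (simp add: power2_eq_square)
    moreover have "0 \<le> expectation (\<lambda>w. min 1 \<bar>Z l w\<bar>)"
      by (rule Bochner_Integration.integral_nonneg) simp
    ultimately show "norm (expectation (\<lambda>w. min 1 \<bar>Z l w\<bar>) - 0) < e" by simp
  qed
qed

lemma vanishing_of_conv_in_prob:
  assumes meas: "\<And>l. X l \<in> borel_measurable M" "Y \<in> borel_measurable M" and lim: "conv_in_prob M X Y"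
  shows "vanishing (\<lambda>l w. X l w - Y w)"
  unfolding vanishing_def
proof (intro conjI allI LIMSEQ_I)
  note [measurable] = meas
  show "(\<lambda>w. X l w - Y w) \<in> borel_measurable M" for l by measurable
  fix e :: real assume e: "e > 0"
  let ?A = "\<lambda>l. {w\<in>space M. \<bar>X l w - Y w\<bar> > e / 2}"
  have "(\<lambda>l. measure M (?A l)) \<longlonglongrightarrow> 0"
    using lim[unfolded conv_in_prob_def, rule_format, of "e / 2"] e by simp
  from LIMSEQ_D[OF this, of "e / 2"] e
  obtain l0 where l0: "\<And>l. l \<ge> l0 \<Longrightarrow> measure M (?A l) < e / 2"
    by auto
  show "\<exists>no. \<forall>l\<ge>no. norm (expectation (\<lambda>w. min 1 \<bar>X l w - Y w\<bar>) - 0) < e"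
  proof (intro exI allI impI)
    fix l assume l: "l \<ge> l0"
    have A: "?A l \<in> sets M" by measurable
    have "expectation (\<lambda>w. min 1 \<bar>X l w - Y w\<bar>) \<le> expectation (\<lambda>w. e / 2 + indicator (?A l) w)"
    proof (intro integral_mono integrable_min1 Bochner_Integration.integrable_add)
      show "min 1 \<bar>X l w - Y w\<bar> \<le> e / 2 + indicator (?A l) w" if "w \<in> space M" for w
      proof (cases "w \<in> ?A l")
        case True
        then show ?thesis using e min.cobounded1[of 1 "\<bar>X l w - Y w\<bar>"] unfolding indicator_simps(1)[OF True] by linarith
      next
        case False
        then have "\<bar>X l w - Y w\<bar> \<le> e / 2" using that by simp
        then show ?thesis using min.cobounded2[of 1 "\<bar>X l w - Y w\<bar>"] unfolding indicator_simps(2)[OF False] by linarith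
      qed
    qed (use A in \<open>auto intro!: integrable_real_indicator simp: less_top[symmetric] simp del: Int_Collect\<close>)
    also have "\<dots> = e / 2 + measure M (?A l)"
    proof -
      have "integrable M (indicator (?A l) :: 'a \<Rightarrow> real)"
        using A by (intro integrable_real_indicator) (auto simp: less_top[symmetric])
      then show ?thesis
        using A by (subst Bochner_Integration.integral_add) (simp_all add: prob_space del: Int_Collect)
    qed
    also have "\<dots> < e" using l0[OF l] by simp
    moreover have "0 \<le> expectation (\<lambda>w. min 1 \<bar>X l w - Y w\<bar>)"
      by (rule Bochner_Integration.integral_nonneg) simp
    ultimately show "norm (expectation (\<lambda>w. min 1 \<bar>X l w - Y w\<bar>) - 0) < e" by simp
  qed
qed

lemma vanishing_bound:
  assumes "vanishing X" "vanishing Y" and meas: "\<And>l. Z l \<in> borel_measurable M"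
    and le: "\<And>l w. w \<in> space M \<Longrightarrow> \<bar>Z l w\<bar> \<le> \<bar>X l w\<bar> + \<bar>Y l w\<bar>"
  shows "vanishing Z"
  unfolding vanishing_def
proof (intro conjI allI meas)
  have m: "X l \<in> borel_measurable M" "Y l \<in> borel_measurable M" for l
    using assms by (auto simp: vanishing_def)
  show "(\<lambda>l. expectation (\<lambda>w. min 1 \<bar>Z l w\<bar>)) \<longlonglongrightarrow> 0"
  proof (rule tendsto_sandwich[OF _ _ tendsto_const])
    show "(\<lambda>l. expectation (\<lambda>w. min 1 \<bar>X l w\<bar>) + expectation (\<lambda>w. min 1 \<bar>Y l w\<bar>)) \<longlonglongrightarrow> 0"
      using assms(1,2) unfolding vanishing_def by (intro tendsto_add_zero) auto
    have "expectation (\<lambda>w. min 1 \<bar>Z l w\<bar>) \<le> expectation (\<lambda>w. min 1 \<bar>X l w\<bar> + min 1 \<bar>Y l w\<bar>)" for l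
    proof (intro integral_mono integrable_min1 meas Bochner_Integration.integrable_add m)
      fix w assume "w \<in> space M"
      from le[OF this, of l] show "min 1 \<bar>Z l w\<bar> \<le> min 1 \<bar>X l w\<bar> + min 1 \<bar>Y l w\<bar>"
        by linarith
    qed
    then show "\<forall>\<^sub>F l in sequentially. expectation (\<lambda>w. min 1 \<bar>Z l w\<bar>) \<le> expectation (\<lambda>w. min 1 \<bar>X l w\<bar>) + expectation (\<lambda>w. min 1 \<bar>Y l w\<bar>)"
      using integrable_min1 m by simp
    show "\<forall>\<^sub>F l in sequentially. 0 \<le> expectation (\<lambda>w. min 1 \<bar>Z l w\<bar>)"
      by (intro always_eventually allI Bochner_Integration.integral_nonneg) simp
  qed
qed

lemma vanishing_sum:
  assumes "finite I" "\<And>i. i \<in> I \<Longrightarrow> vanishing (Z i)"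
  shows "vanishing (\<lambda>l w. \<Sum>i\<in>I. \<bar>Z i l w\<bar>)"
  using assms
proof (induction rule: finite_induct)
  case empty
  then show ?case by (simp add: vanishing_def)
next
  case (insert i I)
  then have I: "vanishing (\<lambda>l w. \<Sum>i\<in>I. \<bar>Z i l w\<bar>)" and i: "vanishing (Z i)" by auto
  show ?case
    by (rule vanishing_bound[OF i I]) (use insert i I in \<open>auto simp: vanishing_def intro!: borel_measurable_add borel_measurable_abs\<close>)
qed

lemma vanishing_AE_subseq:
  assumes "vanishing Z"
  obtains r :: "nat \<Rightarrow> nat" where "strict_mono r" "AE w in M. (\<lambda>l. Z (r l) w) \<longlonglongrightarrow> 0"
proof -
  have "\<exists>r. strict_mono r \<and> (AE w in M. (\<lambda>l. min 1 \<bar>Z (r l) w\<bar>) \<longlonglongrightarrow> 0)"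
    using assms unfolding vanishing_def
    by (intro tendsto_L1_AE_subseq integrable_min1) auto
  then obtain r where r: "strict_mono r" "AE w in M. (\<lambda>l. min 1 \<bar>Z (r l) w\<bar>) \<longlonglongrightarrow> 0" by blast
  have "z \<longlonglongrightarrow> 0" if "(\<lambda>l. min 1 \<bar>z l\<bar>) \<longlonglongrightarrow> 0" for z :: "nat \<Rightarrow> real"
  proof (rule LIMSEQ_I)
    fix e :: real assume "e > 0"
    with LIMSEQ_D[OF that, of "min 1 e"] obtain n where "\<And>l. l \<ge> n \<Longrightarrow> min 1 \<bar>z l\<bar> < min 1 e" by auto
    from this have "norm (z l - 0) < e" if "l \<ge> n" for l
      using \<open>\<And>l. l \<ge> n \<Longrightarrow> min 1 \<bar>z l\<bar> < min 1 e\<close>[OF that] by (simp add: min_def split: if_splits)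
    then show "\<exists>no. \<forall>l\<ge>no. norm (z l - 0) < e" by blast
  qed
  with r show ?thesis by (intro that[of r]) (auto elim!: eventually_mono)
qed

end

section \<open>Quadratic forms in the increments of the Ito process\<close>

context filtered_brownian_motion
begin

definition path_integrand :: "(real \<Rightarrow> 'a \<Rightarrow> real) \<Rightarrow> bool" where
  "path_integrand X \<longleftrightarrow> (\<forall>t\<in>{-pi..pi}. X t \<in> borel_measurable (FM t)) \<and>
     (\<forall>w\<in>space M. continuous_on {-pi..pi} (\<lambda>t. X t w))"

text \<open>Truncating the values, rather than stopping the process, keeps continuity and
  adaptedness at each fixed time, so no stopping times arise.\<close>

definition clip :: "real \<Rightarrow> (real \<Rightarrow> 'a \<Rightarrow> real) \<Rightarrow> real \<Rightarrow> 'a \<Rightarrow> real" where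
  "clip R X t w = max (- R) (min R (X t w))"

lemma clip_nice: "path_integrand X \<Longrightarrow> 0 \<le> R \<Longrightarrow> nice_integrand R (clip R X)"
  unfolding path_integrand_def nice_integrand_def clip_def
  by (auto intro!: continuous_intros borel_measurable_max borel_measurable_min)

lemma clip_eq: "\<bar>X t w\<bar> \<le> R \<Longrightarrow> clip R X t w = X t w"
  by (simp add: clip_def)

lemma abs_clip_le: "0 \<le> R \<Longrightarrow> \<bar>clip R X t w\<bar> \<le> \<bar>X t w\<bar>"
  by (auto simp: clip_def)

lemma path_integrand_measurable: "path_integrand X \<Longrightarrow> t \<in> {-pi..pi} \<Longrightarrow> X t \<in> borel_measurable M"
  using measurable_FM_M[of "X t" t] by (simp add: path_integrand_def)

lemma nice_path_integrand: "nice_integrand R X \<Longrightarrow> path_integrand X"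
  by (simp add: path_integrand_def nice_integrand_def)

text \<open>Along continuous paths the integral is a pointwise limit of left Riemann sums, whose
  summands are measurable because the process is so at each fixed time.\<close>

lemma path_integral_measurable:
  assumes X: "path_integrand X" and ab: "- pi \<le> a" "a \<le> b" "b \<le> pi"
  shows "(\<lambda>w. integral {a..b} (\<lambda>u. X u w ^ q)) \<in> borel_measurable M"
proof (rule borel_measurable_LIMSEQ_real)
  have step: "(a + real (Suc k) * h) - (a + real k * h) = h" for k and h :: real
    by (simp add: algebra_simps)
  let ?s = "\<lambda>l k. a + real k * ((b - a) / real (Suc l))"
  fix w assume w: "w \<in> space M"
  show "(\<lambda>l. \<Sum>k<Suc l. (?s l (Suc k) - ?s l k) * X (?s l k) w ^ q) \<longlonglongrightarrow> integral {a..b} (\<lambda>u. X u w ^ q)"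
  proof (rule riemann_sums_tendsto[where \<delta> = "\<lambda>l. 2 * pi / real (Suc l)", OF _ _ _ _ _ mesh_tendsto])
    show "continuous_on {a..b} (\<lambda>u. X u w ^ q)"
      using X w ab unfolding path_integrand_def by (auto intro!: continuous_intros intro: continuous_on_subset)
    show "?s l (Suc k) - ?s l k \<le> 2 * pi / real (Suc l)" for l k
    proof -
      have "?s l (Suc k) - ?s l k = (b - a) / real (Suc l)" 
        using step by blast
      also have "\<dots> \<le> 2 * pi / real (Suc l)" using ab by (intro divide_right_mono) auto
      finally show ?thesis .
    qed
    show "?s l k \<le> ?s l (Suc k)" for l k
      using ab by (intro add_left_mono mult_right_mono) auto
  qed simp_all
next
  fix l :: nat
  let ?s = "\<lambda>k. a + real k * ((b - a) / real (Suc l))"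
  have "?s k \<in> {-pi..pi}" if "k < Suc l" for k
  proof -
    have "real k * ((b - a) / real (Suc l)) \<le> real (Suc l) * ((b - a) / real (Suc l))"
      using that ab by (intro mult_right_mono) auto
    moreover have "0 \<le> real k * ((b - a) / real (Suc l))" using ab by simp
    moreover have "real (Suc l) * ((b - a) / real (Suc l)) = b - a" by (simp del: of_nat_Suc)
    ultimately show ?thesis using ab unfolding atLeastAtMost_iff by linarith
  qed
  then show "(\<lambda>w. \<Sum>k<Suc l. (?s (Suc k) - ?s k) * X (?s k) w ^ q) \<in> borel_measurable M"
    using path_integrand_measurable[OF X] by (intro borel_measurable_sum borel_measurable_times borel_measurable_power) auto
qed

text \<open>By continuity the bound need only be tested at countably many times. Clamping rational
  numbers to the interval extends each path continuously to the whole line, which also reaches the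
  irrational end points.\<close>

lemma bounded_event:
  assumes X: "path_integrand X"
  shows "{w\<in>space M. \<forall>t\<in>{-pi..pi}. \<bar>X t w\<bar> \<le> R} \<in> sets M"
proof -
  let ?c = "\<lambda>q::real. max (-pi) (min pi q)"
  have c: "?c q \<in> {-pi..pi}" for q by auto
  have "{w\<in>space M. \<forall>t\<in>{-pi..pi}. \<bar>X t w\<bar> \<le> R} = {w\<in>space M. \<forall>q::rat. \<bar>X (?c (of_rat q)) w\<bar> \<le> R}"
  proof (intro Collect_cong conj_cong refl iffI ballI allI)
    fix w t assume w: "w \<in> space M" and le: "\<forall>q::rat. \<bar>X (?c (of_rat q)) w\<bar> \<le> R" and t: "t \<in> {-pi..pi}"
    have "continuous_on {-pi..pi} (\<lambda>t. \<bar>X t w\<bar>)"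
      using X w by (auto simp: path_integrand_def intro!: continuous_intros)
    then have "continuous_on (closure \<rat>) (\<lambda>q. \<bar>X (?c q) w\<bar>)"
      by (rule continuous_on_compose2) (auto intro!: continuous_intros)
    then have "\<bar>X (?c t) w\<bar> \<le> R"
      by (rule continuous_le_on_closure) (use le in \<open>auto simp: Rats_closure_real elim!: Rats_cases\<close>)
    moreover have "?c t = t" using t by simp
    ultimately show "\<bar>X t w\<bar> \<le> R" by metis
  qed (use c in blast)
  also have "\<dots> \<in> sets M"
    using path_integrand_measurable[OF X c] by measurable
  finally show ?thesis .
qed

lemma riemann_ito_sum_eq:
  "riemann_ito_sum X W \<tau> l w = ito_sum X (\<lambda>k. - pi + real k * ((\<tau> + pi) / real (Suc l))) (Suc l) w"
  by (simp only: riemann_ito_sum_def ito_sum_def dW_def Let_def lessThan_Suc_atMost)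

lemma uniform_grid:
  assumes "\<tau> \<in> {-pi..pi}"
  shows "grid (\<lambda>k. - pi + real k * ((\<tau> + pi) / real (Suc l))) (Suc l)"
proof (rule gridI)
  show "- pi + real k * ((\<tau> + pi) / real (Suc l)) \<le> - pi + real (Suc k) * ((\<tau> + pi) / real (Suc l))" for k
    using assms by (intro add_left_mono mult_right_mono) auto
qed (use assms in \<open>auto simp del: of_nat_Suc\<close>)

lemma ito_sum_measurable:
  assumes "grid s n" "path_integrand X"
  shows "ito_sum X s n \<in> borel_measurable M"
proof -
  have s: "s k \<in> {-pi..pi}" if "k \<le> n" for k using grid_in[OF assms(1) that] .
  have "(\<lambda>w. X (s k) w * dW s k w) \<in> borel_measurable M" if "k < n" for k
    using W_M[OF s] path_integrand_measurable[OF assms(2) s] that unfolding dW_def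
    by (intro borel_measurable_times borel_measurable_diff) auto
  then show ?thesis
    unfolding ito_sum_def[abs_def] by (intro borel_measurable_sum) auto
qed

text \<open>The Ito integral up to \<open>t i\<close> is defined by uniform grids on [-pi, t i],
  which depend on \<open>i\<close> and need not contain the earlier partition points. This lemma
  moves to refinements of the partition, which serve all \<open>i\<close> at once; both grids have
  mesh at most 2 pi / (l + 1).\<close>

lemma fine_sum_riemann_vanishing:
  assumes t: "grid t m" "t 0 = - pi" and i: "i \<le> m" and X: "nice_integrand R X"
  shows "vanishing (\<lambda>l w. ito_sum X (fine_grid t (Suc l)) (i * Suc l) w - riemann_ito_sum X W (t i) l w)"
proof -
  let ?u = "\<lambda>l k. - pi + real k * ((t i + pi) / real (Suc l))"
  have ti: "t i \<in> {-pi..pi}" using grid_in[OF t(1) i] .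
  have g1: "grid (fine_grid t (Suc l)) (i * Suc l)" for l
    by (rule grid_subset[OF fine_grid_grid(1)[OF t(1) zero_less_Suc] mult_le_mono1[OF i]])
  have m1: "fine_grid t (Suc l) (Suc k) - fine_grid t (Suc l) k \<le> 2 * pi / real (Suc l)" if "k < i * Suc l" for l k
    by (rule fine_grid_grid(2)[OF t(1) zero_less_Suc less_le_trans[OF that mult_le_mono1[OF i]]])
  have m2: "?u l (Suc k) - ?u l k \<le> 2 * pi / real (Suc l)" for l k
  proof -
    have "(- pi + real (Suc k) * h) - (- pi + real k * h) = h" for h :: real
      by (simp add: algebra_simps)
    then have "?u l (Suc k) - ?u l k = (t i + pi) / real (Suc l)" by blast
    also have "\<dots> \<le> 2 * pi / real (Suc l)"
      using ti by (intro divide_right_mono) auto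
    finally show ?thesis .
  qed
  have ends: "fine_grid t (Suc l) 0 = ?u l 0" "fine_grid t (Suc l) (i * Suc l) = ?u l (Suc l)" for l
    using fine_grid_mult[of "Suc l" t 0] fine_grid_mult[of "Suc l" t i] t by (auto simp del: of_nat_Suc mult_Suc_right)
  note cmp = ito_sum_grid_compare[OF g1 uniform_grid[OF ti] zero_less_Suc ends X m1 m2]
  have C: "moment_const 1 * (2 * pi) > 0" using moment_const_pos[of 1] by simp
  \<comment> \<open>The grid comparison asks for some bound on the mean-square increments even where
    only integrability is wanted; this crude one serves for every \<open>l\<close>.\<close>
  have triv: "expectation (\<lambda>w. (X u w - X v w)\<^sup>2) \<le> 4 * R\<^sup>2" if "u \<in> {-pi..pi}" "v \<in> {-pi..pi}" for u v
  proof -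
    have m: "X u \<in> borel_measurable M" "X v \<in> borel_measurable M"
      using path_integrand_measurable[OF nice_path_integrand[OF X]] that by auto
    have le: "(X u w - X v w)\<^sup>2 \<le> 4 * R\<^sup>2" if "w \<in> space M" for w
    proof -
      have "\<bar>X u w\<bar> \<le> R" "\<bar>X v w\<bar> \<le> R"
        using X that \<open>u \<in> _\<close> \<open>v \<in> _\<close> by (auto simp: nice_integrand_def)
      then have "\<bar>X u w - X v w\<bar> \<le> \<bar>2 * R\<bar>" by auto
      then show ?thesis by (simp add: abs_le_square_iff power_mult_distrib)
    qed
    have "expectation (\<lambda>w. (X u w - X v w)\<^sup>2) \<le> expectation (\<lambda>w. 4 * R\<^sup>2)"
      using le m by (intro integral_mono integrable_const_bound[where B = "4 * R\<^sup>2"]) auto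
    then show ?thesis by (simp add: prob_space)
  qed
  show ?thesis
  proof (rule vanishing_of_L2)
    show "integrable M (\<lambda>w. (ito_sum X (fine_grid t (Suc l)) (i * Suc l) w - riemann_ito_sum X W (t i) l w)\<^sup>2)" for l
      unfolding riemann_ito_sum_eq by (rule cmp(1)[where e = "4 * R\<^sup>2"]) (use triv in auto)
    show "(\<lambda>w. ito_sum X (fine_grid t (Suc l)) (i * Suc l) w - riemann_ito_sum X W (t i) l w) \<in> borel_measurable M" for l
      unfolding riemann_ito_sum_eq 
      by (intro borel_measurable_diff ito_sum_measurable g1 uniform_grid ti nice_path_integrand[OF X])
    show "(\<lambda>l. expectation (\<lambda>w. (ito_sum X (fine_grid t (Suc l)) (i * Suc l) w - riemann_ito_sum X W (t i) l w)\<^sup>2)) \<longlonglongrightarrow> 0"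
    proof (rule LIMSEQ_I)
      fix e :: real assume e: "e > 0"
      define e' where "e' = e / (2 * (moment_const 1 * (2 * pi)))"
      have e': "e' > 0" using e C unfolding e'_def by (intro divide_pos_pos) auto
      obtain d where d: "d > 0" "\<And>u v. u \<in> {-pi..pi} \<Longrightarrow> v \<in> {-pi..pi} \<Longrightarrow> \<bar>u - v\<bar> \<le> d \<Longrightarrow> expectation (\<lambda>w. (X u w - X v w)\<^sup>2) \<le> e'"
        using nice_integrand_L2_modulus[OF X e'] by blast
      obtain l0 where l0: "\<And>l. l \<ge> l0 \<Longrightarrow> 2 * pi / real (Suc l) < d"
        using LIMSEQ_D[OF mesh_tendsto d(1)] by auto
      show "\<exists>no. \<forall>l\<ge>no. norm (expectation (\<lambda>w. (ito_sum X (fine_grid t (Suc l)) (i * Suc l) w - riemann_ito_sum X W (t i) l w)\<^sup>2) - 0) < e"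
      proof (intro exI allI impI)
        fix l assume l: "l \<ge> l0"
        have "expectation (\<lambda>w. (ito_sum X (fine_grid t (Suc l)) (i * Suc l) w - riemann_ito_sum X W (t i) l w)\<^sup>2) \<le> moment_const 1 * (2 * pi * e')"
          unfolding riemann_ito_sum_eq
        proof (rule cmp(2))
          fix u v assume "u \<in> {-pi..pi}" "v \<in> {-pi..pi}" "\<bar>u - v\<bar> \<le> 2 * pi / real (Suc l)"
          then show "expectation (\<lambda>w. (X u w - X v w)\<^sup>2) \<le> e'"
            using l0[OF l] by (intro d) auto
        qed (use e' in auto)
        also have "\<dots> = e / 2" using moment_const_pos[of 1] by (simp add: e'_def)
        finally show "norm (expectation (\<lambda>w. (ito_sum X (fine_grid t (Suc l)) (i * Suc l) w - riemann_ito_sum X W (t i) l w)\<^sup>2) - 0) < e"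
          using e by (simp add: integral_nonneg_AE)
      qed
    qed
  qed
qed

text \<open>The indicator restricts the claim to paths on which clipping changes nothing; off
  \<open>A\<close> the clipped sums have no reason to approach \<open>H\<close>.\<close>

lemma fine_sum_tendsto_ito:
  assumes t: "grid t m" "t 0 = - pi" and i: "i \<le> m" and X: "path_integrand X" and R: "0 \<le> R"
    and H: "is_ito_process M x X W H"
  defines "A \<equiv> {w\<in>space M. \<forall>t\<in>{-pi..pi}. \<bar>X t w\<bar> \<le> R}"
  shows "vanishing (\<lambda>l w. indicator A w * (ito_sum (clip R X) (fine_grid t (Suc l)) (i * Suc l) w - (H (t i) w - x)))"
proof -
  have ti: "t i \<in> {-pi..pi}" using grid_in[OF t(1) i] .
  have g1: "grid (fine_grid t (Suc l)) (i * Suc l)" for l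
    by (rule grid_subset[OF fine_grid_grid(1)[OF t(1) zero_less_Suc] mult_le_mono1[OF i]])
  have A [measurable]: "A \<in> sets M" unfolding A_def by (rule bounded_event[OF X])
  have Hm [measurable]: "H (t i) \<in> borel_measurable M" using H ti by (simp add: is_ito_process_def)
  have Rm: "riemann_ito_sum X W (t i) l \<in> borel_measurable M" for l
    unfolding riemann_ito_sum_eq[abs_def] by (rule ito_sum_measurable[OF uniform_grid[OF ti] X])
  have cn: "nice_integrand R (clip R X)" by (rule clip_nice[OF X R])
  have fm [measurable]: "ito_sum (clip R X) (fine_grid t (Suc l)) (i * Suc l) \<in> borel_measurable M" for l
    by (rule ito_sum_measurable[OF g1 nice_path_integrand[OF cn]])
  have v2: "vanishing (\<lambda>l w. (x + riemann_ito_sum X W (t i) l w) - H (t i) w)"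
    using H ti Rm by (intro vanishing_of_conv_in_prob) (auto simp: is_ito_process_def)
  show ?thesis
  proof (rule vanishing_bound[OF fine_sum_riemann_vanishing[OF t i cn] v2])
    show "(\<lambda>w. indicator A w * (ito_sum (clip R X) (fine_grid t (Suc l)) (i * Suc l) w - (H (t i) w - x))) \<in> borel_measurable M" for l
      by measurable
    fix l w assume w: "w \<in> space M"
    have "riemann_ito_sum (clip R X) W (t i) l w = riemann_ito_sum X W (t i) l w" if "w \<in> A"
      unfolding riemann_ito_sum_eq ito_sum_def
    proof (rule sum.cong)
      fix k assume "k \<in> {..<Suc l}"
      then have "- pi + real k * ((t i + pi) / real (Suc l)) \<in> {-pi..pi}"
        using grid_in[OF uniform_grid[OF ti, of l], of k] by simp
      with that show "clip R X (- pi + real k * ((t i + pi) / real (Suc l))) w * dW (\<lambda>k. - pi + real k * ((t i + pi) / real (Suc l))) k w =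
         X (- pi + real k * ((t i + pi) / real (Suc l))) w * dW (\<lambda>k. - pi + real k * ((t i + pi) / real (Suc l))) k w"
        by (subst clip_eq) (auto simp: A_def)
    qed simp
    then show "\<bar>indicator A w * (ito_sum (clip R X) (fine_grid t (Suc l)) (i * Suc l) w - (H (t i) w - x))\<bar>
      \<le> \<bar>ito_sum (clip R X) (fine_grid t (Suc l)) (i * Suc l) w - riemann_ito_sum (clip R X) W (t i) l w\<bar>
        + \<bar>x + riemann_ito_sum X W (t i) l w - H (t i) w\<bar>"
      by (cases "w \<in> A") auto
  qed
qed

text \<open>On a refinement the form in the approximate increments splits exactly as Z + P + D: an
  iterated sum, a quadratic variation error and a Riemann sum of the diagonal term. As P tends to 0
  and D to the subtracted integrals, Z tends to Q on \<open>A\<close> along a subsequence, and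
  Fatou's lemma transfers the moment bound of Z to Q.\<close>

lemma quadratic_form_moment_truncated:
  assumes t: "grid t m" "t 0 = - pi" "t m = pi" and X: "path_integrand X" and R: "0 \<le> R"
    and H: "is_ito_process M x X W H"
    and G: "G > 0" "\<And>k. k < m \<Longrightarrow> (\<Sum>j<m. (e k j + e j k)\<^sup>2 * (t (Suc j) - t j)) \<le> G"
    and B: "(\<integral>\<^sup>+ w. ennreal (integral {-pi..pi} (\<lambda>u. X u w ^ (4 * Suc i))) \<partial>M) \<le> ennreal B" "B \<ge> 0"
  defines "A \<equiv> {w\<in>space M. \<forall>t\<in>{-pi..pi}. \<bar>X t w\<bar> \<le> R}"
    and "y \<equiv> \<lambda>k w. H (t (Suc k)) w - H (t k) w"
  defines "Q \<equiv> \<lambda>w. (\<Sum>k<m. \<Sum>j<m. e k j * y k w * y j w) - (\<Sum>k<m. e k k * integral {t k..t (Suc k)} (\<lambda>u. (X u w)\<^sup>2))"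
  shows "(\<integral>\<^sup>+ w. ennreal (indicator A w * Q w ^ (2 * Suc i)) \<partial>M) \<le> ennreal (chaos_const i * G ^ Suc i * B)"
proof -
  define Y where "Y = clip R X"
  define s where "s l = fine_grid t (Suc l)" for l
  define c where "c l k = k div Suc l" for l k :: nat
  define h where "h l k = s l (Suc k) - s l k" for l k
  define \<xi> where "\<xi> l k w = Y (s l k) w * dW (s l) k w" for l k w
  define d where "d l k j = e (c l k) (c l j) + e (c l j) (c l k)" for l k j
  define Z where "Z l w = (\<Sum>k<m * Suc l. (\<Sum>j<k. d l k j * Y (s l j) w * dW (s l) j w) * Y (s l k) w * dW (s l) k w)" for l w
  define P where "P l w = (\<Sum>k<m * Suc l. e (c l k) (c l k) * (Y (s l k) w)\<^sup>2 * ((dW (s l) k w)\<^sup>2 - (s l (Suc k) - s l k)))" for l w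
  define D where "D l w = (\<Sum>i<m. e i i * (\<Sum>j<Suc l. h l (i * Suc l + j) * (Y (s l (i * Suc l + j)) w)\<^sup>2))" for l w
  define V where "V l i w = ito_sum Y (s l) (i * Suc l) w" for l i w
  have nice: "nice_integrand R Y" unfolding Y_def by (rule clip_nice[OF X R])
  have pY: "path_integrand Y" by (rule nice_path_integrand[OF nice])
  have gs: "grid (s l) (m * Suc l)" for l
    unfolding s_def by (rule fine_grid_grid(1)[OF t(1) zero_less_Suc])
  have h_le: "h l k \<le> 2 * pi / real (Suc l)" if "k < m * Suc l" for l k
    unfolding h_def s_def by (rule fine_grid_grid(2)[OF t(1) zero_less_Suc that])
  have h0: "0 \<le> h l k" if "k < m * Suc l" for l k
    using grid_step[OF gs that] by (simp add: h_def)
  have h_eq: "h l k = (t (Suc (c l k)) - t (c l k)) / real (Suc l)" for l k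
    unfolding h_def s_def c_def by (rule fine_grid_step) simp
  have cb: "c l (i * Suc l + j) = i" if "j < Suc l" for l i j
    using that by (simp add: c_def del: mult_Suc_right)
  have c_lt: "c l k < m" if "k < m * Suc l" for l k
    unfolding c_def using that by (rule less_mult_imp_div_less)
  have sin: "s l k \<in> {-pi..pi}" if "k \<le> m * Suc l" for l k
    using grid_in[OF gs that] .
  have ba: "bounded_adapted (s l) (m * Suc l) R (\<lambda>k. Y (s l k))" for l
    using nice sin unfolding bounded_adapted_def grid_adapted_def nice_integrand_def by auto
  \<comment> \<open>The kernel is constant on coarse cells, and the lengths of the
    \<open>Suc l\<close> pieces of a coarse cell add up to its length. The row sums, and with them
    the budget \<open>G\<close>, are thus unaffected by refinement.\<close>
  have row: "(\<Sum>j<m * Suc l. (d l k j)\<^sup>2 * (s l (Suc j) - s l j)) \<le> G" if k: "k < m * Suc l" for l k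
  proof -
    have "(\<Sum>j<m * Suc l. (d l k j)\<^sup>2 * (s l (Suc j) - s l j)) = (\<Sum>j<m * Suc l. (d l k j)\<^sup>2 * h l j)"
      by (simp add: h_def)
    also have "\<dots> = (\<Sum>i<m. \<Sum>j<Suc l. (d l k (i * Suc l + j))\<^sup>2 * h l (i * Suc l + j))"
      by (rule sum_lessThan_mult)
    also have "\<dots> = (\<Sum>i<m. \<Sum>j<Suc l. (e (c l k) i + e i (c l k))\<^sup>2 * ((t (Suc i) - t i) / real (Suc l)))"
      by (intro sum.cong refl) (simp only: d_def h_eq cb lessThan_iff)
    also have "\<dots> = (\<Sum>i<m. (e (c l k) i + e i (c l k))\<^sup>2 * (t (Suc i) - t i))"
      by (simp only: sum_constant card_lessThan) (simp del: of_nat_Suc)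
    also have "\<dots> \<le> G" by (rule G(2)[OF c_lt[OF k]])
    finally show ?thesis .
  qed
  have d_sym: "d l k j = d l j k" for l k j by (simp add: d_def)
  have col: "(\<Sum>k<m * Suc l. (d l k j)\<^sup>2 * (s l (Suc k) - s l k)) \<le> G" if "j < m * Suc l" for l j
    unfolding d_sym[of l _ j] by (rule row[OF that])
  note Zm = double_sum_moment[OF gs ba G(1) row col, folded Z_def]

  have V_eq: "V l i w = (\<Sum>i'<i. \<Sum>j<Suc l. \<xi> l (i' * Suc l + j) w)" for l i w
    unfolding V_def ito_sum_def \<xi>_def[symmetric] by (rule sum_lessThan_mult)
  have split: "Z l w = (\<Sum>k<m. \<Sum>j<m. e k j * (V l (Suc k) w - V l k w) * (V l (Suc j) w - V l j w)) - P l w - D l w" for l w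
  proof -
    have "(\<Sum>k<m. \<Sum>j<m. e k j * (V l (Suc k) w - V l k w) * (V l (Suc j) w - V l j w))
       = (\<Sum>k<m. \<Sum>j<m. e k j * (\<Sum>a<Suc l. \<xi> l (k * Suc l + a) w) * (\<Sum>b<Suc l. \<xi> l (j * Suc l + b) w))"
      unfolding V_eq by simp
    also have "\<dots> = (\<Sum>k<m. \<Sum>a<Suc l. \<Sum>j<m. \<Sum>b<Suc l. e k j * \<xi> l (k * Suc l + a) w * \<xi> l (j * Suc l + b) w)"
    proof (rule sum.cong[OF refl])
      fix k
      have "(\<Sum>j<m. e k j * (\<Sum>a<Suc l. \<xi> l (k * Suc l + a) w) * (\<Sum>b<Suc l. \<xi> l (j * Suc l + b) w))
        = (\<Sum>j<m. \<Sum>a<Suc l. \<Sum>b<Suc l. e k j * \<xi> l (k * Suc l + a) w * \<xi> l (j * Suc l + b) w)"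
        by (simp only: mult.assoc sum_product) (simp only: sum_distrib_left)
      also have "\<dots> = (\<Sum>a<Suc l. \<Sum>j<m. \<Sum>b<Suc l. e k j * \<xi> l (k * Suc l + a) w * \<xi> l (j * Suc l + b) w)"
        by (rule sum.swap)
      finally show "(\<Sum>j<m. e k j * (\<Sum>a<Suc l. \<xi> l (k * Suc l + a) w) * (\<Sum>b<Suc l. \<xi> l (j * Suc l + b) w))
        = (\<Sum>a<Suc l. \<Sum>j<m. \<Sum>b<Suc l. e k j * \<xi> l (k * Suc l + a) w * \<xi> l (j * Suc l + b) w)" .
    qed
    also have "\<dots> = (\<Sum>k<m. \<Sum>a<Suc l. \<Sum>j<m. \<Sum>b<Suc l.
        e (c l (k * Suc l + a)) (c l (j * Suc l + b)) * \<xi> l (k * Suc l + a) w * \<xi> l (j * Suc l + b) w)"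
      by (intro sum.cong refl) (simp only: cb lessThan_iff)
    also have "\<dots> = (\<Sum>k<m * Suc l. \<Sum>j<m * Suc l. e (c l k) (c l j) * \<xi> l k w * \<xi> l j w)"
      by (simp only: sum_lessThan_mult)
    also have "\<dots> = (\<Sum>k<m * Suc l. (\<Sum>j<k. d l k j * \<xi> l j w) * \<xi> l k w) + (\<Sum>k<m * Suc l. e (c l k) (c l k) * (\<xi> l k w)\<^sup>2)"
      unfolding d_def by (rule quadratic_form_split)
    also have "(\<Sum>k<m * Suc l. (\<Sum>j<k. d l k j * \<xi> l j w) * \<xi> l k w) = Z l w"
      by (simp only: Z_def \<xi>_def mult.assoc)
    also have "(\<Sum>k<m * Suc l. e (c l k) (c l k) * (\<xi> l k w)\<^sup>2) = P l w + (\<Sum>k<m * Suc l. e (c l k) (c l k) * (h l k * (Y (s l k) w)\<^sup>2))"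
      unfolding P_def h_def sum.distrib[symmetric] by (intro sum.cong refl) (simp add: \<xi>_def power_mult_distrib algebra_simps)
    also have "(\<Sum>k<m * Suc l. e (c l k) (c l k) * (h l k * (Y (s l k) w)\<^sup>2)) 
       = (\<Sum>k<m. \<Sum>j<Suc l. e (c l (k * Suc l + j)) (c l (k * Suc l + j)) * (h l (k * Suc l + j) * (Y (s l (k * Suc l + j)) w)\<^sup>2))"
      by (rule sum_lessThan_mult)
    also have "\<dots> = D l w"
      unfolding D_def sum_distrib_left by (intro sum.cong refl) (simp only: cb lessThan_iff)
    finally show ?thesis by simp
  qed

  \<comment> \<open>A crude bound for the diagonal coefficients. It depends on the partition and is
    harmless, because \<open>P\<close> is sent to 0 with the partition and \<open>R\<close>
    fixed.\<close>
  define E0 where "E0 = (\<Sum>i<m. \<bar>e i i\<bar>)"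
  have baP: "bounded_adapted (s l) (m * Suc l) (E0 * R\<^sup>2) (\<lambda>k w. e (c l k) (c l k) * (Y (s l k) w)\<^sup>2)" for l
    unfolding bounded_adapted_def
  proof (intro conjI allI impI ballI)
    show "grid_adapted (s l) (m * Suc l) (\<lambda>k w. e (c l k) (c l k) * (Y (s l k) w)\<^sup>2)"
      using ba[of l] unfolding bounded_adapted_def grid_adapted_def by (auto intro!: borel_measurable_times borel_measurable_power)
    fix k w assume k: "k < m * Suc l" and w: "w \<in> space M"
    have "\<bar>e (c l k) (c l k)\<bar> \<le> E0"
      unfolding E0_def using c_lt[OF k] by (intro member_le_sum[of "c l k" _ "\<lambda>i. \<bar>e i i\<bar>"]) auto
    moreover have "\<bar>Y (s l k) w\<bar> \<le> R"
      using ba[of l] k w by (auto simp: bounded_adapted_def)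
    then have "(Y (s l k) w)\<^sup>2 \<le> R\<^sup>2"
      by (rule abs_le_square_iff[THEN iffD1, OF order_trans[OF _ abs_ge_self]])
    ultimately show "\<bar>e (c l k) (c l k) * (Y (s l k) w)\<^sup>2\<bar> \<le> E0 * R\<^sup>2"
      by (auto simp: abs_mult intro!: mult_mono)
  qed
  note Pm = quadratic_variation_error[OF gs baP, folded P_def]
  have Wm: "W (s l k) \<in> borel_measurable M" if "k \<le> m * Suc l" for l k
    by (rule W_M[OF sin[OF that]])
  have Ym: "Y (s l k) \<in> borel_measurable M" if "k \<le> m * Suc l" for l k
    by (rule path_integrand_measurable[OF pY sin[OF that]])
  have dWm: "dW (s l) k \<in> borel_measurable M" if "k < m * Suc l" for l k
    unfolding dW_def[abs_def] using that by (intro borel_measurable_diff Wm) auto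
  have P_meas: "P l \<in> borel_measurable M" for l
    unfolding P_def[abs_def] using dWm Ym 
    by (intro borel_measurable_sum borel_measurable_times borel_measurable_diff borel_measurable_power borel_measurable_const) auto
  have Z_meas: "Z l \<in> borel_measurable M" for l
    unfolding Z_def[abs_def] using dWm Ym 
    by (intro borel_measurable_sum borel_measurable_times borel_measurable_const) auto
  have P_van: "vanishing P"
  proof (rule vanishing_of_L2[OF Pm(1) P_meas])
    have le: "expectation (\<lambda>w. (P l w)\<^sup>2) \<le> 2 * (E0 * R\<^sup>2)\<^sup>2 * (2 * pi) * (2 * pi / real (Suc l))" for l
    proof -
      have "(\<Sum>k<m * Suc l. (s l (Suc k) - s l k)\<^sup>2) \<le> (\<Sum>k<m * Suc l. (s l (Suc k) - s l k) * (2 * pi / real (Suc l)))"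
        unfolding power2_eq_square using h_le h0 unfolding h_def by (intro sum_mono mult_left_mono) auto
      also have "\<dots> \<le> 2 * pi * (2 * pi / real (Suc l))"
        unfolding sum_distrib_right[symmetric] by (intro mult_right_mono grid_length[OF gs]) auto
      finally have "2 * (E0 * R\<^sup>2)\<^sup>2 * (\<Sum>k<m * Suc l. (s l (Suc k) - s l k)\<^sup>2) \<le> 2 * (E0 * R\<^sup>2)\<^sup>2 * (2 * pi * (2 * pi / real (Suc l)))"
        by (intro mult_left_mono) auto
      with Pm(2)[of l] show ?thesis by (simp only: mult.assoc)
    qed
    show "(\<lambda>l. expectation (\<lambda>w. (P l w)\<^sup>2)) \<longlonglongrightarrow> 0"
    proof (rule tendsto_sandwich[OF _ _ tendsto_const])
      show "(\<lambda>l. 2 * (E0 * R\<^sup>2)\<^sup>2 * (2 * pi) * (2 * pi / real (Suc l))) \<longlonglongrightarrow> 0"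
        by (rule tendsto_mult_right_zero[OF mesh_tendsto])
    qed (use le in \<open>auto intro!: always_eventually Bochner_Integration.integral_nonneg\<close>)
  qed
  \<comment> \<open>The errors at all partition points are added up, so that one subsequence serves
    every point simultaneously.\<close>
  define U where "U l w = (\<Sum>k\<in>{..m}. \<bar>indicator A w * (V l k w - (H (t k) w - x))\<bar>)" for l w
  have U_van: "vanishing U"
    unfolding U_def[abs_def]
  proof (rule vanishing_sum)
    fix k assume "k \<in> {..m}"
    then show "vanishing (\<lambda>l w. indicator A w * (V l k w - (H (t k) w - x)))"
      unfolding V_def s_def Y_def A_def by (intro fine_sum_tendsto_ito[OF t(1,2) _ X R H]) auto
  qed simp
  have UP: "vanishing (\<lambda>l w. U l w + \<bar>P l w\<bar>)"
    by (rule vanishing_bound[OF U_van P_van]) 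
       (use U_van P_van in \<open>auto simp: vanishing_def intro!: borel_measurable_add borel_measurable_abs\<close>)
  obtain r where r: "strict_mono r" "AE w in M. (\<lambda>l. U (r l) w + \<bar>P (r l) w\<bar>) \<longlonglongrightarrow> 0"
    using vanishing_AE_subseq[OF UP] by blast

  have YX: "Y u w = X u w" if "w \<in> A" "u \<in> {-pi..pi}" for u w
    unfolding Y_def using that by (intro clip_eq) (auto simp: A_def)
  have contY: "continuous_on {-pi..pi} (\<lambda>u. Y u w)" if "w \<in> space M" for w
    using nice that by (simp add: nice_integrand_def)
  have D_lim: "(\<lambda>l. D l w) \<longlonglongrightarrow> (\<Sum>k<m. e k k * integral {t k..t (Suc k)} (\<lambda>u. (Y u w)\<^sup>2))" if w: "w \<in> space M" for w
    unfolding D_def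
  proof (intro tendsto_sum tendsto_mult tendsto_const)
    fix i assume "i \<in> {..<m}"
    then have i: "i < m" by simp
    have blk: "i * Suc l + k < m * Suc l" if "k < Suc l" for l k
    proof -
      have "i * Suc l + k < Suc i * Suc l" using that by simp
      also have "\<dots> \<le> m * Suc l" using i by (intro mult_le_mono1) simp
      finally show ?thesis .
    qed
    have "(\<lambda>l. \<Sum>k<Suc l. (s l (i * Suc l + Suc k) - s l (i * Suc l + k)) * (Y (s l (i * Suc l + k)) w)\<^sup>2)
       \<longlonglongrightarrow> integral {t i..t (Suc i)} (\<lambda>u. (Y u w)\<^sup>2)"
    proof (rule riemann_sums_tendsto[where s = "\<lambda>l k. s l (i * Suc l + k)" and n = Suc, OF _ _ _ _ _ mesh_tendsto])
      show "continuous_on {t i..t (Suc i)} (\<lambda>u. (Y u w)\<^sup>2)"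
        using grid_in[OF t(1), of i] grid_in[OF t(1), of "Suc i"] i
        by (intro continuous_intros continuous_on_subset[OF contY[OF w]]) auto
      show "s l (i * Suc l + 0) = t i" for l
        unfolding s_def by (simp add: fine_grid_mult del: mult_Suc_right)
      show "s l (i * Suc l + Suc l) = t (Suc i)" for l
        using fine_grid_mult[of "Suc l" t "Suc i"] unfolding s_def mult_Suc add.commute[of "Suc l"] by simp
      show "s l (i * Suc l + k) \<le> s l (i * Suc l + Suc k)" if "k < Suc l" for l k
        using h0[OF blk[OF that]] by (simp add: h_def)
      show "s l (i * Suc l + Suc k) - s l (i * Suc l + k) \<le> 2 * pi / real (Suc l)" if "k < Suc l" for l k
        using h_le[OF blk[OF that]] by (simp add: h_def)
    qed
    then show "(\<lambda>l. \<Sum>j<Suc l. h l (i * Suc l + j) * (Y (s l (i * Suc l + j)) w)\<^sup>2) \<longlonglongrightarrow> integral {t i..t (Suc i)} (\<lambda>u. (Y u w)\<^sup>2)"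
      by (simp only: h_def add_Suc_right)
  qed
  have lim: "AE w in M. (\<lambda>l. indicator A w * Z (r l) w ^ (2 * Suc i)) \<longlonglongrightarrow> indicator A w * Q w ^ (2 * Suc i)"
    using r(2) AE_space
  proof eventually_elim
    fix w assume lim0: "(\<lambda>l. U (r l) w + \<bar>P (r l) w\<bar>) \<longlonglongrightarrow> 0" and w: "w \<in> space M"
    show "(\<lambda>l. indicator A w * Z (r l) w ^ (2 * Suc i)) \<longlonglongrightarrow> indicator A w * Q w ^ (2 * Suc i)"
    proof (cases "w \<in> A")
      case True
      have U0: "0 \<le> U l w" for l unfolding U_def by (intro sum_nonneg) auto
      have P0: "(\<lambda>l. P (r l) w) \<longlonglongrightarrow> 0"
        by (rule Lim_null_comparison[OF _ lim0]) (use U0 in \<open>auto intro!: always_eventually\<close>)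
      have V0: "(\<lambda>l. V (r l) k w) \<longlonglongrightarrow> H (t k) w - x" if k: "k \<le> m" for k
      proof -
        have "\<bar>V l k w - (H (t k) w - x)\<bar> \<le> U l w" for l
          unfolding U_def using True k 
          member_le_sum[of k "{..m}" "\<lambda>k. \<bar>indicator A w * (V l k w - (H (t k) w - x))\<bar>"] by auto
        then have "(\<lambda>l. V (r l) k w - (H (t k) w - x)) \<longlonglongrightarrow> 0"
          by (intro Lim_null_comparison[OF _ lim0]) (auto intro!: always_eventually intro: order_trans add_increasing2)
        then show ?thesis by (rule LIM_zero_cancel)
      qed
      have y0: "(\<lambda>l. V (r l) (Suc k) w - V (r l) k w) \<longlonglongrightarrow> y k w" if "k < m" for k
        using tendsto_diff[OF V0[of "Suc k"] V0[of k]] that by (simp add: y_def)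
      have D0: "(\<lambda>l. D (r l) w) \<longlonglongrightarrow> (\<Sum>k<m. e k k * integral {t k..t (Suc k)} (\<lambda>u. (Y u w)\<^sup>2))"
        using LIMSEQ_subseq_LIMSEQ[OF D_lim[OF w] r(1)] by (simp add: o_def)
      have YX2: "integral {t k..t (Suc k)} (\<lambda>u. (Y u w)\<^sup>2) = integral {t k..t (Suc k)} (\<lambda>u. (X u w)\<^sup>2)" if "k < m" for k
        using grid_in[OF t(1), of k] grid_in[OF t(1), of "Suc k"] that
        by (intro integral_cong) (auto simp: YX[OF True])
      have Q: "Q w = (\<Sum>k<m. \<Sum>j<m. e k j * y k w * y j w) - 0 - (\<Sum>k<m. e k k * integral {t k..t (Suc k)} (\<lambda>u. (Y u w)\<^sup>2))"
        by (simp add: Q_def YX2)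
      have "(\<lambda>l. Z (r l) w) \<longlonglongrightarrow> Q w"
        unfolding split Q by (intro tendsto_diff P0 D0 tendsto_sum tendsto_mult tendsto_const y0) auto
      then show ?thesis by (intro tendsto_intros)
    qed simp
  qed

  \<comment> \<open>The bound for the moments of \<open>Z\<close> contains a Riemann sum over the
    fine grid. By dominated convergence, available since \<open>Y\<close> is bounded by
    \<open>R\<close>, it tends to \<open>c0\<close>; clipping lowers absolute values, so
    \<open>c0 \<le> B\<close> whatever \<open>R\<close> is.\<close>
  define c0 where "c0 = expectation (\<lambda>w. integral {-pi..pi} (\<lambda>u. Y u w ^ (4 * Suc i)))"
  have Yp: "\<bar>Y u w ^ (4 * Suc i)\<bar> \<le> R ^ (4 * Suc i)" if "w \<in> space M" "u \<in> {-pi..pi}" for u w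
    using nice that unfolding power_abs by (intro power_mono) (auto simp: nice_integrand_def)
  have iYp: "(\<lambda>u. Y u w ^ (4 * Suc i)) integrable_on {-pi..pi}" if "w \<in> space M" for w
    using contY[OF that] by (intro integrable_continuous_interval continuous_intros)
  have E_lim: "(\<lambda>l. \<Sum>k<m * Suc l. (s l (Suc k) - s l k) * expectation (\<lambda>w. Y (s l k) w ^ (4 * Suc i))) \<longlonglongrightarrow> c0"
  proof -
    have "(\<lambda>l. expectation (\<lambda>w. \<Sum>k<m * Suc l. (s l (Suc k) - s l k) * Y (s l k) w ^ (4 * Suc i))) \<longlonglongrightarrow> c0"
      unfolding c0_def
    proof (rule integral_dominated_convergence[where w = "\<lambda>_. 2 * pi * R ^ (4 * Suc i)"])
      show "(\<lambda>w. integral {-pi..pi} (\<lambda>u. Y u w ^ (4 * Suc i))) \<in> borel_measurable M"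
        by (rule path_integral_measurable[OF pY]) auto
      show "(\<lambda>w. \<Sum>k<m * Suc l. (s l (Suc k) - s l k) * Y (s l k) w ^ (4 * Suc i)) \<in> borel_measurable M" for l
        using Ym by (intro borel_measurable_sum borel_measurable_times borel_measurable_power borel_measurable_const) auto
      show "AE w in M. (\<lambda>l. \<Sum>k<m * Suc l. (s l (Suc k) - s l k) * Y (s l k) w ^ (4 * Suc i)) \<longlonglongrightarrow> integral {-pi..pi} (\<lambda>u. Y u w ^ (4 * Suc i))"
      proof (rule AE_I2)
        fix w assume w: "w \<in> space M"
        show "(\<lambda>l. \<Sum>k<m * Suc l. (s l (Suc k) - s l k) * Y (s l k) w ^ (4 * Suc i)) \<longlonglongrightarrow> integral {-pi..pi} (\<lambda>u. Y u w ^ (4 * Suc i))"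
        proof (rule riemann_sums_tendsto[where n = "\<lambda>l. m * Suc l", OF _ _ _ _ _ mesh_tendsto])
          show "s l 0 = - pi" "s l (m * Suc l) = pi" for l
            using fine_grid_mult[of "Suc l" t 0] fine_grid_mult[of "Suc l" t m] t unfolding s_def by simp_all
        qed (use contY[OF w] h0 h_le in \<open>auto simp: h_def intro!: continuous_intros\<close>)
      qed
      show "AE w in M. norm (\<Sum>k<m * Suc l. (s l (Suc k) - s l k) * Y (s l k) w ^ (4 * Suc i)) \<le> 2 * pi * R ^ (4 * Suc i)" for l
      proof (rule AE_I2)
        fix w assume w: "w \<in> space M"
        have "norm (\<Sum>k<m * Suc l. (s l (Suc k) - s l k) * Y (s l k) w ^ (4 * Suc i)) \<le> (\<Sum>k<m * Suc l. (s l (Suc k) - s l k) * R ^ (4 * Suc i))"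
        proof (rule order_trans[OF norm_sum sum_mono])
          fix k assume "k \<in> {..<m * Suc l}"
          then have "0 \<le> s l (Suc k) - s l k" "\<bar>Y (s l k) w ^ (4 * Suc i)\<bar> \<le> R ^ (4 * Suc i)"
            using h0[of k l] Yp[OF w sin[of k l]] by (auto simp: h_def)
          then show "norm ((s l (Suc k) - s l k) * Y (s l k) w ^ (4 * Suc i)) \<le> (s l (Suc k) - s l k) * R ^ (4 * Suc i)"
            unfolding real_norm_def abs_mult by (intro mult_mono) auto
        qed
        also have "\<dots> \<le> 2 * pi * R ^ (4 * Suc i)"
          unfolding sum_distrib_right[symmetric] using R by (intro mult_right_mono grid_length[OF gs]) auto
        finally show "norm (\<Sum>k<m * Suc l. (s l (Suc k) - s l k) * Y (s l k) w ^ (4 * Suc i)) \<le> 2 * pi * R ^ (4 * Suc i)" .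
      qed
    qed simp
    moreover have "expectation (\<lambda>w. \<Sum>k<m * Suc l. (s l (Suc k) - s l k) * Y (s l k) w ^ (4 * Suc i))
       = (\<Sum>k<m * Suc l. (s l (Suc k) - s l k) * expectation (\<lambda>w. Y (s l k) w ^ (4 * Suc i)))" for l
      using bounded_adapted_integrable[OF gs ba, of _ l "4 * Suc i"]
      by (subst Bochner_Integration.integral_sum) auto
    ultimately show ?thesis by simp
  qed
  have "c0 \<le> B"
  proof -
    have int: "integrable M (\<lambda>w. integral {-pi..pi} (\<lambda>u. Y u w ^ (4 * Suc i)))"
    proof (rule integrable_const_bound[where B = "R ^ (4 * Suc i) * (2 * pi)"])
      show "AE w in M. norm (integral {-pi..pi} (\<lambda>u. Y u w ^ (4 * Suc i))) \<le> R ^ (4 * Suc i) * (2 * pi)"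
      proof (rule AE_I2)
        fix w assume w: "w \<in> space M"
        show "norm (integral {-pi..pi} (\<lambda>u. Y u w ^ (4 * Suc i))) \<le> R ^ (4 * Suc i) * (2 * pi)"
          using integral_bound[of "-pi" pi "\<lambda>u. Y u w ^ (4 * Suc i)" "R ^ (4 * Suc i)"] Yp[OF w]
            continuous_on_power[OF contY[OF w], of "4 * Suc i"]
          by (auto intro!: continuous_intros simp del: power_Suc mult_Suc_right)
      qed
    qed (auto intro!: path_integral_measurable[OF pY])
    have nn: "0 \<le> integral {-pi..pi} (\<lambda>u. Y u w ^ (4 * Suc i))" if "w \<in> space M" for w
      by (rule Henstock_Kurzweil_Integration.integral_nonneg[OF iYp[OF that]]) 
         (auto simp: zero_le_even_power simp del: power_Suc mult_Suc_right)
    have "ennreal c0 = (\<integral>\<^sup>+ w. ennreal (integral {-pi..pi} (\<lambda>u. Y u w ^ (4 * Suc i))) \<partial>M)"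
      unfolding c0_def using int nn by (subst nn_integral_eq_integral) (auto intro!: AE_I2 simp del: power_Suc mult_Suc_right)
    also have "\<dots> \<le> (\<integral>\<^sup>+ w. ennreal (integral {-pi..pi} (\<lambda>u. X u w ^ (4 * Suc i))) \<partial>M)"
    proof (intro nn_integral_mono ennreal_leI)
      fix w assume w: "w \<in> space M"
      show "integral {-pi..pi} (\<lambda>u. Y u w ^ (4 * Suc i)) \<le> integral {-pi..pi} (\<lambda>u. X u w ^ (4 * Suc i))"
      proof (rule integral_le[OF iYp[OF w]])
        show "(\<lambda>u. X u w ^ (4 * Suc i)) integrable_on {-pi..pi}"
          using X w by (intro integrable_continuous_interval continuous_intros) (auto simp: path_integrand_def)
        fix u
        have "\<bar>Y u w\<bar> ^ (4 * Suc i) \<le> \<bar>X u w\<bar> ^ (4 * Suc i)"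
          unfolding Y_def by (intro power_mono abs_clip_le R) auto
        then show "Y u w ^ (4 * Suc i) \<le> X u w ^ (4 * Suc i)"
          by (simp add: power_even_abs del: power_Suc mult_Suc_right)
      qed
    qed
    also have "\<dots> \<le> ennreal B" by (rule B)
    finally show ?thesis using B(2) by (simp add: ennreal_le_iff)
  qed
  have A_sets: "A \<in> sets M" unfolding A_def by (rule bounded_event[OF X])
  define K where "K = chaos_const i * G ^ Suc i"
  have K0: "K \<ge> 0" using chaos_const_pos[of i] G by (simp add: K_def)
  have "(\<integral>\<^sup>+ w. ennreal (indicator A w * Q w ^ (2 * Suc i)) \<partial>M) \<le> ennreal (K * c0)"
  proof (rule nn_integral_le_of_tendsto[OF _ lim])
    show "(\<lambda>w. indicator A w * Z (r l) w ^ (2 * Suc i)) \<in> borel_measurable M" for l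
      using A_sets Z_meas[of "r l"] by measurable
    show "(\<lambda>l. K * (\<Sum>k<m * Suc (r l). (s (r l) (Suc k) - s (r l) k) * expectation (\<lambda>w. Y (s (r l) k) w ^ (4 * Suc i)))) \<longlonglongrightarrow> K * c0"
      using LIMSEQ_subseq_LIMSEQ[OF E_lim r(1)] by (intro tendsto_mult tendsto_const) (simp add: o_def)
    fix l
    have even: "0 \<le> z ^ (2 * Suc i)" for z :: real by (simp add: zero_le_even_power del: power_Suc mult_Suc_right)
    have "(\<integral>\<^sup>+ w. ennreal (indicator A w * Z (r l) w ^ (2 * Suc i)) \<partial>M) \<le> (\<integral>\<^sup>+ w. ennreal (Z (r l) w ^ (2 * Suc i)) \<partial>M)"
      using even by (intro nn_integral_mono ennreal_leI) (auto simp: indicator_def)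
    also have "\<dots> = ennreal (expectation (\<lambda>w. Z (r l) w ^ (2 * Suc i)))"
      using Zm(1)[of "r l"] even by (intro nn_integral_eq_integral) (auto simp: Z_def)
    also have "\<dots> \<le> ennreal (K * (\<Sum>k<m * Suc (r l). (s (r l) (Suc k) - s (r l) k) * expectation (\<lambda>w. Y (s (r l) k) w ^ (4 * Suc i))))"
      using Zm(2)[of "r l"] unfolding K_def Z_def by (intro ennreal_leI) auto
    finally show "(\<integral>\<^sup>+ w. ennreal (indicator A w * Z (r l) w ^ (2 * Suc i)) \<partial>M)
      \<le> ennreal (K * (\<Sum>k<m * Suc (r l). (s (r l) (Suc k) - s (r l) k) * expectation (\<lambda>w. Y (s (r l) k) w ^ (4 * Suc i))))" .
  qed
  also have "\<dots> \<le> ennreal (K * B)"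
    using \<open>c0 \<le> B\<close> K0 by (intro ennreal_leI mult_left_mono) auto
  finally show ?thesis by (simp only: K_def)
qed

text \<open>A continuous path is bounded on the compact time interval, so each path lies in the
  truncation events from some level on. Since the truncated bound is free of the level, Fatou's
  lemma removes the indicator.\<close>

lemma quadratic_form_moment:
  assumes t: "grid t m" "t 0 = - pi" "t m = pi" and X: "path_integrand X"
    and H: "is_ito_process M x X W H"
    and G: "G > 0" "\<And>k. k < m \<Longrightarrow> (\<Sum>j<m. (e k j + e j k)\<^sup>2 * (t (Suc j) - t j)) \<le> G"
    and B: "(\<integral>\<^sup>+ w. ennreal (integral {-pi..pi} (\<lambda>u. X u w ^ (4 * Suc i))) \<partial>M) \<le> ennreal B" "B \<ge> 0"
  defines "y \<equiv> \<lambda>k w. H (t (Suc k)) w - H (t k) w"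
  defines "Q \<equiv> \<lambda>w. (\<Sum>k<m. \<Sum>j<m. e k j * y k w * y j w) - (\<Sum>k<m. e k k * integral {t k..t (Suc k)} (\<lambda>u. (X u w)\<^sup>2))"
  shows "Q \<in> borel_measurable M"
    and "(\<integral>\<^sup>+ w. ennreal (Q w ^ (2 * Suc i)) \<partial>M) \<le> ennreal (chaos_const i * G ^ Suc i * B)"
proof -
  let ?A = "\<lambda>n::nat. {w\<in>space M. \<forall>t\<in>{-pi..pi}. \<bar>X t w\<bar> \<le> real n}"
  have Hm: "H (t k) \<in> borel_measurable M" if "k \<le> m" for k
    using H grid_in[OF t(1) that] by (simp add: is_ito_process_def)
  have ym: "y k \<in> borel_measurable M" if "k < m" for k
    unfolding y_def using that Hm[of k] Hm[of "Suc k"] by (intro borel_measurable_diff) auto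
  have im: "(\<lambda>w. integral {t k..t (Suc k)} (\<lambda>u. (X u w)\<^sup>2)) \<in> borel_measurable M" if "k < m" for k
    using grid_in[OF t(1), of k] grid_in[OF t(1), of "Suc k"] grid_step[OF t(1) that] that
    by (intro path_integral_measurable[OF X]) auto
  show Qm: "Q \<in> borel_measurable M"
    unfolding Q_def using ym im 
    by (intro borel_measurable_diff borel_measurable_sum borel_measurable_times borel_measurable_const) auto
  show "(\<integral>\<^sup>+ w. ennreal (Q w ^ (2 * Suc i)) \<partial>M) \<le> ennreal (chaos_const i * G ^ Suc i * B)"
  proof (rule nn_integral_le_of_tendsto[OF _ _ _ tendsto_const])
    show "(\<lambda>w. indicator (?A n) w * Q w ^ (2 * Suc i)) \<in> borel_measurable M" for n
      using bounded_event[OF X, of "real n"] Qm by measurable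
    show "(\<integral>\<^sup>+ w. ennreal (indicator (?A n) w * Q w ^ (2 * Suc i)) \<partial>M) \<le> ennreal (chaos_const i * G ^ Suc i * B)" for n
      unfolding Q_def y_def by (rule quadratic_form_moment_truncated[OF t X _ H G B]) auto
    show "AE w in M. (\<lambda>n. indicator (?A n) w * Q w ^ (2 * Suc i)) \<longlonglongrightarrow> Q w ^ (2 * Suc i)"
    proof (rule AE_I2)
      fix w assume w: "w \<in> space M"
      then have "compact ((\<lambda>t. X t w) ` {-pi..pi})"
        using X by (intro compact_continuous_image) (auto simp: path_integrand_def)
      then have "bounded ((\<lambda>t. X t w) ` {-pi..pi})"
        by (rule compact_imp_bounded)
      then obtain b where b: "\<forall>t\<in>{-pi..pi}. \<bar>X t w\<bar> \<le> b"
        unfolding bounded_iff by auto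
      obtain n0 where n0: "b \<le> real n0" using real_arch_simple by blast
      have A: "w \<in> ?A n" if "n \<ge> n0" for n
      proof (intro CollectI conjI w ballI)
        fix t assume "t \<in> {-pi..pi}"
        then have "\<bar>X t w\<bar> \<le> b" using b by blast
        then show "\<bar>X t w\<bar> \<le> real n" using n0 that by linarith
      qed
      have "indicator (?A n) w * Q w ^ (2 * Suc i) = Q w ^ (2 * Suc i)" if "n \<ge> n0" for n
        unfolding indicator_simps(1)[OF A[OF that]] by (rule mult_1)
      then have "eventually (\<lambda>n. indicator (?A n) w * Q w ^ (2 * Suc i) = Q w ^ (2 * Suc i)) sequentially"
        unfolding eventually_sequentially by blast
      then show "(\<lambda>n. indicator (?A n) w * Q w ^ (2 * Suc i)) \<longlonglongrightarrow> Q w ^ (2 * Suc i)"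
        by (rule tendsto_eventually)
    qed
  qed
qed

end

section \<open>The Dirichlet kernel\<close>

text \<open>The normalisation makes the value at 0 equal to 1, so the diagonal of the quadratic form
  carries only the phases.\<close>

definition dirichlet :: "nat \<Rightarrow> real \<Rightarrow> real" where
  "dirichlet N u = (\<Sum>l\<in>{- int N..int N}. cos (of_int l * u)) / (2 * real N + 1)"

definition dirichlet' :: "nat \<Rightarrow> real \<Rightarrow> real" where
  "dirichlet' N u = - (\<Sum>l\<in>{- int N..int N}. of_int l * sin (of_int l * u)) / (2 * real N + 1)"

lemma dirichlet_minus: "dirichlet N (- u) = dirichlet N u"
  by (simp add: dirichlet_def)

lemma dirichlet_zero: "dirichlet N 0 = 1"
  by (simp add: dirichlet_def)

lemma has_derivative_dirichlet: "(dirichlet N has_real_derivative dirichlet' N u) (at u)"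
  unfolding dirichlet_def[abs_def] dirichlet'_def
  by (auto intro!: derivative_eq_intros sum.cong simp: sum_negf mult.commute)

text \<open>Averaging f(a) \<le> f(v) + (integral of |f'|) over v in the cell gives the estimate. A
  majorant \<open>g\<close> stands for |f'| so that an explicitly integrable function can be
  used.\<close>

lemma left_sum_le_integral:
  fixes f f' g :: "real \<Rightarrow> real"
  assumes f: "\<And>u. (f has_real_derivative f' u) (at u)" and g: "continuous_on {a..b} g" and le: "\<And>u. \<bar>f' u\<bar> \<le> g u"
    and ab: "a \<le> b" "b - a \<le> \<rho>"
  shows "(b - a) * f a \<le> integral {a..b} f + \<rho> * integral {a..b} g"
proof -
  have g0: "0 \<le> g u" for u using le[of u] by linarith
  have gi: "g integrable_on {c..d}" if "a \<le> c" "d \<le> b" for c d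
    using that by (intro integrable_continuous_interval continuous_on_subset[OF g]) auto
  have fc: "continuous_on {a..b} f"
    using f by (intro DERIV_continuous_on) (auto intro: has_field_derivative_at_within)
  have step: "f a \<le> f v + integral {a..b} g" if v: "v \<in> {a..b}" for v
  proof -
    have "(f' has_integral f v - f a) {a..v}"
      using f v by (intro fundamental_theorem_of_calculus)
        (auto simp: has_real_derivative_iff_has_vector_derivative[symmetric] intro: has_field_derivative_at_within)
    then have "\<bar>f v - f a\<bar> \<le> integral {a..v} g"
      using integral_norm_bound_integral[of f' "{a..v}" g] gi[of a v] v le by (auto simp: has_integral_iff)
    also have "\<dots> \<le> integral {a..b} g"
      using v gi g0 by (intro integral_subset_le) auto
    finally show ?thesis by linarith
  qed
  have "(b - a) * f a = integral {a..b} (\<lambda>_. f a)"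
    using ab by simp
  also have "\<dots> \<le> integral {a..b} (\<lambda>v. f v + integral {a..b} g)"
    using step fc by (intro integral_le integrable_continuous_interval continuous_intros) auto
  also have "\<dots> = integral {a..b} f + (b - a) * integral {a..b} g"
    using ab fc by (subst Henstock_Kurzweil_Integration.integral_add) (auto intro: integrable_continuous_interval)
  also have "(b - a) * integral {a..b} g \<le> \<rho> * integral {a..b} g"
    using ab g0 gi[of a b] by (intro mult_right_mono Henstock_Kurzweil_Integration.integral_nonneg) auto
  finally show ?thesis by simp
qed

lemma integral_cos_period:
  fixes k :: int
  shows "((\<lambda>u. cos (of_int k * (u - y))) has_integral (if k = 0 then 2 * pi else 0)) {-pi..pi}"
proof (cases "k = 0")
  case True
  then show ?thesis using has_integral_const_real[of "1::real" "-pi" pi] by simp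
next
  case False
  have "((\<lambda>u. cos (of_int k * (u - y))) has_integral
      sin (of_int k * (pi - y)) / of_int k - sin (of_int k * (- pi - y)) / of_int k) {-pi..pi}"
    using False by (intro fundamental_theorem_of_calculus)
      (auto simp: has_real_derivative_iff_has_vector_derivative[symmetric] intro!: derivative_eq_intros)
  moreover have "sin (of_int k * (pi - y)) - sin (of_int k * (- pi - y)) = 0"
  proof -
    have "sin (of_int k * pi :: real) = 0" by (simp add: sin_zero_iff_int2)
    then show ?thesis by (simp add: right_diff_distrib sin_diff)
  qed
  ultimately show ?thesis using False by (simp add: diff_divide_distrib[symmetric])
qed

text \<open>Parseval's identity by product-to-sum formulas: each \<open>l\<close> resonates with
  \<open>l' = l\<close> and \<open>l' = - l\<close>, pi from each. For \<open>l = 0\<close> the two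
  indices coincide and the total is still 2 pi. The shift \<open>y\<close> allows the kernel to be
  centred at any partition point.\<close>

lemma integral_dirichlet_sq:
  "((\<lambda>u. (dirichlet N (u - y))\<^sup>2) has_integral 2 * pi / (2 * real N + 1)) {-pi..pi}"
proof -
  let ?I = "{- int N..int N}"
  let ?c = "\<lambda>k::int. if k = 0 then 2 * pi else 0 :: real"
  have "((\<lambda>u. (\<Sum>l\<in>?I. \<Sum>l'\<in>?I. (cos (of_int (l - l') * (u - y)) + cos (of_int (l + l') * (u - y))) / 2) / (2 * real N + 1)\<^sup>2)
     has_integral (\<Sum>l\<in>?I. \<Sum>l'\<in>?I. (?c (l - l') + ?c (l + l')) / 2) / (2 * real N + 1)\<^sup>2) {-pi..pi}"
    by (intro has_integral_divide has_integral_sum has_integral_add integral_cos_period) auto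
  moreover have "(\<Sum>l\<in>?I. \<Sum>l'\<in>?I. (cos (of_int (l - l') * u) + cos (of_int (l + l') * u)) / 2) / (2 * real N + 1)\<^sup>2
     = (dirichlet N u)\<^sup>2" for u
  proof -
    have "(\<Sum>l\<in>?I. cos (of_int l * u))\<^sup>2 = (\<Sum>l\<in>?I. \<Sum>l'\<in>?I. cos (of_int l * u) * cos (of_int l' * u))"
      by (simp add: power2_eq_square sum_product)
    also have "\<dots> = (\<Sum>l\<in>?I. \<Sum>l'\<in>?I. (cos (of_int (l - l') * u) + cos (of_int (l + l') * u)) / 2)"
      by (simp add: cos_times_cos algebra_simps)
    finally show ?thesis by (simp add: dirichlet_def power_divide)
  qed
  moreover have "(\<Sum>l\<in>?I. \<Sum>l'\<in>?I. (?c (l - l') + ?c (l + l')) / 2) = 2 * pi * (2 * real N + 1)"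
  proof -
    have "(\<Sum>l'\<in>?I. (?c (l - l') + ?c (l + l')) / 2) = 2 * pi" if "l \<in> ?I" for l
    proof -
      have "(\<Sum>l'\<in>?I. ?c (l - l')) = (\<Sum>l'\<in>?I. if l' = l then 2 * pi else 0)"
           "(\<Sum>l'\<in>?I. ?c (l + l')) = (\<Sum>l'\<in>?I. if l' = - l then 2 * pi else 0)"
        by (rule sum.cong[OF refl]; auto)+
      moreover have "(\<Sum>l'\<in>?I. if l' = l then 2 * pi else 0) = 2 * pi" "(\<Sum>l'\<in>?I. if l' = - l then 2 * pi else 0) = 2 * pi"
        using sum.delta[of ?I l "\<lambda>_. 2 * pi"] sum.delta[of ?I "- l" "\<lambda>_. 2 * pi"] that by simp_all
      ultimately show ?thesis
        by (simp only: sum_divide_distrib[symmetric] sum.distrib) simp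
    qed
    then show ?thesis by simp
  qed
  ultimately show ?thesis
    by (simp add: power2_eq_square)
qed

text \<open>The same resonances now carry the weight l^2, which is at most N^2. An upper bound
  suffices later, so the exact value stays hidden in \<open>J\<close>.\<close>

lemma integral_dirichlet'_sq:
  obtains J where "((\<lambda>u. (dirichlet' N (u - y))\<^sup>2) has_integral J) {-pi..pi}" "J \<le> 2 * pi * (real N)\<^sup>2 / (2 * real N + 1)"
proof
  let ?I = "{- int N..int N}"
  let ?c = "\<lambda>k::int. if k = 0 then 2 * pi else 0 :: real"
  let ?J = "(\<Sum>l\<in>?I. \<Sum>l'\<in>?I. of_int l * of_int l' * ((?c (l - l') - ?c (l + l')) / 2)) / (2 * real N + 1)\<^sup>2"
  have "((\<lambda>u. (\<Sum>l\<in>?I. \<Sum>l'\<in>?I. of_int l * of_int l' * ((cos (of_int (l - l') * (u - y)) - cos (of_int (l + l') * (u - y))) / 2)) / (2 * real N + 1)\<^sup>2)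
     has_integral ?J) {-pi..pi}"
    by (intro has_integral_divide has_integral_sum has_integral_diff has_integral_mult_right integral_cos_period) auto
  moreover have "(\<Sum>l\<in>?I. \<Sum>l'\<in>?I. of_int l * of_int l' * ((cos (of_int (l - l') * u) - cos (of_int (l + l') * u)) / 2)) / (2 * real N + 1)\<^sup>2
     = (dirichlet' N u)\<^sup>2" for u
  proof -
    have "(\<Sum>l\<in>?I. of_int l * sin (of_int l * u))\<^sup>2 = (\<Sum>l\<in>?I. \<Sum>l'\<in>?I. of_int l * of_int l' * (sin (of_int l * u) * sin (of_int l' * u)))"
      by (simp add: power2_eq_square sum_product mult_ac)
    also have "\<dots> = (\<Sum>l\<in>?I. \<Sum>l'\<in>?I. of_int l * of_int l' * ((cos (of_int (l - l') * u) - cos (of_int (l + l') * u)) / 2))"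
      by (simp add: sin_times_sin algebra_simps)
    finally show ?thesis by (simp add: dirichlet'_def power_divide)
  qed
  ultimately show "((\<lambda>u. (dirichlet' N (u - y))\<^sup>2) has_integral ?J) {-pi..pi}"
    by simp
  have "(\<Sum>l\<in>?I. \<Sum>l'\<in>?I. of_int l * of_int l' * ((?c (l - l') - ?c (l + l')) / 2)) \<le> (\<Sum>l\<in>?I. 2 * pi * (real N)\<^sup>2)"
  proof (rule sum_mono)
    fix l assume l: "l \<in> ?I"
    have "(\<Sum>l'\<in>?I. of_int l * of_int l' * ((?c (l - l') - ?c (l + l')) / 2))
        = (\<Sum>l'\<in>?I. (if l' = l then of_int l * of_int l' * pi else 0) + (if l' = - l then - (of_int l * of_int l' * pi) else 0))"
      by (intro sum.cong) auto
    also have "\<dots> = 2 * pi * (of_int l)\<^sup>2"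
      using l by (simp add: sum.distrib power2_eq_square)
    also have "\<dots> \<le> 2 * pi * (real N)\<^sup>2"
    proof -
      have "\<bar>of_int l :: real\<bar> \<le> real N" using l by auto
      from power_mono[OF this, of 2] show ?thesis by simp
    qed
    finally show "(\<Sum>l'\<in>?I. of_int l * of_int l' * ((?c (l - l') - ?c (l + l')) / 2)) \<le> 2 * pi * (real N)\<^sup>2" .
  qed
  also have "\<dots> = 2 * pi * (real N)\<^sup>2 * (2 * real N + 1)"
    by simp
  finally show "?J \<le> 2 * pi * (real N)\<^sup>2 / (2 * real N + 1)"
    by (simp add: divide_simps power2_eq_square mult_ac)
qed

text \<open>A left Riemann sum of \<open>D\<^sup>2\<close> exceeds its integral by at most \<open>\<rho>\<close> times the total variation,
  and \<open>2 \<bar>D D'\<bar> \<le> N D\<^sup>2 + D'\<^sup>2 / N\<close> reduces the latter to Parseval's identity.\<close>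
lemma dirichlet_sq_sum_le:
  assumes t: "t 0 = - pi" "t m = pi" "\<And>i. i < m \<Longrightarrow> t i \<le> t (Suc i)" "\<And>i. i < m \<Longrightarrow> t (Suc i) - t i \<le> \<rho>"
    and N: "N > 0" and \<rho>: "\<rho> \<ge> 0"
  shows "(\<Sum>i<m. (dirichlet N (t i - y))\<^sup>2 * (t (Suc i) - t i)) \<le> 2 * pi * (\<rho> + 1 / (2 * real N + 1))"
proof -
  define f where "f u = (dirichlet N (u - y))\<^sup>2" for u
  define f' where "f' u = 2 * dirichlet N (u - y) * dirichlet' N (u - y)" for u
  define g where "g u = real N * (dirichlet N (u - y))\<^sup>2 + (dirichlet' N (u - y))\<^sup>2 / real N" for u
  have f: "(f has_real_derivative f' u) (at u)" for u
    unfolding f_def[abs_def] f'_def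
    by (rule derivative_eq_intros DERIV_chain2[OF has_derivative_dirichlet] refl | simp)+
  have gc: "continuous_on S g" for S
    unfolding g_def[abs_def] dirichlet_def dirichlet'_def using N by (intro continuous_intros) auto
  have fc: "continuous_on S f" for S
    unfolding f_def[abs_def] dirichlet_def by (intro continuous_intros) auto
  have le: "\<bar>f' u\<bar> \<le> g u" for u
  proof -
    have "2 * \<bar>a\<bar> * \<bar>b\<bar> \<le> real N * a\<^sup>2 + b\<^sup>2 / real N" for a b :: real
    proof -
      have "0 \<le> (real N * \<bar>a\<bar> - \<bar>b\<bar>)\<^sup>2 / real N" by simp
      also have "\<dots> = real N * a\<^sup>2 + b\<^sup>2 / real N - 2 * \<bar>a\<bar> * \<bar>b\<bar>"
        using N by (simp add: field_simps power2_eq_square)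
      finally show ?thesis by simp
    qed
    then show ?thesis by (simp add: f'_def g_def abs_mult)
  qed
  have main: "(\<Sum>i<k. f (t i) * (t (Suc i) - t i)) \<le> integral {-pi..t k} f + \<rho> * integral {-pi..t k} g \<and> - pi \<le> t k" if "k \<le> m" for k
    using that
  proof (induction k)
    case (Suc k)
    have k: "k < m" using Suc by simp
    have IH: "(\<Sum>i<k. f (t i) * (t (Suc i) - t i)) \<le> integral {-pi..t k} f + \<rho> * integral {-pi..t k} g" "- pi \<le> t k"
      using Suc by auto
    have c: "integral {-pi..t k} F + integral {t k..t (Suc k)} F = integral {-pi..t (Suc k)} F"
      if "\<And>S. continuous_on S F" for F :: "real \<Rightarrow> real"
      using IH(2) t(3)[OF k] that by (intro Henstock_Kurzweil_Integration.integral_combine integrable_continuous_interval) auto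
    have "(t (Suc k) - t k) * f (t k) \<le> integral {t k..t (Suc k)} f + \<rho> * integral {t k..t (Suc k)} g"
      by (rule left_sum_le_integral[OF f gc le t(3)[OF k] t(4)[OF k]])
    moreover have "(\<Sum>i<Suc k. f (t i) * (t (Suc i) - t i)) = (\<Sum>i<k. f (t i) * (t (Suc i) - t i)) + (t (Suc k) - t k) * f (t k)"
      by (simp add: mult.commute)
    moreover have "\<rho> * integral {-pi..t (Suc k)} g = \<rho> * integral {-pi..t k} g + \<rho> * integral {t k..t (Suc k)} g"
      by (simp only: c[OF gc, symmetric] distrib_left)
    ultimately show ?case
      using IH c[OF fc] t(3)[OF k] by linarith
  qed (use t in simp)
  obtain J where J: "((\<lambda>u. (dirichlet' N (u - y))\<^sup>2) has_integral J) {-pi..pi}" "J \<le> 2 * pi * (real N)\<^sup>2 / (2 * real N + 1)"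
    using integral_dirichlet'_sq by blast
  have If: "integral {-pi..pi} f = 2 * pi / (2 * real N + 1)"
    using integral_dirichlet_sq[of N y] unfolding f_def[abs_def] by (rule integral_unique)
  have "(g has_integral real N * (2 * pi / (2 * real N + 1)) + J / real N) {-pi..pi}"
    unfolding g_def[abs_def] by (intro has_integral_add has_integral_mult_right has_integral_divide integral_dirichlet_sq J(1))
  then have "integral {-pi..pi} g = real N * (2 * pi / (2 * real N + 1)) + J / real N"
    by (rule integral_unique)
  also have "\<dots> \<le> real N * (2 * pi / (2 * real N + 1)) + (2 * pi * (real N)\<^sup>2 / (2 * real N + 1)) / real N"
    by (intro add_left_mono divide_right_mono J(2)) simp
  also have "\<dots> = 2 * pi * (2 * real N / (2 * real N + 1))"
    using N by (simp add: power2_eq_square)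
  also have "\<dots> \<le> 2 * pi"
    by (simp add: divide_le_eq)
  finally have "\<rho> * integral {-pi..pi} g \<le> \<rho> * (2 * pi)"
    using \<rho> by (intro mult_left_mono)
  with main[of m] If show ?thesis
    by (simp add: t f_def algebra_simps)
qed

section \<open>Fourier coefficients\<close>

lemma exp_eq_cis: "exp (- \<i> * of_int q * of_real t) = cis (- (of_int q * t))"
  by (simp add: cis_conv_exp mult_ac)

lemma dirichlet_cis_sum:
  "(\<Sum>l\<in>{- int N..int N}. cis (- (of_int l * u))) = of_real ((2 * real N + 1) * dirichlet N u)"
proof (rule complex_eqI)
  have "(\<Sum>l\<in>{- int N..int N}. sin (of_int l * u)) = (\<Sum>l\<in>{- int N..int N}. sin (of_int (- l) * u))"
    by (rule sum.reindex_bij_witness[of _ uminus uminus]) auto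
  then have "(\<Sum>l\<in>{- int N..int N}. sin (of_int l * u)) = 0"
    by (simp add: sum_negf)
  then show "Im (\<Sum>l\<in>{- int N..int N}. cis (- (of_int l * u))) = Im (of_real ((2 * real N + 1) * dirichlet N u))"
    by (simp add: sum_negf)
qed (simp add: dirichlet_def)

text \<open>The phases combine as e^(-il t_k) e^(-i(q-l) t_j) = e^(-iq t_j) e^(-il(t_k - t_j)), and
  summing the last factor over l gives (2N+1) D(t_k - t_j). The prefactors 2 pi / (2N+1) and 1 / (2
  pi)^2 then leave 1 / (2 pi).\<close>

lemma fourier_B_quadratic:
  fixes tp m n H w
  defines "t \<equiv> tp n" and "y \<equiv> \<lambda>k. H (tp n (Suc k)) w - H (tp n k) w"
  shows "fourier_B tp m H n N q w =
    (\<Sum>k<m n. \<Sum>j<m n. cis (- (of_int q * t j)) * of_real (dirichlet N (t k - t j) * y k * y j)) / (2 * pi)"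
proof -
  let ?I = "{- int N..int N}"
  have prod: "fourier_dH tp m H n l w * fourier_dH tp m H n (q - l) w
     = (\<Sum>k<m n. \<Sum>j<m n. cis (- (of_int l * (t k - t j))) * (cis (- (of_int q * t j)) * of_real (y k * y j))) / (2 * pi)\<^sup>2" for l
  proof -
    have "cis (- (of_int l * t k)) * of_real (y k) * (cis (- (of_int (q - l) * t j)) * of_real (y j))
       = cis (- (of_int l * (t k - t j))) * (cis (- (of_int q * t j)) * of_real (y k * y j))" for k j
    proof -
      have "cis (- (of_int l * t k)) * of_real (y k) * (cis (- (of_int (q - l) * t j)) * of_real (y j))
         = (cis (- (of_int l * t k)) * cis (- (of_int (q - l) * t j))) * of_real (y k * y j)"
        by simp
      also have "cis (- (of_int l * t k)) * cis (- (of_int (q - l) * t j)) = cis (- (of_int l * (t k - t j))) * cis (- (of_int q * t j))"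
        by (simp add: cis_mult algebra_simps)
      finally show ?thesis by (simp only: mult.assoc)
    qed
    then have "(\<Sum>k<m n. cis (- (of_int l * t k)) * of_real (y k)) * (\<Sum>j<m n. cis (- (of_int (q - l) * t j)) * of_real (y j))
      = (\<Sum>k<m n. \<Sum>j<m n. cis (- (of_int l * (t k - t j))) * (cis (- (of_int q * t j)) * of_real (y k * y j)))"
      unfolding sum_product by (intro sum.cong refl)
    then show ?thesis
      unfolding fourier_dH_def exp_eq_cis t_def y_def by (simp add: power2_eq_square)
  qed
  have "(\<Sum>l\<in>?I. fourier_dH tp m H n l w * fourier_dH tp m H n (q - l) w)
     = (\<Sum>l\<in>?I. \<Sum>k<m n. \<Sum>j<m n. cis (- (of_int l * (t k - t j))) * (cis (- (of_int q * t j)) * of_real (y k * y j))) / (2 * pi)\<^sup>2"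
    unfolding prod by (simp add: sum_divide_distrib)
  also have "(\<Sum>l\<in>?I. \<Sum>k<m n. \<Sum>j<m n. cis (- (of_int l * (t k - t j))) * (cis (- (of_int q * t j)) * of_real (y k * y j)))
     = (\<Sum>k<m n. \<Sum>l\<in>?I. \<Sum>j<m n. cis (- (of_int l * (t k - t j))) * (cis (- (of_int q * t j)) * of_real (y k * y j)))"
    by (rule sum.swap)
  also have "\<dots> = (\<Sum>k<m n. \<Sum>j<m n. \<Sum>l\<in>?I. cis (- (of_int l * (t k - t j))) * (cis (- (of_int q * t j)) * of_real (y k * y j)))"
    by (intro sum.cong refl sum.swap)
  also have "\<dots> = (\<Sum>k<m n. \<Sum>j<m n. of_real (2 * real N + 1) * (cis (- (of_int q * t j)) * of_real (dirichlet N (t k - t j) * y k * y j)))"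
    unfolding sum_distrib_right[symmetric] dirichlet_cis_sum by (intro sum.cong refl) simp
  also have "\<dots> = of_real (2 * real N + 1) * (\<Sum>k<m n. \<Sum>j<m n. cis (- (of_int q * t j)) * of_real (dirichlet N (t k - t j) * y k * y j))"
    by (simp only: sum_distrib_left)
  finally have "(\<Sum>l\<in>?I. fourier_dH tp m H n l w * fourier_dH tp m H n (q - l) w)
     = of_real (2 * real N + 1) * (\<Sum>k<m n. \<Sum>j<m n. cis (- (of_int q * t j)) * of_real (dirichlet N (t k - t j) * y k * y j)) / (2 * pi)\<^sup>2" .
  moreover have "of_real (2 * real N + 1) = (2 * of_nat N + 1 :: complex)" by simp
  moreover have "(2 * of_nat N + 1 :: complex) \<noteq> 0"
    by (metis of_nat_1 of_nat_add of_nat_eq_0_iff of_nat_mult of_nat_numeral add_is_0 one_neq_zero)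
  ultimately show ?thesis
    unfolding fourier_B_def by (simp add: power2_eq_square)
qed

lemma integral_cells:
  fixes f :: "real \<Rightarrow> 'b::banach"
  assumes "\<And>i. i < m \<Longrightarrow> t i \<le> t (Suc i)" "f integrable_on {t 0..t m}"
  shows "(\<Sum>i<m. integral {t i..t (Suc i)} f) = integral {t 0..t m} f"
  using assms
proof (induction m)
  case (Suc m)
  have le: "t 0 \<le> t k" if "k \<le> m" for k
    using that
  proof (induction k)
    case (Suc k)
    then show ?case using Suc.prems \<open>\<And>i. i < Suc m \<Longrightarrow> t i \<le> t (Suc i)\<close>[of k] by auto
  qed simp
  have "f integrable_on {t 0..t m}"
    using Suc.prems(1)[of m] by (intro integrable_on_subinterval[OF Suc.prems(2)]) auto
  then show ?case
    using Suc Henstock_Kurzweil_Integration.integral_combine[OF le[of m] Suc.prems(1)[of m] Suc.prems(2)] by simp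
qed simp

lemma norm_cis_diff_le: "cmod (cis a - cis b) \<le> \<bar>a - b\<bar>"
proof -
  have "(cmod (cis a - cis b))\<^sup>2 = (cos a - cos b)\<^sup>2 + (sin a - sin b)\<^sup>2"
    by (simp add: cmod_power2)
  also have "\<dots> = ((cos a)\<^sup>2 + (sin a)\<^sup>2) + ((cos b)\<^sup>2 + (sin b)\<^sup>2) - 2 * (cos a * cos b + sin a * sin b)"
    by (simp add: power2_eq_square algebra_simps)
  also have "\<dots> = 2 - 2 * cos (a - b)"
    by (simp add: cos_diff)
  also have "a - b = 2 * ((a - b) / 2)"
    by simp
  also have "2 - 2 * cos (2 * ((a - b) / 2)) = (2 * sin ((a - b) / 2))\<^sup>2"
    unfolding cos_double_sin by (simp add: power2_eq_square)
  also have "\<dots> \<le> (a - b)\<^sup>2"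
    using abs_sin_x_le_abs_x[of "(a - b) / 2"] by (intro abs_le_square_iff[THEN iffD1]) (simp add: abs_mult)
  finally show ?thesis
    by (metis abs_le_square_iff abs_norm_cancel)
qed

text \<open>The phase is |q|-Lipschitz, so freezing it at the left end costs at most |q| \<rho> per
  unit of the integral of \<open>v\<close>.\<close>

lemma fourier_cell_error:
  assumes v: "continuous_on {a..b} v" "\<And>u. v u \<ge> 0" and ab: "a \<le> b" "b - a \<le> \<rho>"
  shows "cmod (integral {a..b} (\<lambda>u. cis (- (of_int q * u)) * of_real (v u)) - cis (- (of_int q * a)) * of_real (integral {a..b} v))
     \<le> \<bar>of_int q\<bar> * \<rho> * integral {a..b} v"
proof -
  have c: "continuous_on {a..b} (\<lambda>u. cis (- (of_int q * u)) * of_real (v u))"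
    using v by (intro continuous_intros) auto
  have c': "continuous_on {a..b} (\<lambda>u. cis (- (of_int q * a)) * complex_of_real (v u))"
    using v by (intro continuous_intros) auto
  have vi: "v integrable_on {a..b}" using v by (intro integrable_continuous_interval)
  have "cis (- (of_int q * a)) * complex_of_real (integral {a..b} v) = integral {a..b} (\<lambda>u. cis (- (of_int q * a)) * of_real (v u))"
    using has_integral_mult_right[OF has_integral_of_real[OF integrable_integral[OF vi]], of "cis (- (of_int q * a))"]
    by (rule integral_unique[symmetric])
  then have "integral {a..b} (\<lambda>u. cis (- (of_int q * u)) * of_real (v u)) - cis (- (of_int q * a)) * of_real (integral {a..b} v)
    = integral {a..b} (\<lambda>u. cis (- (of_int q * u)) * of_real (v u)) - integral {a..b} (\<lambda>u. cis (- (of_int q * a)) * of_real (v u))"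
    by (simp only:)
  also have "\<dots> = integral {a..b} (\<lambda>u. cis (- (of_int q * u)) * of_real (v u) - cis (- (of_int q * a)) * of_real (v u))"
    using c c' by (intro Henstock_Kurzweil_Integration.integral_diff[symmetric] integrable_continuous_interval)
  also have "cmod \<dots> \<le> integral {a..b} (\<lambda>u. \<bar>of_int q\<bar> * \<rho> * v u)"
  proof (rule integral_norm_bound_integral)
    fix u assume u: "u \<in> {a..b}"
    have "cmod (cis (- (of_int q * u)) * of_real (v u) - cis (- (of_int q * a)) * of_real (v u))
       = cmod (cis (- (of_int q * u)) - cis (- (of_int q * a))) * v u"
      using v(2) by (simp add: left_diff_distrib[symmetric] norm_mult)
    also have "\<dots> \<le> \<bar>- (of_int q * u) - - (of_int q * a)\<bar> * v u"
      by (intro mult_right_mono norm_cis_diff_le v)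
    also have "\<bar>- (of_int q * u) - - (of_int q * a)\<bar> = \<bar>of_int q\<bar> * (u - a)"
    proof -
      have "- (of_int q * u) - - (of_int q * a) = - (of_int q * (u - a))"
        by (simp add: right_diff_distrib)
      then show ?thesis
        using u by (simp only: abs_minus_cancel abs_mult) simp
    qed
    also have "\<bar>of_int q\<bar> * (u - a) * v u \<le> \<bar>of_int q\<bar> * \<rho> * v u"
      using u ab v(2) by (intro mult_right_mono mult_left_mono) auto
    finally show "cmod (cis (- (of_int q * u)) * of_real (v u) - cis (- (of_int q * a)) * of_real (v u)) \<le> \<bar>of_int q\<bar> * \<rho> * v u" .
  qed (use c c' v in \<open>auto intro!: integrable_continuous_interval continuous_intros\<close>)
  finally show ?thesis by simp
qed

text \<open>Real and imaginary parts of e^(-iq t_j) D(t_k - t_j), separated because the moment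
  bounds concern real forms. The phase sits at \<open>t j\<close> alone, so the kernels are not
  symmetric in \<open>k\<close> and \<open>j\<close>; the estimates symmetrise them.\<close>

definition kernel_cos :: "(nat \<Rightarrow> real) \<Rightarrow> nat \<Rightarrow> int \<Rightarrow> nat \<Rightarrow> nat \<Rightarrow> real" where
  "kernel_cos t N q k j = cos (of_int q * t j) * dirichlet N (t k - t j)"

definition kernel_sin :: "(nat \<Rightarrow> real) \<Rightarrow> nat \<Rightarrow> int \<Rightarrow> nat \<Rightarrow> nat \<Rightarrow> real" where
  "kernel_sin t N q k j = - sin (of_int q * t j) * dirichlet N (t k - t j)"

text \<open>A quadratic form minus its diagonal compensator for a single path; this is the random
  variable whose moments \<open>quadratic_form_moment\<close> controls.\<close>

definition form_error :: "(nat \<Rightarrow> nat \<Rightarrow> real) \<Rightarrow> (nat \<Rightarrow> real) \<Rightarrow> nat \<Rightarrow> (nat \<Rightarrow> real) \<Rightarrow> (real \<Rightarrow> real) \<Rightarrow> real" where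
  "form_error e t m y v = (\<Sum>k<m. \<Sum>j<m. e k j * y k * y j) - (\<Sum>k<m. e k k * integral {t k..t (Suc k)} v)"

lemma fourier_error:
  fixes tp m n H w
  defines "t \<equiv> tp n" and "y \<equiv> \<lambda>k. H (tp n (Suc k)) w - H (tp n k) w"
  assumes t: "t 0 = - pi" "t (m n) = pi" "\<And>i. i < m n \<Longrightarrow> t i \<le> t (Suc i)" "\<And>i. i < m n \<Longrightarrow> t (Suc i) - t i \<le> \<rho>"
    and v: "continuous_on {-pi..pi} v" "\<And>u. v u \<ge> 0" and \<rho>: "\<rho> \<ge> 0"
  shows "cmod (fourier v q - fourier_B tp m H n N q w)
    \<le> \<bar>form_error (kernel_cos t N q) t (m n) y v\<bar> + \<bar>form_error (kernel_sin t N q) t (m n) y v\<bar>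
      + \<bar>of_int q\<bar> * \<rho> * integral {-pi..pi} v"
proof -
  define c where "c u = cis (- (of_int q * u))" for u
  define J where "J k = integral {t k..t (Suc k)} (\<lambda>u. c u * of_real (v u))" for k
  define I where "I k = integral {t k..t (Suc k)} v" for k
  define S where "S = (\<Sum>k<m n. \<Sum>j<m n. c (t j) * of_real (dirichlet N (t k - t j) * y k * y j))"
  have sub: "{t k..t (Suc k)} \<subseteq> {-pi..pi}" if k: "k < m n" for k
  proof -
    have mono: "t i \<le> t j" if "i \<le> j" "j \<le> m n" for i j
      using that(1)
    proof (induction rule: inc_induct)
      case (step k)
      then show ?case using t(3)[of k] that by simp
    qed simp
    from mono[of 0 k] mono[of "Suc k" "m n"] k t(1,2) show ?thesis by auto
  qed
  have cc: "continuous_on {-pi..pi} (\<lambda>u. c u * of_real (v u))"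
    unfolding c_def using v by (intro continuous_intros) auto
  have F: "fourier v q = (\<Sum>k<m n. J k) / (2 * pi)"
  proof -
    have "(\<Sum>k<m n. J k) = integral {t 0..t (m n)} (\<lambda>u. c u * of_real (v u))"
      unfolding J_def using t cc by (intro integral_cells integrable_continuous_interval) auto
    then show ?thesis unfolding fourier_def exp_eq_cis c_def t by simp
  qed
  have B: "fourier_B tp m H n N q w = S / (2 * pi)"
    unfolding fourier_B_quadratic S_def c_def t_def y_def ..
  have sumI: "(\<Sum>k<m n. I k) = integral {-pi..pi} v"
    unfolding I_def using t v by (subst integral_cells) (auto intro: integrable_continuous_interval)
  have S: "S - (\<Sum>k<m n. c (t k) * of_real (I k)) = Complex (form_error (kernel_cos t N q) t (m n) y v) (form_error (kernel_sin t N q) t (m n) y v)"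
    by (rule complex_eqI)
       (simp_all add: S_def c_def form_error_def kernel_cos_def kernel_sin_def I_def dirichlet_zero sum_negf mult.assoc)
  have "fourier v q - fourier_B tp m H n N q w
     = ((\<Sum>k<m n. J k - c (t k) * of_real (I k)) - (S - (\<Sum>k<m n. c (t k) * of_real (I k)))) / (2 * pi)"
    unfolding F B sum_subtractf by (simp add: diff_divide_distrib)
  then have "cmod (fourier v q - fourier_B tp m H n N q w)
     = cmod ((\<Sum>k<m n. J k - c (t k) * of_real (I k)) - (S - (\<Sum>k<m n. c (t k) * of_real (I k)))) / (2 * pi)"
    by (simp add: norm_divide norm_mult)
  also have "\<dots> \<le> cmod ((\<Sum>k<m n. J k - c (t k) * of_real (I k)) - (S - (\<Sum>k<m n. c (t k) * of_real (I k)))) / 1"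
    using pi_ge_two by (intro divide_left_mono) auto
  also have "\<dots> \<le> cmod (\<Sum>k<m n. J k - c (t k) * of_real (I k)) + cmod (S - (\<Sum>k<m n. c (t k) * of_real (I k)))"
    by (simp add: norm_triangle_ineq4)
  also have "cmod (S - (\<Sum>k<m n. c (t k) * of_real (I k)))
     \<le> \<bar>form_error (kernel_cos t N q) t (m n) y v\<bar> + \<bar>form_error (kernel_sin t N q) t (m n) y v\<bar>"
    unfolding S using cmod_le[of "Complex (form_error (kernel_cos t N q) t (m n) y v) (form_error (kernel_sin t N q) t (m n) y v)"] by simp
  also have "cmod (\<Sum>k<m n. J k - c (t k) * of_real (I k)) \<le> (\<Sum>k<m n. \<bar>of_int q\<bar> * \<rho> * I k)"
  proof (rule order_trans[OF norm_sum sum_mono])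
    fix k assume "k \<in> {..<m n}"
    then show "cmod (J k - c (t k) * of_real (I k)) \<le> \<bar>of_int q\<bar> * \<rho> * I k"
      unfolding J_def I_def c_def using sub[of k] t v 
      by (intro fourier_cell_error continuous_on_subset[OF v(1)]) auto
  qed
  also have "\<dots> = \<bar>of_int q\<bar> * \<rho> * integral {-pi..pi} v"
    unfolding sumI[symmetric] by (simp add: sum_distrib_left)
  finally show ?thesis by simp
qed

text \<open>Since D is even, the symmetrised kernel is at most 2 |D(t_j - t_k)|; squaring gives the
  factor 4 in front of the bound 2 pi (...) for D^2.\<close>

lemma kernel_row_sum:
  assumes t: "t 0 = - pi" "t m = pi" "\<And>i. i < m \<Longrightarrow> t i \<le> t (Suc i)" "\<And>i. i < m \<Longrightarrow> t (Suc i) - t i \<le> \<rho>"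
    and N: "N > 0" and \<rho>: "\<rho> \<ge> 0" and e: "\<And>k j. \<bar>e k j\<bar> \<le> \<bar>dirichlet N (t k - t j)\<bar>"
  shows "(\<Sum>j<m. (e k j + e j k)\<^sup>2 * (t (Suc j) - t j)) \<le> 8 * pi * (\<rho> + 1 / (2 * real N + 1))"
proof -
  have "(e k j + e j k)\<^sup>2 \<le> 4 * (dirichlet N (t j - t k))\<^sup>2" for j
  proof -
    have "\<bar>e k j\<bar> \<le> \<bar>dirichlet N (t j - t k)\<bar>" "\<bar>e j k\<bar> \<le> \<bar>dirichlet N (t j - t k)\<bar>"
      using e[of k j] e[of j k] dirichlet_minus[of N "t j - t k"] by simp_all
    then have "\<bar>e k j + e j k\<bar> \<le> \<bar>2 * dirichlet N (t j - t k)\<bar>" by linarith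
    then show ?thesis by (simp add: abs_le_square_iff power_mult_distrib)
  qed
  then have "(\<Sum>j<m. (e k j + e j k)\<^sup>2 * (t (Suc j) - t j)) \<le> (\<Sum>j<m. 4 * (dirichlet N (t j - t k))\<^sup>2 * (t (Suc j) - t j))"
    using t(3) by (intro sum_mono mult_right_mono) auto
  also have "\<dots> = 4 * (\<Sum>j<m. (dirichlet N (t j - t k))\<^sup>2 * (t (Suc j) - t j))"
    by (simp add: sum_distrib_left mult.assoc)
  also have "\<dots> \<le> 4 * (2 * pi * (\<rho> + 1 / (2 * real N + 1)))"
    by (intro mult_left_mono dirichlet_sq_sum_le t N \<rho>) auto
  finally show ?thesis by simp
qed

lemma kernel_cos_le: "\<bar>kernel_cos t N q k j\<bar> \<le> \<bar>dirichlet N (t k - t j)\<bar>"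
  unfolding kernel_cos_def abs_mult by (intro mult_left_le_one_le) auto

lemma kernel_sin_le: "\<bar>kernel_sin t N q k j\<bar> \<le> \<bar>dirichlet N (t k - t j)\<bar>"
  unfolding kernel_sin_def abs_mult by (intro mult_left_le_one_le) auto

text \<open>The Cesaro weights and the exponentials have modulus at most 1. The bound is free of
  \<open>t\<close>, so the supremum costs no more than a sum over the frequencies.\<close>

lemma T_poly_diff_le:
  assumes "MM > 0"
  shows "cmod (T_poly MM v t - T_B_poly tp m H n N MM w t) \<le> (\<Sum>l\<in>{- int MM..int MM}. cmod (fourier v l - fourier_B tp m H n N l w))"
proof -
  have "T_poly MM v t - T_B_poly tp m H n N MM w t = (\<Sum>l\<in>{- int MM..int MM}.
      of_real (1 - \<bar>real_of_int l\<bar> / real MM) * (fourier v l - fourier_B tp m H n N l w) * exp (\<i> * of_int l * of_real t))"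
    unfolding T_poly_def T_B_poly_def sum_subtractf[symmetric] by (simp add: algebra_simps)
  also have "cmod \<dots> \<le> (\<Sum>l\<in>{- int MM..int MM}. cmod (fourier v l - fourier_B tp m H n N l w))"
  proof (rule order_trans[OF norm_sum sum_mono])
    fix l assume "l \<in> {- int MM..int MM}"
    then have "\<bar>real_of_int l\<bar> \<le> real MM" by auto
    then have "\<bar>1 - \<bar>real_of_int l\<bar> / real MM\<bar> \<le> 1" using assms by (auto simp: field_simps)
    moreover have "cmod (exp (\<i> * of_int l * of_real t)) = 1" by (simp add: norm_exp_eq_Re)
    ultimately show "cmod (of_real (1 - \<bar>real_of_int l\<bar> / real MM) * (fourier v l - fourier_B tp m H n N l w) * exp (\<i> * of_int l * of_real t))
       \<le> cmod (fourier v l - fourier_B tp m H n N l w)"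
      unfolding norm_mult norm_of_real by (simp add: mult_left_le_one_le)
  qed
  finally show ?thesis .
qed

section \<open>Almost sure convergence\<close>

text \<open>Comparison with the largest term. Hoelder's inequality would save one factor
  \<open>card I\<close>; that factor is of order \<epsilon>^(-r) later and is paid for by the
  \<open>- r\<close> in the summability exponent.\<close>

lemma sum_power_le_card:
  fixes a :: "'b \<Rightarrow> real"
  assumes "finite I" "I \<noteq> {}" "\<And>q. q \<in> I \<Longrightarrow> 0 \<le> a q"
  shows "(\<Sum>q\<in>I. a q) ^ k \<le> real (card I) ^ k * (\<Sum>q\<in>I. a q ^ k)"
proof -
  have "Max (a ` I) \<in> a ` I" using assms by (intro Max_in) auto
  then obtain q0 where q0: "q0 \<in> I" "a q0 = Max (a ` I)" by auto
  have "(\<Sum>q\<in>I. a q) \<le> real (card I) * a q0"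
    using assms q0 by (intro sum_bounded_above) auto
  then have "(\<Sum>q\<in>I. a q) ^ k \<le> (real (card I) * a q0) ^ k"
    using assms by (intro power_mono sum_nonneg) auto
  also have "\<dots> = real (card I) ^ k * a q0 ^ k" by (rule power_mult_distrib)
  also have "\<dots> \<le> real (card I) ^ k * (\<Sum>q\<in>I. a q ^ k)"
    using assms q0 by (intro mult_left_mono member_le_sum[of q0 I "\<lambda>q. a q ^ k"]) auto
  finally show ?thesis .
qed

lemma abs_add_power_le:
  fixes a b :: real
  shows "(\<bar>a\<bar> + \<bar>b\<bar>) ^ (2 * k) \<le> 2 ^ (2 * k) * (a ^ (2 * k) + b ^ (2 * k))"
proof -
  have "(\<bar>a\<bar> + \<bar>b\<bar>) ^ (2 * k) \<le> (2 * max \<bar>a\<bar> \<bar>b\<bar>) ^ (2 * k)"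
    by (intro power_mono) auto
  also have "\<dots> \<le> 2 ^ (2 * k) * (a ^ (2 * k) + b ^ (2 * k))"
    unfolding power_mult_distrib by (intro mult_left_mono) (auto simp: max_def power_even_abs zero_le_even_power)
  finally show ?thesis .
qed

text \<open>The series of the \<open>U n\<close> has finite expectation, hence converges almost
  surely, and its terms tend to 0. This plays the role of Chebyshev's inequality followed by
  Borel-Cantelli.\<close>

lemma AE_tendsto_zero_of_summable_integrals:
  fixes U :: "nat \<Rightarrow> 'a \<Rightarrow> real"
  assumes U: "\<And>n. integrable M (U n)" "\<And>n w. 0 \<le> U n w" and le: "\<And>n. integral\<^sup>L M (U n) \<le> c n" and c: "summable c"
  shows "AE w in M. (\<lambda>n. U n w) \<longlonglongrightarrow> 0"
proof -
  have [measurable]: "U n \<in> borel_measurable M" for n using U(1)[of n] by simp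
  have nn: "0 \<le> integral\<^sup>L M (U n)" for n by (rule Bochner_Integration.integral_nonneg) (rule U)
  have sm: "summable (\<lambda>n. integral\<^sup>L M (U n))"
    by (rule summable_comparison_test[OF _ c]) (use nn le in auto)
  have "(\<integral>\<^sup>+ w. (\<Sum>n. ennreal (U n w)) \<partial>M) = (\<Sum>n. \<integral>\<^sup>+ w. ennreal (U n w) \<partial>M)"
    by (rule nn_integral_suminf) measurable
  also have "\<dots> = (\<Sum>n. ennreal (integral\<^sup>L M (U n)))"
    using U by (subst nn_integral_eq_integral) auto
  also have "\<dots> = ennreal (\<Sum>n. integral\<^sup>L M (U n))"
    by (rule suminf_ennreal2[OF nn sm])
  finally have "(\<integral>\<^sup>+ w. (\<Sum>n. ennreal (U n w)) \<partial>M) \<noteq> \<infinity>" by simp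
  then have "AE w in M. (\<Sum>n. ennreal (U n w)) \<noteq> \<infinity>"
    by (intro nn_integral_PInf_AE) measurable
  then show ?thesis
  proof eventually_elim
    fix w assume "(\<Sum>n. ennreal (U n w)) \<noteq> \<infinity>"
    then have "summable (\<lambda>n. U n w)" using U(2) by (intro summable_suminf_not_top) auto
    then show "(\<lambda>n. U n w) \<longlonglongrightarrow> 0" by (rule summable_LIMSEQ_zero)
  qed
qed

lemma integrable_of_nn_integral_le:
  fixes f :: "'a \<Rightarrow> real"
  assumes "f \<in> borel_measurable M" "\<And>w. 0 \<le> f w" "(\<integral>\<^sup>+ w. ennreal (f w) \<partial>M) \<le> ennreal C" "0 \<le> C"
  shows "integrable M f" "integral\<^sup>L M f \<le> C"
proof -
  have "(\<integral>\<^sup>+ w. ennreal (f w) \<partial>M) < \<infinity>"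
    using assms(3) by (rule le_less_trans) simp
  then show i: "integrable M f"
    using assms by (intro integrableI_nonneg) auto
  have "ennreal (integral\<^sup>L M f) \<le> ennreal C"
    using assms nn_integral_eq_integral[OF i] by simp
  then show "integral\<^sup>L M f \<le> C" using assms(4) by simp
qed

section \<open>From the hypotheses on the volatility to adaptedness and even integer moments\<close>

context filtered_brownian_motion
begin

text \<open>Joint measurability up to time \<open>t\<close> is restricted to the slice {t} by
  composing with the measurable map \<open>Pair t\<close>.\<close>

lemma progressive_path_integrand:
  assumes "progressive M F X" "\<forall>w\<in>space M. continuous_on {-pi..pi} (\<lambda>t. X t w)"
  shows "path_integrand X"
  unfolding path_integrand_def
proof (intro conjI ballI)
  fix t assume t: "t \<in> {-pi..pi}"
  have "(\<lambda>(s, w). X s w) \<in> borel_measurable (restrict_space lborel {-pi..t} \<Otimes>\<^sub>M FM t)"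
    using assms t by (simp add: progressive_def)
  moreover have "Pair t \<in> measurable (FM t) (restrict_space lborel {-pi..t} \<Otimes>\<^sub>M FM t)"
    using t by (intro measurable_Pair1') (simp add: space_restrict_space)
  ultimately have "(\<lambda>(s, w). X s w) \<circ> Pair t \<in> borel_measurable (FM t)"
    by (rule measurable_comp[rotated])
  then show "X t \<in> borel_measurable (FM t)" by (simp add: o_def)
qed (use assms in auto)

text \<open>For even \<open>k\<close> up to \<open>a\<close> one has x^k \<le> 1 + |x|^a; the
  constant 1 contributes 2 pi after integration in time.\<close>

lemma cond_I_moment:
  assumes X: "path_integrand X" and I: "cond_I M a X" and k: "even k" "real k \<le> a" "a > 0"
  obtains B where "B \<ge> 0" "(\<integral>\<^sup>+ w. ennreal (integral {-pi..pi} (\<lambda>u. X u w ^ k)) \<partial>M) \<le> ennreal B"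
proof -
  let ?f = "\<lambda>w. integral {-pi..pi} (\<lambda>u. X u w ^ k)"
  let ?g = "\<lambda>w. \<integral>\<^sup>+ z\<in>{-pi..pi}. ennreal (\<bar>X z w\<bar> powr a) \<partial>lborel"
  have fm [measurable]: "?f \<in> borel_measurable M"
    by (rule path_integral_measurable[OF X]) auto
  have le: "ennreal (?f w) \<le> ennreal (2 * pi) + ?g w" if w: "w \<in> space M" for w
  proof -
    have c: "continuous_on {-pi..pi} (\<lambda>u. X u w)" using X w by (simp add: path_integrand_def)
    have "continuous_on {-pi..pi} (\<lambda>u. \<bar>X u w\<bar> powr a)"
      using c k(3) by (intro continuous_on_powr' continuous_intros) auto
    then have meas: "(\<lambda>u. indicator {-pi..pi} u * \<bar>X u w\<bar> powr a) \<in> borel_measurable lborel"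
      using borel_measurable_continuous_on_indicator[of "{-pi..pi}" "\<lambda>u. \<bar>X u w\<bar> powr a"] by simp
    have pw: "x ^ k \<le> 1 + \<bar>x\<bar> powr a" for x :: real
    proof (cases "\<bar>x\<bar> \<le> 1")
      case True
      then have "\<bar>x\<bar> ^ k \<le> 1" by (intro power_le_one) auto
      then show ?thesis using k(1) by (simp add: power_even_abs add_increasing2)
    next
      case False
      then have "\<bar>x\<bar> ^ k = \<bar>x\<bar> powr real k" by (simp add: powr_realpow)
      also have "\<dots> \<le> \<bar>x\<bar> powr a" using False k by (intro powr_mono) auto
      finally show ?thesis using k(1) by (simp add: power_even_abs)
    qed
    have "((\<lambda>u. X u w ^ k) has_integral ?f w) {-pi..pi}"
      using c by (intro integrable_integral integrable_continuous_interval continuous_intros)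
    from nn_integral_has_integral_lebesgue[OF _ this] k(1)
    have "ennreal (?f w) = (\<integral>\<^sup>+ u. ennreal (indicator {-pi..pi} u * X u w ^ k) \<partial>lborel)"
      by (simp add: zero_le_even_power)
    also have "\<dots> \<le> (\<integral>\<^sup>+ u. indicator {-pi..pi} u + ennreal (indicator {-pi..pi} u * \<bar>X u w\<bar> powr a) \<partial>lborel)"
    proof (rule nn_integral_mono)
      fix u
      show "ennreal (indicator {-pi..pi} u * X u w ^ k) \<le> indicator {-pi..pi} u + ennreal (indicator {-pi..pi} u * \<bar>X u w\<bar> powr a)"
        using pw[of "X u w"] by (auto simp: indicator_def ennreal_leI simp flip: ennreal_plus ennreal_1)
    qed
    also have "\<dots> = (\<integral>\<^sup>+ u. indicator {-pi..pi} u \<partial>lborel) + (\<integral>\<^sup>+ u. ennreal (indicator {-pi..pi} u * \<bar>X u w\<bar> powr a) \<partial>lborel)"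
      using meas by (intro nn_integral_add) auto
    also have "(\<integral>\<^sup>+ u. indicator {-pi..pi} u \<partial>lborel) = ennreal (2 * pi)"
      by simp
    also have "(\<integral>\<^sup>+ u. ennreal (indicator {-pi..pi} u * \<bar>X u w\<bar> powr a) \<partial>lborel) = ?g w"
      by (intro nn_integral_cong) (auto simp: indicator_def)
    finally show ?thesis .
  qed
  \<comment> \<open>Measurability of \<open>?g\<close> in \<open>w\<close> is not established here,
    so additivity is not applied to it: 2 pi is moved to the measurable side, and added back after
    integration.\<close>
  have "(\<integral>\<^sup>+ w. ennreal (?f w - 2 * pi) \<partial>M) \<le> (\<integral>\<^sup>+ w. ?g w \<partial>M)"
  proof (rule nn_integral_mono)
    fix w assume "w \<in> space M"
    from le[OF this] have "ennreal (?f w) - ennreal (2 * pi) \<le> ?g w"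
      by (simp add: ennreal_minus_le_iff)
    then show "ennreal (?f w - 2 * pi) \<le> ?g w" by (simp add: ennreal_minus)
  qed
  also have "\<dots> < \<infinity>" using I by (simp add: cond_I_def)
  finally have fin: "(\<integral>\<^sup>+ w. ennreal (?f w - 2 * pi) \<partial>M) < \<infinity>" .
  have "(\<integral>\<^sup>+ w. ennreal (?f w) \<partial>M) \<le> (\<integral>\<^sup>+ w. ennreal (?f w - 2 * pi) + ennreal (2 * pi) \<partial>M)"
  proof (rule nn_integral_mono)
    fix w
    show "ennreal (?f w) \<le> ennreal (?f w - 2 * pi) + ennreal (2 * pi)"
      by (cases "?f w \<ge> 2 * pi") (auto simp: ennreal_plus[symmetric] ennreal_leI ennreal_neg simp del: ennreal_plus)
  qed
  also have "\<dots> = (\<integral>\<^sup>+ w. ennreal (?f w - 2 * pi) \<partial>M) + ennreal (2 * pi)"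
    by (subst nn_integral_add) (auto simp: emeasure_space_1)
  also have "\<dots> < \<infinity>" using fin by simp
  finally have "(\<integral>\<^sup>+ w. ennreal (?f w) \<partial>M) < \<infinity>" .
  then obtain B where "B \<ge> 0" "(\<integral>\<^sup>+ w. ennreal (?f w) \<partial>M) = ennreal B"
    by (cases "\<integral>\<^sup>+ w. ennreal (?f w) \<partial>M" rule: ennreal_cases) auto
  then show ?thesis by (intro that[of B]) auto
qed

end

text \<open>Only even integer moments enter the argument. The exponents allow this because
  \<open>[p / \<beta>, p max(\<alpha>, \<beta>) / 2]\<close> has length greater than \<open>2\<close>.\<close>
lemma exists_even_exponent:
  fixes p \<alpha> \<beta> \<theta> r :: real
  assumes p: "p > 2" and ab: "\<alpha> > 1" "\<beta> > 1" "1 / \<alpha> + 1 / \<beta> = 1"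
    and \<theta>: "0 < \<theta>" "\<theta> < 1 / (2 * \<beta>)" and r: "0 < r" "r < 1 / (2 * \<beta>) - \<theta>" "r < \<theta> * p - 1"
  obtains i :: nat where "real (4 * Suc i) \<le> p * max \<alpha> \<beta>" "\<theta> * p \<le> real (Suc i) * (1 - 2 * r)"
proof -
  define b where "b = 1 / (2 * \<beta>)"
  have b: "0 < b" "b < 1 / 2" using ab by (auto simp: b_def field_simps)
  have pb: "p * b > 1"
  proof -
    have "\<theta> * p < b * p" using \<theta> p by (intro mult_strict_right_mono) (auto simp: b_def)
    then show ?thesis using r by (simp add: mult.commute)
  qed
  \<comment> \<open>Rounding up p b costs less than 1, and p b > 1 because \<theta> p > 1 + r and
    \<theta> < b.\<close>
  define k where "k = nat \<lceil>p * b\<rceil>"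
  have k: "p * b \<le> real k" "real k < p * b + 1" using pb ceiling_correct[of "p * b"] by (auto simp: k_def)
  have k0: "k > 0" using k(1) pb by (cases k) auto
  \<comment> \<open>Conjugate exponents satisfy \<alpha> \<beta> \<ge> 4, whence
    max(\<alpha>,\<beta>) \<ge> 8 b. So p max(\<alpha>,\<beta>) exceeds 4 p b by at least 4 p b > 4,
    which is the room for rounding.\<close>
  have "\<alpha> * \<beta> = \<alpha> + \<beta>" using ab by (simp add: field_simps)
  moreover have "4 * (\<alpha> * \<beta>) \<le> (\<alpha> + \<beta>)\<^sup>2"
    using zero_le_power2[of "\<alpha> - \<beta>"] by (simp add: power2_eq_square algebra_simps)
  ultimately have "4 * (\<alpha> * \<beta>) \<le> (\<alpha> * \<beta>) * (\<alpha> * \<beta>)" by (simp add: power2_eq_square)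
  then have "4 \<le> \<alpha> * \<beta>" using ab by (simp add: mult_le_cancel_right)
  also have "\<alpha> * \<beta> \<le> max \<alpha> \<beta> * \<beta>" using ab by (intro mult_right_mono) auto
  finally have a: "4 \<le> max \<alpha> \<beta> * \<beta>" .
  have "4 * b \<le> max \<alpha> \<beta> - 4 * b"
    using a ab by (simp add: b_def field_simps)
  moreover have "max \<alpha> \<beta> = (max \<alpha> \<beta> * \<beta>) * (2 * b)" using ab by (simp add: b_def)
  ultimately have "4 \<le> p * (max \<alpha> \<beta> - 4 * b)"
  proof -
    have "4 * b * p \<le> (max \<alpha> \<beta> - 4 * b) * p"
      using \<open>4 * b \<le> max \<alpha> \<beta> - 4 * b\<close> p by (intro mult_right_mono) auto
    moreover have "4 * b * p = 4 * (p * b)" by simp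
    ultimately show ?thesis using pb unfolding mult.commute[of p "max \<alpha> \<beta> - 4 * b"] by linarith
  qed
  then have 1: "4 * real k \<le> p * max \<alpha> \<beta>"
    using k(2) by (simp add: algebra_simps)
  have r2: "r < 1 / 2" using r(2) b(2) \<theta>(1) unfolding b_def[symmetric] by linarith
  have tp: "\<theta> * p \<le> p * (b - r)"
    using r p by (simp add: b_def mult.commute)
  have 2: "\<theta> * p \<le> real k * (1 - 2 * r)"
  \<comment> \<open>It suffices to reach p (b - r). If 2k \<le> p, the loss 2kr is at most pr and k
    \<ge> pb. Otherwise k > p/2, and p/2 - pr is enough because b < 1/2.\<close>
  proof (cases "2 * real k \<le> p")
    case True
    have "2 * real k * r \<le> p * r" using True r by (intro mult_right_mono) auto
    then show ?thesis using tp k(1) by (simp add: algebra_simps)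
  next
    case False
    have "p / 2 * (1 - 2 * r) \<le> real k * (1 - 2 * r)"
      using False r2 by (intro mult_right_mono) auto
    moreover have "p * b \<le> p / 2" using b p by simp
    ultimately show ?thesis using tp by (simp add: algebra_simps)
  qed
  show ?thesis
    using 1 2 k0 that[of "k - 1"] by simp
qed

lemma mesh_ge:
  assumes "i < m n" "tp n i \<le> tp n (Suc i)"
  shows "tp n (Suc i) - tp n i \<le> mesh tp m n"
proof -
  have "finite {\<bar>tp n (Suc i) - tp n i\<bar> | i. i < m n}" by simp
  moreover have "tp n (Suc i) - tp n i \<in> {\<bar>tp n (Suc i) - tp n i\<bar> | i. i < m n}"
    using assms by (auto intro!: exI[of _ i])
  ultimately show ?thesis unfolding mesh_def by (rule Max_ge)
qed

theorem mainTheorem8: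
  fixes M :: "'a measure" and F :: "real \<Rightarrow> 'a set set"
    and W \<sigma> H :: "real \<Rightarrow> 'a \<Rightarrow> real" and x :: real
    and tp :: "nat \<Rightarrow> nat \<Rightarrow> real" and m :: "nat \<Rightarrow> nat"
    and p \<alpha> \<beta> \<theta> r K :: real and NN MM :: "nat \<Rightarrow> nat" and \<epsilon> :: "nat \<Rightarrow> real"
  assumes "prob_space M"
    and "filtration_on M F" and "usual_conditions M F"
    and "brownian_motion M F W"
    and "progressive M F \<sigma>"
    and "\<forall>w\<in>space M. continuous_on {-pi..pi} (\<lambda>t. \<sigma> t w)"
    and "is_ito_process M x \<sigma> W H"
    and "partitions tp m"
    and "p > 2" and "\<alpha> > 1" and "\<beta> > 1" and "1 / \<alpha> + 1 / \<beta> = 1"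
    and "cond_I M (p * max \<alpha> \<beta>) \<sigma>"
    and "0 < \<theta>" and "\<theta> < 1 / (2 * \<beta>)"
    and "0 < r" and "r < min (1 / (2 * \<beta>) - \<theta>) (\<theta> * p - 1)"
    and "\<forall>n. NN n > 0"
    and "\<forall>n. \<epsilon> n = 5 * mesh tp m n + A_const (2 * \<beta>) / (2 * real (NN n) + 1)"
    and "summable (\<lambda>n. \<epsilon> n powr (\<theta> * p - r))"
    and "K > 0"
    and "\<forall>n. MM n > 0 \<and> real (MM n) \<le> K * \<epsilon> n powr (- r)"
  shows "AE w in M.
     (\<lambda>n. SUP t\<in>{-pi..pi}. cmod (T_poly (MM n) (\<lambda>s. (\<sigma> s w)\<^sup>2) t
                                 - T_B_poly tp m H n (NN n) (MM n) w t)) \<longlonglongrightarrow> 0"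
proof -
  interpret filtered_brownian_motion M F W
    using assms(1,2,4) by (simp add: filtered_brownian_motion_def filtered_brownian_motion_axioms_def)
  have X: "path_integrand \<sigma>" by (rule progressive_path_integrand[OF assms(5,6)])
  have part: "tp n 0 = - pi" "tp n (m n) = pi" "\<And>i. i < m n \<Longrightarrow> tp n i \<le> tp n (Suc i)" for n
    using assms(8) by (auto simp: partitions_def)
  have grid_n: "grid (tp n) (m n)" for n
    by (rule gridI) (use part in auto)
  have step: "tp n (Suc i) - tp n i \<le> mesh tp m n" if "i < m n" for n i
    by (rule mesh_ge[of i m n tp, OF that part(3)[OF that]])
  have rho: "0 \<le> mesh tp m n" for n
  proof -
    \<comment> \<open>The end points differ, so there is at least one cell, whose length is
      nonnegative and at most \<open>mesh\<close>.\<close>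
    have "m n \<noteq> 0" using part(1,2)[of n] by (metis less_irrefl pi_gt_zero neg_less_0_iff_less less_trans)
    then show ?thesis using step[of 0 n] part(3)[of 0 n] by simp
  qed
  \<comment> \<open>As 2 \<beta> > 1, the fraction in \<open>A_const\<close> is nonnegative. Thus
    \<epsilon> dominates 5 times the quantity that controls the kernel rows.\<close>
  have A5: "A_const (2 * \<beta>) \<ge> 5" using \<open>\<beta> > 1\<close> by (simp add: A_const_def)
  have eps_ge: "5 * (mesh tp m n + 1 / (2 * real (NN n) + 1)) \<le> \<epsilon> n" for n
    using A5 assms(19) by (simp add: divide_right_mono)
  have eps_pos: "\<epsilon> n > 0" for n
    using rho[of n] by (intro less_le_trans[OF _ eps_ge[of n]]) (auto intro!: add_nonneg_pos divide_pos_pos)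
  have rho_eps: "mesh tp m n \<le> \<epsilon> n" for n
  proof -
    have "mesh tp m n \<le> 5 * (mesh tp m n + z)" if "z \<ge> 0" for z
      using that rho[of n] by simp
    from order_trans[OF this eps_ge] show ?thesis by simp
  qed
  have r: "r < 1 / (2 * \<beta>) - \<theta>" "r < \<theta> * p - 1" using assms(17) by auto
  obtain i where i: "real (4 * Suc i) \<le> p * max \<alpha> \<beta>" "\<theta> * p \<le> real (Suc i) * (1 - 2 * r)"
    using exists_even_exponent[OF assms(9-12,14-16) r] by blast
  \<comment> \<open>The half-order is \<open>Suc i\<close>; \<open>s\<close> is even, so that powers
    of signed errors are nonnegative.\<close>
  define s where "s = 2 * Suc i"
  have pmax: "p * max \<alpha> \<beta> > 0" using assms(9-11) by (intro mult_pos_pos) auto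
  obtain B where B: "B \<ge> 0" "(\<integral>\<^sup>+ w. ennreal (integral {-pi..pi} (\<lambda>u. \<sigma> u w ^ (4 * Suc i))) \<partial>M) \<le> ennreal B"
    using cond_I_moment[OF X assms(13) _ i(1) pmax] by auto

  define v where "v w = (\<lambda>u. (\<sigma> u w)\<^sup>2)" for w
  define Q where "Q e n w = form_error e (tp n) (m n) (\<lambda>k. H (tp n (Suc k)) w - H (tp n k) w) (v w)"
    for e :: "nat \<Rightarrow> nat \<Rightarrow> real" and n w
  \<comment> \<open>The rows are bounded by 8 pi (...) \<le> 2 pi * 5 (...) \<le> 2 pi \<epsilon>,
    so the budget is \<open>2 * pi * \<epsilon> n\<close>; its power supplies
    \<open>(2 * pi) ^ Suc i\<close>.\<close>
  define C where "C = chaos_const i * (2 * pi) ^ Suc i * B"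
  have C0: "C \<ge> 0" using B chaos_const_pos[of i] by (simp add: C_def)
  have Q_moment: "integrable M (\<lambda>w. Q e n w ^ s)" "expectation (\<lambda>w. Q e n w ^ s) \<le> C * \<epsilon> n ^ Suc i"
    if e: "\<And>k j. \<bar>e k j\<bar> \<le> \<bar>dirichlet (NN n) (tp n k - tp n j)\<bar>" for e n
  proof -
    have G: "(\<Sum>j<m n. (e k j + e j k)\<^sup>2 * (tp n (Suc j) - tp n j)) \<le> 2 * pi * \<epsilon> n" for k
    proof -
      have "(\<Sum>j<m n. (e k j + e j k)\<^sup>2 * (tp n (Suc j) - tp n j)) \<le> 8 * pi * (mesh tp m n + 1 / (2 * real (NN n) + 1))"
        using assms(18) by (intro kernel_row_sum part step rho e) auto
      also have "\<dots> \<le> 2 * pi * (5 * (mesh tp m n + 1 / (2 * real (NN n) + 1)))"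
      proof -
        have "8 * pi * z \<le> 2 * pi * (5 * z)" if "z \<ge> 0" for z
          using that by simp
        then show ?thesis using rho[of n] by (auto intro!: add_nonneg_nonneg simp del: distrib_left_numeral)
      qed
      also have "\<dots> \<le> 2 * pi * \<epsilon> n" by (intro mult_left_mono eps_ge) auto
      finally show ?thesis .
    qed
    have G0: "2 * pi * \<epsilon> n > 0" using eps_pos by simp
    note q = quadratic_form_moment[OF grid_n part(1,2) X assms(7) G0 G B(2,1)]
    have Qeq: "Q e n = (\<lambda>w. (\<Sum>k<m n. \<Sum>j<m n. e k j * (H (tp n (Suc k)) w - H (tp n k) w) * (H (tp n (Suc j)) w - H (tp n j) w))
         - (\<Sum>k<m n. e k k * integral {tp n k..tp n (Suc k)} (\<lambda>u. (\<sigma> u w)\<^sup>2)))"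
      by (simp add: Q_def form_error_def v_def fun_eq_iff)
    have meas: "Q e n \<in> borel_measurable M" unfolding Qeq by (rule q(1))
    have "(\<integral>\<^sup>+ w. ennreal (Q e n w ^ s) \<partial>M) \<le> ennreal (chaos_const i * (2 * pi * \<epsilon> n) ^ Suc i * B)"
      unfolding Qeq s_def by (rule q(2))
    also have "chaos_const i * (2 * pi * \<epsilon> n) ^ Suc i * B = C * \<epsilon> n ^ Suc i"
      unfolding C_def power_mult_distrib by (simp only: mult_ac)
    finally have "(\<integral>\<^sup>+ w. ennreal (Q e n w ^ s) \<partial>M) \<le> ennreal (C * \<epsilon> n ^ Suc i)" .
    note bound = integrable_of_nn_integral_le[OF _ _ this]
    show "integrable M (\<lambda>w. Q e n w ^ s)" "expectation (\<lambda>w. Q e n w ^ s) \<le> C * \<epsilon> n ^ Suc i"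
      using bound meas C0 eps_pos[of n] by (auto simp: s_def zero_le_even_power less_imp_le simp del: power_Suc mult_Suc_right)
  qed

  define L where "L n = 2 * real (MM n) + 1" for n
  define QC where "QC n q w = Q (kernel_cos (tp n) (NN n) q) n w" for n q w
  define QS where "QS n q w = Q (kernel_sin (tp n) (NN n) q) n w" for n q w
  \<comment> \<open>A majorant for the power \<open>s\<close> of the summed errors over all
    frequencies: \<open>L n ^ s\<close> comes from pulling the power into the sum,
    \<open>2 ^ s\<close> from separating cosine and sine parts. Its mean is linear in the moments
    already bounded.\<close>
  define U where "U n w = L n ^ s * (\<Sum>q\<in>{- int (MM n)..int (MM n)}. 2 ^ s * (QC n q w ^ s + QS n q w ^ s))" for n w
  have QC_m: "integrable M (\<lambda>w. QC n q w ^ s)" "expectation (\<lambda>w. QC n q w ^ s) \<le> C * \<epsilon> n ^ Suc i" for n q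
    unfolding QC_def by (rule Q_moment, rule kernel_cos_le)+
  have QS_m: "integrable M (\<lambda>w. QS n q w ^ s)" "expectation (\<lambda>w. QS n q w ^ s) \<le> C * \<epsilon> n ^ Suc i" for n q
    unfolding QS_def by (rule Q_moment, rule kernel_sin_le)+
  have L0: "L n > 0" for n by (simp add: L_def)
  have U_le: "expectation (U n) \<le> 2 ^ Suc s * C * (L n ^ Suc s * \<epsilon> n ^ Suc i)" for n
  proof -
    have "expectation (U n) = L n ^ s * (\<Sum>q\<in>{- int (MM n)..int (MM n)}. 2 ^ s * (expectation (\<lambda>w. QC n q w ^ s) + expectation (\<lambda>w. QS n q w ^ s)))"
      unfolding U_def[abs_def] using QC_m(1) QS_m(1) by simp
    also have "\<dots> \<le> L n ^ s * (\<Sum>q\<in>{- int (MM n)..int (MM n)}. 2 ^ s * (C * \<epsilon> n ^ Suc i + C * \<epsilon> n ^ Suc i))"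
      using L0[of n] by (intro mult_left_mono sum_mono add_mono QC_m QS_m) auto
    also have "\<dots> = L n ^ s * (L n * (2 ^ s * (C * \<epsilon> n ^ Suc i + C * \<epsilon> n ^ Suc i)))"
      by (simp add: L_def)
    also have "\<dots> = 2 ^ Suc s * C * (L n ^ Suc s * \<epsilon> n ^ Suc i)"
      unfolding power_Suc by (simp add: algebra_simps)
    finally show ?thesis .
  qed
  have L_le: "L n \<le> 3 * K * \<epsilon> n powr (- r)" for n
  proof -
    have "1 \<le> real (MM n)" "real (MM n) \<le> K * \<epsilon> n powr (- r)"
      using assms(22) by (auto simp: Suc_le_eq)
    then show ?thesis by (simp add: L_def)
  qed
  have eps_lim: "\<epsilon> \<longlonglongrightarrow> 0"
  proof -
    have e: "\<theta> * p - r > 0" using r by simp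
    have "(\<lambda>n. (\<epsilon> n powr (\<theta> * p - r)) powr (1 / (\<theta> * p - r))) \<longlonglongrightarrow> 0"
      using e by (intro tendsto_zero_powrI[OF summable_LIMSEQ_zero[OF assms(20)] tendsto_const]) auto
    then show ?thesis using e eps_pos by (simp add: powr_powr less_imp_le)
  qed
  \<comment> \<open>With L of order \<epsilon>^(-r), the exponent is (i+1)(1-2r) - r, which is at
    least \<theta> p - r by the choice of \<open>i\<close>. Comparing powers needs \<epsilon> \<le>
    1, hence only eventual domination.\<close>
  have U_sum: "summable (\<lambda>n. 2 ^ Suc s * C * (L n ^ Suc s * \<epsilon> n ^ Suc i))"
  proof (rule summable_comparison_test_ev[OF _ summable_mult[OF assms(20), of "2 ^ Suc s * C * (3 * K) ^ Suc s"]])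
    have "eventually (\<lambda>n. \<epsilon> n \<le> 1) sequentially"
      using order_tendstoD(2)[OF eps_lim, of 1] by (auto elim!: eventually_mono)
    then show "eventually (\<lambda>n. norm (2 ^ Suc s * C * (L n ^ Suc s * \<epsilon> n ^ Suc i))
        \<le> 2 ^ Suc s * C * (3 * K) ^ Suc s * \<epsilon> n powr (\<theta> * p - r)) sequentially"
    proof eventually_elim
      fix n assume e1: "\<epsilon> n \<le> 1"
      have "L n ^ Suc s * \<epsilon> n ^ Suc i \<le> (3 * K * \<epsilon> n powr (- r)) ^ Suc s * \<epsilon> n ^ Suc i"
        using L_le[of n] L0[of n] eps_pos[of n] by (intro mult_right_mono power_mono) auto
      also have "\<dots> = (3 * K) ^ Suc s * ((\<epsilon> n powr (- r)) powr real (Suc s) * \<epsilon> n powr real (Suc i))"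
        using eps_pos[of n] by (simp only: power_mult_distrib powr_realpow powr_gt_zero mult.assoc)
      also have "(\<epsilon> n powr (- r)) powr real (Suc s) * \<epsilon> n powr real (Suc i) = \<epsilon> n powr (- r * real (Suc s) + real (Suc i))"
        unfolding powr_powr powr_add ..
      also have "(3 * K) ^ Suc s * \<epsilon> n powr (- r * real (Suc s) + real (Suc i)) \<le> (3 * K) ^ Suc s * \<epsilon> n powr (\<theta> * p - r)"
      proof (intro mult_left_mono powr_mono' e1)
        have "- r * real (Suc s) + real (Suc i) = real (Suc i) * (1 - 2 * r) - r"
          by (simp add: s_def algebra_simps)
        then show "\<theta> * p - r \<le> - r * real (Suc s) + real (Suc i)" using i(2) by linarith
      qed (use eps_pos[of n] assms(21) in auto)
      finally have "2 ^ Suc s * C * (L n ^ Suc s * \<epsilon> n ^ Suc i) \<le> 2 ^ Suc s * C * ((3 * K) ^ Suc s * \<epsilon> n powr (\<theta> * p - r))"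
        using C0 by (intro mult_left_mono) auto
      moreover have "0 \<le> 2 ^ Suc s * C * (L n ^ Suc s * \<epsilon> n ^ Suc i)"
        using C0 L0[of n] eps_pos[of n] by (intro mult_nonneg_nonneg zero_le_power) auto
      ultimately show "norm (2 ^ Suc s * C * (L n ^ Suc s * \<epsilon> n ^ Suc i)) \<le> 2 ^ Suc s * C * (3 * K) ^ Suc s * \<epsilon> n powr (\<theta> * p - r)"
        by (simp only: real_norm_def abs_of_nonneg mult.assoc)
    qed
  qed
  have even_s: "0 \<le> z ^ s" for z :: real by (simp add: s_def zero_le_even_power del: power_Suc mult_Suc_right)
  have "AE w in M. (\<lambda>n. U n w) \<longlonglongrightarrow> 0"
  proof (rule AE_tendsto_zero_of_summable_integrals[OF _ _ U_le U_sum])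
    show "integrable M (U n)" for n
      unfolding U_def[abs_def] using QC_m(1) QS_m(1) by simp
    show "0 \<le> U n w" for n w
      unfolding U_def by (intro mult_nonneg_nonneg sum_nonneg add_nonneg_nonneg even_s)
  qed
  then show ?thesis
    using AE_space
  proof eventually_elim
    fix w assume U0: "(\<lambda>n. U n w) \<longlonglongrightarrow> 0" and w: "w \<in> space M"
    define V where "V = integral {-pi..pi} (v w)"
    define S where "S n = (\<Sum>q\<in>{- int (MM n)..int (MM n)}. \<bar>QC n q w\<bar> + \<bar>QS n q w\<bar>)" for n
    have vc: "continuous_on {-pi..pi} (v w)" 
      unfolding v_def using assms(6) w by (auto intro!: continuous_intros)
    have v0: "v w u \<ge> 0" for u by (simp add: v_def)
    have V0: "V \<ge> 0" 
      unfolding V_def using vc v0 by (intro Henstock_Kurzweil_Integration.integral_nonneg integrable_continuous_interval) auto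
    have S0: "S n \<ge> 0" for n unfolding S_def by (intro sum_nonneg) auto
    have SU: "S n ^ s \<le> U n w" for n
    proof -
      have "S n ^ s \<le> real (card {- int (MM n)..int (MM n)}) ^ s * (\<Sum>q\<in>{- int (MM n)..int (MM n)}. (\<bar>QC n q w\<bar> + \<bar>QS n q w\<bar>) ^ s)"
        unfolding S_def by (rule sum_power_le_card) auto
      also have "real (card {- int (MM n)..int (MM n)}) = L n" by (simp add: L_def)
      also have "L n ^ s * (\<Sum>q\<in>{- int (MM n)..int (MM n)}. (\<bar>QC n q w\<bar> + \<bar>QS n q w\<bar>) ^ s) \<le> U n w"
        unfolding U_def using L0[of n] 
        by (intro mult_left_mono sum_mono) (auto simp: s_def abs_add_power_le simp del: power_Suc mult_Suc_right)
      finally show ?thesis .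
    qed
    have S_lim: "S \<longlonglongrightarrow> 0"
    proof (rule LIMSEQ_I)
      fix e :: real assume e: "e > 0"
      have "eventually (\<lambda>n. U n w < e ^ s) sequentially"
        using order_tendstoD(2)[OF U0, of "e ^ s"] e by simp
      then obtain n0 where n0: "\<And>n. n \<ge> n0 \<Longrightarrow> U n w < e ^ s"
        unfolding eventually_sequentially by blast
      have "S n < e" if "n \<ge> n0" for n
        using power_less_imp_less_base[OF le_less_trans[OF SU n0[OF that]]] e by simp
      then show "\<exists>no. \<forall>n\<ge>no. norm (S n - 0) < e" using S0 by auto
    qed
    define T where "T n = L n * (real (MM n) * mesh tp m n * V)" for n
    have T0: "T n \<ge> 0" for n
      unfolding T_def using L0[of n] rho V0 by (intro mult_nonneg_nonneg) auto
    have T_lim: "T \<longlonglongrightarrow> 0"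
    proof (rule tendsto_sandwich[OF _ _ tendsto_const])
      have r2: "1 - 2 * r > 0"
      proof -
        have "1 / (2 * \<beta>) < 1 / 2" using assms(11) by (simp add: field_simps)
        then show ?thesis using r(1) assms(14) by linarith
      qed
      have "T n \<le> 3 * K * K * V * \<epsilon> n powr (1 - 2 * r)" for n
      proof -
        have "T n \<le> (3 * K * \<epsilon> n powr (- r)) * ((K * \<epsilon> n powr (- r)) * \<epsilon> n * V)"
          unfolding T_def using L_le[of n] L0[of n] assms(21,22) rho[of n] rho_eps[of n] V0 eps_pos[of n]
          by (intro mult_mono mult_nonneg_nonneg) auto
        also have "\<dots> = 3 * K * K * V * (\<epsilon> n powr (- r) * \<epsilon> n powr (- r) * \<epsilon> n powr 1)"
          using eps_pos[of n] by simp
        also have "\<epsilon> n powr (- r) * \<epsilon> n powr (- r) * \<epsilon> n powr 1 = \<epsilon> n powr (1 - 2 * r)"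
          by (simp only: powr_add[symmetric]) simp
        finally show ?thesis .
      qed
      then show "eventually (\<lambda>n. T n \<le> 3 * K * K * V * \<epsilon> n powr (1 - 2 * r)) sequentially" by simp
      show "(\<lambda>n. 3 * K * K * V * \<epsilon> n powr (1 - 2 * r)) \<longlonglongrightarrow> 0"
        using r2 eps_pos by (intro tendsto_mult_right_zero tendsto_zero_powrI[OF eps_lim tendsto_const]) (auto simp: less_imp_le)
    qed (use T0 in simp)
    let ?D = "\<lambda>n t. cmod (T_poly (MM n) (\<lambda>s. (\<sigma> s w)\<^sup>2) t - T_B_poly tp m H n (NN n) (MM n) w t)"
    have D_le: "?D n t \<le> S n + T n" for n t
    proof -
      have "?D n t \<le> (\<Sum>q\<in>{- int (MM n)..int (MM n)}. cmod (fourier (v w) q - fourier_B tp m H n (NN n) q w))"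
        unfolding v_def using assms(22) by (intro T_poly_diff_le) auto
      also have "\<dots> \<le> (\<Sum>q\<in>{- int (MM n)..int (MM n)}. (\<bar>QC n q w\<bar> + \<bar>QS n q w\<bar>) + real (MM n) * mesh tp m n * V)"
      proof (rule sum_mono)
        fix q assume "q \<in> {- int (MM n)..int (MM n)}"
        then have q: "\<bar>real_of_int q\<bar> \<le> real (MM n)" by auto
        have "cmod (fourier (v w) q - fourier_B tp m H n (NN n) q w)
           \<le> \<bar>QC n q w\<bar> + \<bar>QS n q w\<bar> + \<bar>of_int q\<bar> * mesh tp m n * V"
          unfolding QC_def QS_def Q_def V_def by (intro fourier_error part step vc v0 rho)
        also have "\<bar>of_int q\<bar> * mesh tp m n * V \<le> real (MM n) * mesh tp m n * V"
          using q rho V0 by (intro mult_right_mono) auto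
        finally show "cmod (fourier (v w) q - fourier_B tp m H n (NN n) q w)
           \<le> (\<bar>QC n q w\<bar> + \<bar>QS n q w\<bar>) + real (MM n) * mesh tp m n * V" by simp
      qed
      also have "\<dots> = S n + T n"
        by (simp only: sum.distrib S_def T_def L_def) simp
      finally show ?thesis .
    qed
    show "(\<lambda>n. SUP t\<in>{-pi..pi}. ?D n t) \<longlonglongrightarrow> 0"
    proof (rule tendsto_sandwich[OF _ _ tendsto_const])
      show "(\<lambda>n. S n + T n) \<longlonglongrightarrow> 0"
        using tendsto_add[OF S_lim T_lim] by simp
      have "(SUP t\<in>{-pi..pi}. ?D n t) \<le> S n + T n" for n
        using D_le by (intro cSUP_least) auto
      then show "eventually (\<lambda>n. (SUP t\<in>{-pi..pi}. ?D n t) \<le> S n + T n) sequentially" by simp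
      \<comment> \<open>The real supremum lies above its members only for bounded families; the
        bound S + T, uniform in \<open>t\<close>, provides this.\<close>
      have "0 \<le> (SUP t\<in>{-pi..pi}. ?D n t)" for n
      proof -
        have "?D n 0 \<le> (SUP t\<in>{-pi..pi}. ?D n t)"
          by (rule cSUP_upper) (auto intro!: bdd_aboveI[of _ "S n + T n"] D_le)
        then show ?thesis by (rule order_trans[OF norm_ge_zero])
      qed
      then show "eventually (\<lambda>n. 0 \<le> (SUP t\<in>{-pi..pi}. ?D n t)) sequentially" by simp
    qed
  qed
qed

end
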